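(* Let $G$ be any finitely generated subgroup of the Higman group $H$. Then either $G$ is cyclic or $G$ has uniform exponential growth with $w(G)\ge\sqrt[600]{2}$.
   Context: The Higman group is $H=\langle a_i,\ i\in\mathbb{Z}/4\mathbb{Z} \mid a_i a_{i+1}a_i^{-1}=a_{i+1}^2,\ i\in\mathbb{Z}/4\mathbb{Z}\rangle$. For a group $G$ with finite generating set $S$, let $B(n,S)$ be the ball of radius $n$ in the Cayley graph of $G$ with respect to $S$, $w(G,S)=\lim_{n\to\infty}|B(n,S)|^{1/n}$, and $w(G)=\inf\{w(G,S)\mid S \text{ a finite generating set of } G\}$. The group $G$ has uniform exponential growth if $w(G)>1$. *)

theory Defs
  imports
    Complex_Main
    "HOL-Algebra.Algebra"
    "HOL-Library.Numeral_Type"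
begin

section \<open>Groups given by generators and relations\<close>

text \<open>A letter \<open>(x, True)\<close> stands for the generator \<open>x\<close> and \<open>(x, False)\<close> for its formal inverse.
  A relation \<open>u = v\<close> is the pair \<open>(u, v)\<close> of words.\<close>

type_synonym 'g group_word = "('g \<times> bool) list"

inductive pres_eq :: "('g group_word \<times> 'g group_word) set \<Rightarrow> 'g group_word \<Rightarrow> 'g group_word \<Rightarrow> bool"
  for R where
  relation: "(u, v) \<in> R \<Longrightarrow> pres_eq R u v"
| cancel: "pres_eq R [(x, b), (x, \<not> b)] []"
| refl: "pres_eq R u u"
| sym: "pres_eq R u v \<Longrightarrow> pres_eq R v u"
| trans: "pres_eq R u v \<Longrightarrow> pres_eq R v w \<Longrightarrow> pres_eq R u w"
| append: "pres_eq R u u' \<Longrightarrow> pres_eq R v v' \<Longrightarrow> pres_eq R (u @ v) (u' @ v')"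

definition pres_class :: "('g group_word \<times> 'g group_word) set \<Rightarrow> 'g group_word \<Rightarrow> 'g group_word set"
  where "pres_class R u = {v. pres_eq R u v}"

definition presented_group :: "('g group_word \<times> 'g group_word) set \<Rightarrow> 'g group_word set monoid"
  where "presented_group R =
    \<lparr>carrier = range (pres_class R),
     monoid.mult = (\<lambda>A B. \<Union>u\<in>A. \<Union>v\<in>B. pres_class R (u @ v)),
     one = pres_class R []\<rparr>"

lemma pres_class_eq_iff: "pres_class R u = pres_class R v \<longleftrightarrow> pres_eq R u v"
  unfolding pres_class_def set_eq_iff mem_Collect_eq
  by (metis pres_eq.refl pres_eq.sym pres_eq.trans)

lemma carrier_presented_group: "carrier (presented_group R) = range (pres_class R)"
  by (simp add: presented_group_def)

lemma one_presented_group: "\<one>\<^bsub>presented_group R\<^esub> = pres_class R []"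
  by (simp add: presented_group_def)

lemma mult_presented_group:
  "pres_class R u \<otimes>\<^bsub>presented_group R\<^esub> pres_class R v = pres_class R (u @ v)"
proof -
  have *: "pres_class R (u' @ v') = pres_class R (u @ v)"
    if "u' \<in> pres_class R u" "v' \<in> pres_class R v" for u' v'
    using that unfolding pres_class_eq_iff unfolding pres_class_def
    by (simp add: pres_eq.append pres_eq.sym)
  have nonempty: "pres_class R w \<noteq> {}" for w
    using pres_eq.refl[of R w] by (auto simp: pres_class_def)
  have "pres_class R u \<otimes>\<^bsub>presented_group R\<^esub> pres_class R v
      = (\<Union>u'\<in>pres_class R u. \<Union>v'\<in>pres_class R v. pres_class R (u' @ v'))"
    by (simp add: presented_group_def)
  also have "\<dots> = (\<Union>u'\<in>pres_class R u. \<Union>v'\<in>pres_class R v. pres_class R (u @ v))"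
    by (intro SUP_cong * HOL.refl)
  also have "\<dots> = pres_class R (u @ v)"
    by (simp add: nonempty)
  finally show ?thesis .
qed

definition inverse_word :: "'g group_word \<Rightarrow> 'g group_word"
  where "inverse_word u = rev (map (\<lambda>(x, b). (x, \<not> b)) u)"

lemma pres_eq_inverse_word: "pres_eq R (inverse_word u @ u) []"
proof (induction u)
  case Nil
  then show ?case by (simp add: inverse_word_def pres_eq.refl)
next
  case (Cons a u)
  obtain x b where a: "a = (x, b)" by (cases a)
  have "pres_eq R [(x, \<not> b), (x, b)] []"
    using pres_eq.cancel[of R x "\<not> b"] by simp
  then have "pres_eq R (inverse_word u @ [(x, \<not> b), (x, b)] @ u) (inverse_word u @ [] @ u)"
    by (intro pres_eq.append pres_eq.refl)
  from pres_eq.trans[OF this] Cons show ?case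
    by (simp add: a inverse_word_def)
qed

lemma group_presented_group: "group (presented_group R)"
proof (rule groupI, goal_cases)
  case (5 A)
  then obtain u where "A = pres_class R u" by (auto simp: carrier_presented_group)
  then have "pres_class R (inverse_word u) \<otimes>\<^bsub>presented_group R\<^esub> A = \<one>\<^bsub>presented_group R\<^esub>"
    by (simp add: mult_presented_group one_presented_group pres_class_eq_iff pres_eq_inverse_word)
  then show ?case by (auto simp: carrier_presented_group)
qed (auto simp: carrier_presented_group one_presented_group mult_presented_group)


section \<open>The Higman group\<close>

text \<open>The numeral type \<open>4\<close> is the ring of integers modulo 4, so \<open>i + 1\<close> is cyclic.\<close>

definition higman_relations :: "(4 group_word \<times> 4 group_word) set"
  where "higman_relations =
    {([(i, True), (i + 1, True), (i, False)], [(i + 1, True), (i + 1, True)]) | i. i \<in> UNIV}"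

definition higman_group :: "4 group_word set monoid"
  where "higman_group = presented_group higman_relations"

definition higman_gen :: "4 \<Rightarrow> 4 group_word set"
  where "higman_gen i = pres_class higman_relations [(i, True)]"

lemma group_higman_group: "group higman_group"
  unfolding higman_group_def by (rule group_presented_group)

lemma higman_gen_closed: "higman_gen i \<in> carrier higman_group"
  by (simp add: higman_gen_def higman_group_def carrier_presented_group)

lemma inv_higman_gen:
  "inv\<^bsub>higman_group\<^esub> (higman_gen i) = pres_class higman_relations [(i, False)]"
proof -
  have "pres_eq higman_relations [(i, False), (i, True)] []"
    using pres_eq.cancel[of higman_relations i False] by simp
  then have "pres_class higman_relations [(i, False)] \<otimes>\<^bsub>higman_group\<^esub> higman_gen i
      = \<one>\<^bsub>higman_group\<^esub>"
    by (simp add: higman_gen_def higman_group_def mult_presented_group one_presented_group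
        pres_class_eq_iff)
  then show ?thesis
    by (intro group.inv_equality[OF group_higman_group])
      (auto simp: higman_gen_def higman_group_def carrier_presented_group)
qed

lemma higman_relation:
  "higman_gen i \<otimes>\<^bsub>higman_group\<^esub> higman_gen (i + 1) \<otimes>\<^bsub>higman_group\<^esub> inv\<^bsub>higman_group\<^esub> (higman_gen i)
    = higman_gen (i + 1) [^]\<^bsub>higman_group\<^esub> (2::nat)"
proof -
  interpret group higman_group by (rule group_higman_group)
  have "higman_gen (i + 1) [^]\<^bsub>higman_group\<^esub> (2::nat)
      = higman_gen (i + 1) \<otimes>\<^bsub>higman_group\<^esub> higman_gen (i + 1)"
    by (simp add: numeral_2_eq_2 higman_gen_closed)
  moreover have "pres_eq higman_relations
      [(i, True), (i + 1, True), (i, False)] [(i + 1, True), (i + 1, True)]"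
    by (rule pres_eq.relation) (auto simp: higman_relations_def)
  ultimately show ?thesis
    unfolding inv_higman_gen
    by (simp add: higman_gen_def higman_group_def mult_presented_group pres_class_eq_iff)
qed


section \<open>Growth\<close>

definition finite_generating_set :: "('a, 'b) monoid_scheme \<Rightarrow> 'a set \<Rightarrow> bool"
  where "finite_generating_set G S \<longleftrightarrow>
    finite S \<and> S \<subseteq> carrier G \<and> generate G S = carrier G"

definition finitely_generated_group :: "('a, 'b) monoid_scheme \<Rightarrow> bool"
  where "finitely_generated_group G \<longleftrightarrow> group G \<and> (\<exists>S. finite_generating_set G S)"

text \<open>Edges may be traversed in both directions; \<open>S\<close> need not be symmetric.\<close>

definition cayley_edges :: "('a, 'b) monoid_scheme \<Rightarrow> 'a set \<Rightarrow> ('a \<times> 'a) set"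
  where "cayley_edges G S = {(x, y). x \<in> carrier G \<and> y \<in> carrier G \<and>
    (\<exists>s\<in>S. y = x \<otimes>\<^bsub>G\<^esub> s \<or> x = y \<otimes>\<^bsub>G\<^esub> s)}"

definition cayley_ball :: "('a, 'b) monoid_scheme \<Rightarrow> nat \<Rightarrow> 'a set \<Rightarrow> 'a set"
  where "cayley_ball G n S = {x. \<exists>m\<le>n. (\<one>\<^bsub>G\<^esub>, x) \<in> cayley_edges G S ^^ m}"

definition growth_rate :: "('a, 'b) monoid_scheme \<Rightarrow> 'a set \<Rightarrow> real"
  where "growth_rate G S = lim (\<lambda>n. root n (real (card (cayley_ball G n S))))"

definition uniform_growth_rate :: "('a, 'b) monoid_scheme \<Rightarrow> real"
  where "uniform_growth_rate G = Inf {growth_rate G S | S. finite_generating_set G S}"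

definition uniform_exponential_growth :: "('a, 'b) monoid_scheme \<Rightarrow> bool"
  where "uniform_exponential_growth G \<longleftrightarrow> uniform_growth_rate G > 1"

end

(* The Higman group H is, in two ways, an amalgamated product of two groups
   A_i = <a_i, a_(i+1), a_(i+2)> along a free group F_i = <a_i, a_(i+2)>, so it acts on two trees.
   A finite set S acting on a tree contains short words generating a free semigroup, unless the
   group it generates fixes a vertex or preserves a line on which one of its elements translates:
   if an element g of length at most 2 has an axis that some s in S moves, then g and s g s^-1,
   up to inversion, play ping-pong; and if all elements of length at most 2 have fixed points,
   they have a common one by the Helly property.

   Suppose S contains no short free semigroup generators.
   - A group fixing a vertex in both trees is conjugate into a Baumslag-Solitar group
     <a_i, a_(i+1)>, a group of affine maps of the real line, where one argues directly.
   - A group fixing a vertex in one tree and preserving a line in the other acts faithfully on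
     that line, because <a_i> is malnormal in <a_i, a_(i+1)>; as H is torsion-free, it is cyclic.
   - A group preserving a line in both trees acts faithfully on one of them, and is cyclic, or
     contains elements x and y that fix one line and translate the other one. Then the product of
     the two lines is a doubly periodic plane, tiled by squares indexed by H. Along it the
     exponents of the generators satisfy p = 2^q p', so they cannot stay bounded.

   All words used have length at most 4, so the growth rate is at least the 4th root of 2. *)

theory Submission
  imports Defs "HOL-Library.Product_Plus"
begin

section \<open>Groups, written additively\<close>

text \<open>The presentation of H alone does not show that its generators have infinite order or
  that its subgroups meet as expected; this needs models. The correspondence with the models is kept
  as a subgroup of a product (\<open>G2\<close>, \<open>G3\<close>). Normal forms show that the
  model coordinate determines the element of H. The converse needs a homomorphism out of H, which is
  available only once the last amalgam, where all four relations hold, has been built.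

  The two trees interact as follows. \<open>As i\<close> is a vertex group of one tree and is also
  generated by its intersections with two vertex groups of the other tree, so it has an invariant
  subtree there, its span. Fixed points can be moved into the span and axes lie in it, which turns
  information about one tree into conjugacy statements inside \<open>As i\<close>. The same holds
  for the edge group \<open>Fs i\<close>.

  Malnormality in <a_i, a_(i+1)> holds for the scaling generator a_i but not for the translation
  a_(i+1). Hence the argument on a line has to be made at a vertex of the right type.\<close>

text \<open>Groups are types of class \<^class>\<open>group_add\<close>, whose addition need not be commutative.\<close>

lemmas grp_simps = diff_conv_add_uminus add.assoc minus_add minus_minus left_minus right_minus
  add_0_left add_0_right minus_add_cancel add_minus_cancel minus_zero

definition zmul :: "int \<Rightarrow> 'a::group_add \<Rightarrow> 'a"
  where "zmul k x = (if 0 \<le> k then ((+) x ^^ nat k) 0 else ((+) (- x) ^^ nat (- k)) 0)"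

lemma zmul_0 [simp]: "zmul 0 x = 0"
  by (simp add: zmul_def)

lemma zmul_succ: "zmul (k + 1) x = x + zmul k x"
proof (cases "0 \<le> k")
  case True
  then show ?thesis by (simp add: zmul_def nat_add_distrib)
next
  case False
  then obtain n where n: "nat (- k) = Suc n" by (metis gr0_conv_Suc not_le_imp_less
        zero_less_nat_eq neg_0_less_iff_less)
  then have "nat (- (k + 1)) = n" "k = - int n - 1" using False by linarith+
  then show ?thesis using False n
    by (cases "n = 0") (auto simp: zmul_def)
qed

lemma zmul_pred: "zmul (k - 1) x = - x + zmul k x"
  using zmul_succ[of "k - 1" x] by simp

lemma zmul_add: "zmul (j + k) x = zmul j x + zmul k x"
proof (induction j rule: int_induct[where k = 0])
  case (step1 i)
  have "i + 1 + k = (i + k) + 1" by simp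
  then show ?case using step1 by (metis zmul_succ add.assoc)
next
  case (step2 i)
  have "i - 1 + k = (i + k) - 1" by simp
  then show ?case using step2 by (metis zmul_pred add.assoc)
qed simp

lemma zmul_1 [simp]: "zmul 1 x = x"
  using zmul_succ[of 0 x] by simp

lemma zmul_neg: "zmul (- k) x = - zmul k x"
  using zmul_add[of "- k" k x] by (simp add: eq_neg_iff_add_eq_0)

lemma zmul_m1 [simp]: "zmul (- 1) x = - x"
  by (simp add: zmul_neg)

lemma zmul_diff: "zmul (j - k) x = zmul j x - zmul k x"
  using zmul_add[of j "- k" x] by (simp add: zmul_neg)

lemma zmul_zero_right [simp]: "zmul k 0 = 0"
  by (induction k rule: int_induct[where k = 0]) (simp_all add: zmul_succ zmul_pred)

lemma conj_eq_0:
  assumes "- g + x + g = (0::'a::group_add)"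
  shows "x = 0"
proof -
  have "- g + x + g = - g + 0 + g" using assms by simp
  then show ?thesis unfolding add_right_cancel add_left_cancel .
qed

definition subgrp :: "'a::group_add set \<Rightarrow> bool"
  where "subgrp A \<longleftrightarrow> 0 \<in> A \<and> (\<forall>x\<in>A. \<forall>y\<in>A. x + y \<in> A) \<and> (\<forall>x\<in>A. - x \<in> A)"

lemma subgrpD:
  assumes "subgrp A"
  shows "0 \<in> A" "\<And>x y. x \<in> A \<Longrightarrow> y \<in> A \<Longrightarrow> x + y \<in> A" "\<And>x. x \<in> A \<Longrightarrow> - x \<in> A"
    "\<And>x y. x \<in> A \<Longrightarrow> y \<in> A \<Longrightarrow> x - y \<in> A" "\<And>x k. x \<in> A \<Longrightarrow> zmul k x \<in> A"
proof -
  show "x - y \<in> A" if "x \<in> A" "y \<in> A" for x y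
    using assms that unfolding subgrp_def by (metis diff_conv_add_uminus)
  show "zmul k x \<in> A" if "x \<in> A" for x k
    using assms that
    by (induction k rule: int_induct[where k = 0]) (auto simp only: zmul_succ zmul_pred zmul_0 subgrp_def)
qed (use assms in \<open>auto simp: subgrp_def\<close>)

lemma subgrp_cancel:
  assumes "subgrp A" "x \<in> A"
  shows "x + y \<in> A \<longleftrightarrow> y \<in> A" "y + x \<in> A \<longleftrightarrow> y \<in> A" "- y \<in> A \<longleftrightarrow> y \<in> A"
proof -
  show "x + y \<in> A \<longleftrightarrow> y \<in> A"
    using assms subgrpD(2)[OF assms(1)] subgrpD(3)[OF assms(1)] by (metis minus_add_cancel)
  show "y + x \<in> A \<longleftrightarrow> y \<in> A"
    using assms subgrpD(2)[OF assms(1)] subgrpD(4)[OF assms(1)] by (metis add_diff_cancel)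
  show "- y \<in> A \<longleftrightarrow> y \<in> A"
    using subgrpD(3)[OF assms(1)] by (metis minus_minus)
qed

inductive_set gen :: "'a::group_add set \<Rightarrow> 'a set" for S where
  zero: "0 \<in> gen S"
| base: "s \<in> S \<Longrightarrow> s \<in> gen S"
| add: "x \<in> gen S \<Longrightarrow> y \<in> gen S \<Longrightarrow> x + y \<in> gen S"
| uminus: "x \<in> gen S \<Longrightarrow> - x \<in> gen S"

lemma subgrp_gen [simp]: "subgrp (gen S)"
  by (auto simp: subgrp_def intro: gen.intros)

lemma gen_minimal: "subgrp A \<Longrightarrow> S \<subseteq> A \<Longrightarrow> gen S \<subseteq> A"
proof
  fix x assume "subgrp A" "S \<subseteq> A" "x \<in> gen S"
  from this(3) show "x \<in> A"
    by induction (use \<open>subgrp A\<close> \<open>S \<subseteq> A\<close> in \<open>auto simp: subgrp_def\<close>)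
qed

lemma gen_mono: "S \<subseteq> T \<Longrightarrow> gen S \<subseteq> gen T"
  by (intro gen_minimal subgrp_gen) (auto intro: gen.base)

lemma gen_gen_Un: "gen (gen S \<union> gen T) = gen (S \<union> T)"
proof
  show "gen (gen S \<union> gen T) \<subseteq> gen (S \<union> T)"
    by (intro gen_minimal subgrp_gen Un_least gen_mono) auto
  show "gen (S \<union> T) \<subseteq> gen (gen S \<union> gen T)"
    by (rule gen_mono) (auto intro: gen.base)
qed

lemma gen_induct_left [consumes 1, case_names zero plus minus]:
  assumes "x \<in> gen S" "P 0"
    and "\<And>s x. s \<in> S \<Longrightarrow> P x \<Longrightarrow> P (s + x)" "\<And>s x. s \<in> S \<Longrightarrow> P x \<Longrightarrow> P (- s + x)"
  shows "P x"
proof -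
  \<comment> \<open>Left addition of \<open>x\<close> and of \<open>- x\<close> are treated
    together, since negation exchanges them; an arbitrary \<open>y\<close> lets sums
    compose.\<close>
  have "\<forall>y. P y \<longrightarrow> P (x + y) \<and> P (- x + y)"
    using assms(1) by induction (use assms(3,4) in \<open>auto simp: minus_add add.assoc simp del: add_uminus_conv_diff\<close>)
  then show ?thesis using assms(2) by (metis add.right_neutral)
qed

lemma gen_singleton: "gen {x} = range (\<lambda>k. zmul k x)"
proof
  have "subgrp (range (\<lambda>k. zmul k x))"
    unfolding subgrp_def
    by (auto simp flip: zmul_add zmul_neg intro: range_eqI[where x = 0])
  then show "gen {x} \<subseteq> range (\<lambda>k. zmul k x)"
    by (rule gen_minimal) (auto intro: range_eqI[where x = 1])
qed (auto intro: subgrpD(5)[OF subgrp_gen] gen.base)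

lemma additive_zero: "f (0::'a::group_add) = (0::'b::group_add)" if "\<And>x y. f (x + y) = f x + f y"
  using that[of 0 0] add_left_cancel[of "f 0" "f 0" 0] by simp

lemma additive_uminus:
  assumes "\<And>x y. f (x + y) = f x + (f y::'b::group_add)"
  shows "f (- x) = - f (x::'a::group_add)"
  using assms[of "- x" x] additive_zero[of f, OF assms] by (simp add: eq_neg_iff_add_eq_0)

lemma additive_zmul:
  assumes "\<And>x y. f (x + y) = f x + (f y::'b::group_add)"
  shows "f (zmul k x) = zmul k (f (x::'a::group_add))"
  by (induction k rule: int_induct[where k = 0])
    (simp_all only: zmul_succ zmul_pred zmul_0 assms additive_uminus[of f, OF assms] additive_zero[of f, OF assms])

lemma additive_sum_list:
  assumes "\<And>x y. f (x + y) = f x + (f y::'b::group_add)"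
  shows "f (sum_list xs) = sum_list (map f (xs::'a::group_add list))"
  by (induction xs) (simp_all add: assms additive_zero[of f, OF assms])

lemma fst_zmul [simp]: "fst (zmul k p) = zmul k (fst p)"
  by (rule additive_zmul) simp

lemma snd_zmul [simp]: "snd (zmul k p) = zmul k (snd p)"
  by (rule additive_zmul) simp

lemma gen_image:
  assumes "\<And>x y. f (x + y) = f x + (f y::'b::group_add)"
  shows "f ` gen S = gen (f ` (S::'a::group_add set))"
proof
  have "f x \<in> gen (f ` S)" if "x \<in> gen S" for x
    using that by induction (auto simp: assms additive_zero[of f, OF assms] additive_uminus[of f, OF assms] intro: gen.intros)
  then show "f ` gen S \<subseteq> gen (f ` S)" by blast
  have "y \<in> f ` gen S" if "y \<in> gen (f ` S)" for y
    using that
  proof induction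
    case zero
    then show ?case by (metis additive_zero assms gen.zero image_eqI)
  next
    case (add x y)
    then show ?case by (auto simp flip: assms intro: gen.add)
  next
    case (uminus x)
    then show ?case by (auto simp flip: additive_uminus[of f, OF assms] intro: gen.uminus)
  qed (auto intro: gen.base)
  then show "gen (f ` S) \<subseteq> f ` gen S" by blast
qed

text \<open>An element of least positive value generates \<open>K\<close>, by division with
  remainder. Additivity is asked on \<open>K\<close> only, because \<open>c\<close> will be a
  translation length or a slope that is meaningful only there.\<close>

lemma cyclic_if_int_valued:
  fixes c :: "'a::group_add \<Rightarrow> int"
  assumes K: "subgrp K" and c: "\<And>x y. x \<in> K \<Longrightarrow> y \<in> K \<Longrightarrow> c (x + y) = c x + c y"
    and inj: "\<And>x. x \<in> K \<Longrightarrow> c x = 0 \<Longrightarrow> x = 0"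
  shows "\<exists>x\<in>K. K = range (\<lambda>k. zmul k x)"
proof (cases "\<exists>x\<in>K. c x > 0")
  case False
  have c0: "c 0 = 0" using c[of 0 0] subgrpD(1)[OF K] by simp
  have "x = 0" if "x \<in> K" for x
  proof -
    have "c (- x) = - c x" using c[of x "- x"] that subgrpD(3)[OF K that] c0 by simp
    then have "c x = 0" using False that subgrpD(3)[OF K that] by force
    then show ?thesis using inj that by blast
  qed
  then have "K = {0}" using subgrpD(1)[OF K] by blast
  then show ?thesis by auto
next
  case True
  define n where "n = (LEAST n. \<exists>x\<in>K. nat (c x) = n \<and> c x > 0)"
  have "\<exists>x\<in>K. nat (c x) = n \<and> c x > 0"
    unfolding n_def by (rule LeastI_ex) (use True in blast)
  then obtain x where x: "x \<in> K" "nat (c x) = n" "c x > 0" by blast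
  have min: "c x \<le> c y" if "y \<in> K" "c y > 0" for y
    using Least_le[of "\<lambda>n. \<exists>x\<in>K. nat (c x) = n \<and> c x > 0" "nat (c y)"] that x
    unfolding n_def by force
  have c0: "c 0 = 0" using c[of 0 0] subgrpD(1)[OF K] by simp
  have cz: "c (zmul k x) = k * c x" for k
  proof (induction k rule: int_induct[where k = 0])
    case (step1 i)
    have "c (zmul (i + 1) x) = c x + c (zmul i x)"
      unfolding zmul_succ using c x subgrpD(5)[OF K] by blast
    then show ?case using step1 by (simp add: algebra_simps)
  next
    case (step2 i)
    have "c (x + zmul (i - 1) x) = c x + c (zmul (i - 1) x)"
      using c x subgrpD(5)[OF K] by blast
    moreover have "x + zmul (i - 1) x = zmul i x" using zmul_succ[of "i - 1" x] by simp
    ultimately show ?case using step2 by (simp add: left_diff_distrib)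
  qed (simp add: c0)
  have "y \<in> range (\<lambda>k. zmul k x)" if y: "y \<in> K" for y
  proof -
    define k where "k = c y div c x"
    let ?r = "zmul (- k) x + y"
    have r: "?r \<in> K" by (intro subgrpD(2,5)[OF K] x(1) y)
    have "c ?r = c y mod c x"
      using c[of "zmul (- k) x" y] x y subgrpD(5)[OF K x(1)] cz[of "- k"]
      by (simp add: k_def minus_div_mult_eq_mod)
    then have "c ?r = 0"
      using min[OF r] x(3) by (smt (verit) pos_mod_bound pos_mod_sign)
    then have "?r = 0" using inj r by blast
    then have "y = zmul k x" by (simp add: zmul_neg neg_eq_iff_add_eq_0 add_eq_0_iff)
    then show ?thesis by blast
  qed
  then show ?thesis using x(1) subgrpD(5)[OF K x(1)] by (intro bexI[of _ x]) auto
qed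

subsection \<open>Reduced words in two subgroups\<close>

text \<open>The reduced words of the normal form theorem for amalgamated products, with no choice of
  coset representatives, so that an element may have several.\<close>

fun red :: "(bool \<Rightarrow> 'a set) \<Rightarrow> bool \<Rightarrow> 'a list \<Rightarrow> bool" where
  "red M b [] = True"
| "red M b (x # xs) = (x \<in> M b \<and> x \<notin> M (\<not> b) \<and> red M (\<not> b) xs)"

text \<open>The elements of these two kinds are stable under adding a letter on the left: it is
  prepended or merges with a first letter of its own side, and a sum that falls into the
  intersection is absorbed by the next letter.\<close>

lemma gen_red_cases:
  fixes M :: "bool \<Rightarrow> 'a::group_add set"
  assumes M: "\<And>b. subgrp (M b)" and x: "x \<in> gen (M True \<union> M False)"
  obtains "x \<in> M True" "x \<in> M False" | b xs where "xs \<noteq> []" "red M b xs" "x = sum_list xs"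
proof -
  define P where "P x \<longleftrightarrow> x \<in> M True \<inter> M False \<or> (\<exists>b xs. xs \<noteq> [] \<and> red M b xs \<and> x = sum_list xs)" for x
  note s = subgrpD[OF M]
  have D: "y \<in> M True \<inter> M False \<longleftrightarrow> y \<in> M b \<and> y \<in> M (\<not> b)" for y b
    by (cases b) auto
  have single: "P y" if "y \<in> M b" for y b
  proof (cases "y \<in> M (\<not> b)")
    case False
    then have "[y] \<noteq> [] \<and> red M b [y] \<and> y = sum_list [y]" using that by simp
    then show ?thesis unfolding P_def by blast
  qed (use that D[of y b] in \<open>simp add: P_def\<close>)
  have absorb: "P (y + sum_list zs)" if y: "y \<in> M True \<inter> M False" and zs: "red M b zs" for y b zs
  proof (cases zs)
    case Nil
    then show ?thesis using y by (simp add: P_def)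
  next
    case (Cons w ws)
    have "red M b ((y + w) # ws)"
      using zs y D[of y b] s Cons by (auto simp: subgrp_cancel[OF M])
    then have "((y + w) # ws) \<noteq> [] \<and> red M b ((y + w) # ws) \<and> y + sum_list zs = sum_list ((y + w) # ws)"
      using Cons by (simp add: add.assoc)
    then show ?thesis unfolding P_def by blast
  qed
  have step: "P (y + x)" if y: "y \<in> M b" and "P x" for y x b
  proof -
    from \<open>P x\<close> consider "x \<in> M True \<inter> M False" | b' z zs where "red M b' (z # zs)" "x = z + sum_list zs"
      unfolding P_def by (metis list.exhaust sum_list.Cons)
    then show ?thesis
    proof cases
      case 1
      then have "x \<in> M b" by (cases b) auto
      then show ?thesis using single[of "y + x" b] s(2)[OF y] by simp
    next
      case 2
      show ?thesis
      proof (cases "b' = b")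
        case True
        then have yz: "y + z \<in> M b" using y 2 s by simp
        have eq: "y + x = (y + z) + sum_list zs" using 2 by (simp add: add.assoc)
        show ?thesis
        proof (cases "y + z \<in> M (\<not> b)")
          case True
          then have "y + z \<in> M True \<inter> M False" using yz by (cases b) auto
          then show ?thesis using absorb[of "y + z" "\<not> b" zs] 2 eq \<open>b' = b\<close> by simp
        next
          case False
          then have "red M b ((y + z) # zs)" using yz 2 \<open>b' = b\<close> by simp
          then have "(y + z) # zs \<noteq> [] \<and> red M b ((y + z) # zs) \<and> y + x = sum_list ((y + z) # zs)"
            using eq by simp
          then show ?thesis unfolding P_def by blast
        qed
      next
        case False
        then have b': "b' = (\<not> b)" by simp
        show ?thesis
        proof (cases "y \<in> M (\<not> b)")
          case True
          then have "y \<in> M True \<inter> M False" using y by (cases b) auto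
          then show ?thesis using absorb[of y b' "z # zs"] 2 by simp
        next
          case False
          then have "y # z # zs \<noteq> [] \<and> red M b (y # z # zs) \<and> y + x = sum_list (y # z # zs)"
            using y 2 b' by simp
          then show ?thesis unfolding P_def by blast
        qed
      qed
    qed
  qed
  have "P x"
    using x
  proof (induction rule: gen_induct_left)
    case zero
    then show ?case using s by (simp add: P_def)
  next
    case (plus z x)
    then show ?case using step[of z True x] step[of z False x] by auto
  next
    case (minus z x)
    then show ?case using step[of "- z" True x] step[of "- z" False x] s(3)[of z] by auto
  qed
  then show thesis using that unfolding P_def by blast
qed

subsection \<open>Free semigroups and word length\<close>

definition word_ball :: "'a::group_add set \<Rightarrow> nat \<Rightarrow> 'a set"
  where "word_ball S n = {sum_list ws | ws. length ws \<le> n \<and> set ws \<subseteq> S \<union> uminus ` S}"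

lemma word_ball_base: "s \<in> S \<Longrightarrow> s \<in> word_ball S 1"
  unfolding word_ball_def by (rule CollectI, rule exI[of _ "[s]"]) simp

lemma word_ball_add: "x \<in> word_ball S m \<Longrightarrow> y \<in> word_ball S n \<Longrightarrow> x + y \<in> word_ball S (m + n)"
  unfolding word_ball_def
proof clarify
  fix ws vs assume "length ws \<le> m" "set ws \<subseteq> S \<union> uminus ` S" "length vs \<le> n" "set vs \<subseteq> S \<union> uminus ` S"
  then show "\<exists>us. sum_list ws + sum_list vs = sum_list us \<and> length us \<le> m + n \<and> set us \<subseteq> S \<union> uminus ` S"
    by (intro exI[of _ "ws @ vs"]) auto
qed

lemma minus_sum_list: "- sum_list xs = sum_list (rev (map uminus (xs::'a::group_add list)))"
  by (induction xs) (simp_all add: minus_add del: add_uminus_conv_diff)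

lemma word_ball_uminus: "x \<in> word_ball S n \<Longrightarrow> - x \<in> word_ball S n"
  unfolding word_ball_def
proof clarify
  fix ws assume "length ws \<le> n" "set ws \<subseteq> S \<union> uminus ` S"
  then show "\<exists>us. - sum_list ws = sum_list us \<and> length us \<le> n \<and> set us \<subseteq> S \<union> uminus ` S"
    by (intro exI[of _ "rev (map uminus ws)"]) (auto simp: minus_sum_list)
qed

lemma word_ball_mono: "m \<le> n \<Longrightarrow> word_ball S m \<subseteq> word_ball S n"
  unfolding word_ball_def by fastforce

lemma word_ball_gen: "word_ball S n \<subseteq> gen S"
proof -
  have "set ws \<subseteq> S \<union> uminus ` S \<Longrightarrow> sum_list ws \<in> gen S" for ws
    by (induction ws) (auto intro: gen.intros)
  then show ?thesis by (auto simp: word_ball_def)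
qed

text \<open>Only words of equal length are compared; this is what counting 2^m elements in a ball
  needs.\<close>

definition free_pair :: "'a::group_add \<Rightarrow> 'a \<Rightarrow> bool"
  where "free_pair u v \<longleftrightarrow> (\<forall>bs cs. length bs = length cs \<longrightarrow>
    sum_list (map (\<lambda>b. if b then u else v) bs) = sum_list (map (\<lambda>b. if b then u else v) cs) \<longrightarrow> bs = cs)"

text \<open>The radius 4 is the length of a conjugate s + g - s of an element g of length 2, see
  \<open>tree_alternative\<close>.\<close>

definition short_free_pair :: "'a::group_add set \<Rightarrow> bool"
  where "short_free_pair S \<longleftrightarrow> (\<exists>u\<in>word_ball S 4. \<exists>v\<in>word_ball S 4. free_pair u v)"

text \<open>The image of \<open>p\<close> under a nonempty word lies in \<open>U\<close> or in
  \<open>V\<close> according to the first letter. Equal words thus have equal first letters, which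
  cancel.\<close>

lemma free_pair_pingpong:
  fixes act :: "'a::group_add \<Rightarrow> 'v \<Rightarrow> 'v"
  assumes act: "\<And>x y p. act (x + y) p = act x (act y p)" "\<And>p. act 0 p = p"
    and disj: "U \<inter> V = {}" and p: "p \<in> U \<union> V"
    and u: "\<And>x. x \<in> U \<union> V \<Longrightarrow> act u x \<in> U" and v: "\<And>x. x \<in> U \<union> V \<Longrightarrow> act v x \<in> V"
  shows "free_pair u v"
proof -
  let ?w = "\<lambda>bs. sum_list (map (\<lambda>b. if b then u else v) bs)"
  have in_UV: "act (?w bs) p \<in> U \<union> V" for bs
    by (induction bs) (use p u v in \<open>auto simp: act\<close>)
  have first: "act (?w (b # bs)) p \<in> (if b then U else V)" for b bs
    using in_UV[of bs] u v by (auto simp: act)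
  have "?w bs = ?w cs \<Longrightarrow> bs = cs" if "length bs = length cs" for bs cs
    using that
  proof (induction rule: list_induct2)
    case (Cons b bs c cs)
    have "b = c"
    proof (rule ccontr)
      assume "b \<noteq> c"
      then show False using first[of b bs] first[of c cs] Cons.prems disj by (cases b) auto
    qed
    then show ?case using Cons by simp
  qed simp
  then show ?thesis unfolding free_pair_def by blast
qed

section \<open>Groups acting on trees\<close>

text \<open>A tree is given by the distance between its vertices. Distinct points may be at distance
  \<open>0\<close>: in the application the points represent cosets, and equality of vertices is distance \<open>0\<close>.\<close>

locale tree =
  fixes d :: "'v \<Rightarrow> 'v \<Rightarrow> nat"
  assumes d_refl [simp]: "d x x = 0"
    and d_sym: "d x y = d y x"
    and d_tri: "d x z \<le> d x y + d y z"
    and step: "d x y = Suc n \<Longrightarrow> \<exists>z. d x z = 1 \<and> d z y = n"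
    and parity: "d x y = 1 \<Longrightarrow> even (d z x) \<longleftrightarrow> odd (d z y)"
    and uniq: "d x y = Suc n \<Longrightarrow> d x z = 1 \<Longrightarrow> d x z' = 1 \<Longrightarrow> d z y = n \<Longrightarrow> d z' y = n \<Longrightarrow> d z z' = 0"
begin

lemma d_zero: "d x y = 0 \<Longrightarrow> d x z = d y z" "d x y = 0 \<Longrightarrow> d z x = d z y"
  using d_tri[of x z y] d_tri[of y z x] by (auto simp: d_sym)

lemma d_zero_trans: "d x y = 0 \<Longrightarrow> d y z = 0 \<Longrightarrow> d x z = 0"
  using d_tri[of x z y] by simp

lemma d_zero_join: "d x y = 0 \<Longrightarrow> d z y = 0 \<Longrightarrow> d x z = 0"
  using d_zero_trans[of x y z] by (simp add: d_sym)

lemma adj: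
  assumes "d x y = 1"
  shows "d z x = d z y + 1 \<or> d z y = d z x + 1"
proof -
  have "d z x \<le> d z y + 1" "d z y \<le> d z x + 1"
    using d_tri[of z x y] d_tri[of z y x] assms by (auto simp: d_sym)
  moreover have "d z x \<noteq> d z y" using parity[OF assms, of z] by auto
  ultimately show ?thesis by linarith
qed

text \<open>Walk from \<open>x\<close> to \<open>w\<close>. After a first step to \<open>u\<close>,
  which leads away from \<open>y\<close>, the only neighbour of \<open>u\<close> closer to
  \<open>y\<close> is \<open>x\<close> by \<open>uniq\<close>, and \<open>x\<close> is farther from
  \<open>w\<close>; so the hypothesis persists.\<close>

lemma additive_if_diverging:
  assumes "\<And>z. d x z = 1 \<Longrightarrow> d z y < d x y \<Longrightarrow> d z w < d x w \<Longrightarrow> False"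
  shows "d y w = d y x + d x w"
  using assms
proof (induction "d x w" arbitrary: x)
  case 0
  then show ?case using d_zero(2)[of x w y] by simp
next
  case (Suc n)
  obtain u where u: "d x u = 1" "d u w = n" using step[OF Suc(2)[symmetric]] by blast
  have uy: "d u y = d x y + 1"
    using adj[OF u(1), of y] Suc(2,3) u by (force simp: d_sym)
  have "d y w = d y u + d u w"
  proof (rule Suc(1)[OF u(2)[symmetric]])
    fix z assume z: "d u z = 1" "d z y < d u y" "d z w < d u w"
    then have "d z y = d x y" using uy adj[OF z(1), of y] by (simp add: d_sym)
    then have "d x z = 0" using uniq[of u y "d x y" x z] uy z(1) u(1) by (simp add: d_sym)
    then show False using d_zero(1)[of x z w] z(3) u Suc(2) by simp
  qed
  then show ?case using uy u Suc(2) by (simp add: d_sym)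
qed

text \<open>Move \<open>x\<close> as long as one step approaches \<open>y\<close>, \<open>z\<close>
  and \<open>w\<close> at once; each of the three sums then drops by 1. Where this stops, at most
  one of the three pairs can share a first step, so the geodesics of the other two pairs pass
  through \<open>x\<close>.\<close>

lemma four_point_all:
  "(d x y + d z w \<le> d x z + d y w \<or> d x y + d z w \<le> d x w + d y z) \<and>
   (d x z + d y w \<le> d x y + d z w \<or> d x z + d y w \<le> d x w + d y z) \<and>
   (d x w + d y z \<le> d x y + d z w \<or> d x w + d y z \<le> d x z + d y w)"
proof (induction "d x y + d x z + d x w" arbitrary: x rule: less_induct)
  case less
  let ?c = "\<lambda>u y. d x u = 1 \<and> d u y < d x y"
  show ?case
  proof (cases "\<exists>u. ?c u y \<and> ?c u z \<and> ?c u w")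
    case True
    then obtain u where u: "d x u = 1" "d u y < d x y" "d u z < d x z" "d u w < d x w" by blast
    have "d x y = d u y + 1" "d x z = d u z + 1" "d x w = d u w + 1"
      using adj[OF u(1), of y] adj[OF u(1), of z] adj[OF u(1), of w] u by (auto simp: d_sym)
    then show ?thesis using less[of u] by auto
  next
    case False
    have same: "?c u q" if "?c u p" "?c u' p" "?c u' q" for u u' p q
    proof -
      have "d x p = Suc (d u p)" "d u' p = d u p"
        using adj[of x u p] adj[of x u' p] that by (auto simp: d_sym)
      then have "d u u' = 0" using uniq[of x p "d u p" u u'] that by simp
      then show ?thesis using d_zero(1)[of u u' q] that by simp
    qed
    have add: "d p q = d p x + d x q" if "\<And>u. \<not> (?c u p \<and> ?c u q)" for p q
      by (rule additive_if_diverging) (use that in blast)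
    have tri: "d p q \<le> d x p + d x q" for p q using d_tri[of p q x] by (simp add: d_sym)
    consider u u' where "?c u y" "?c u z" "?c u' y" "?c u' w"
      | u u' where "?c u y" "?c u z" "?c u' z" "?c u' w"
      | u u' where "?c u y" "?c u w" "?c u' z" "?c u' w"
      | "d y z = d y x + d x z" "d y w = d y x + d x w"
      | "d y z = d y x + d x z" "d z w = d z x + d x w"
      | "d y w = d y x + d x w" "d z w = d z x + d x w"
      using add[of y z] add[of y w] add[of z w] by blast
    then show ?thesis
    proof cases
      case (1 u u')
      then show ?thesis using same[of u y u' w] False by blast
    next
      case (2 u u')
      then show ?thesis using same[of u z u' w] False by blast
    next
      case (3 u u')
      then show ?thesis using same[of u w u' z] False by blast
    qed (use tri[of y z] tri[of y w] tri[of z w] in \<open>simp_all add: d_sym\<close>)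
  qed
qed

lemma four_point:
  "d x y + d z w \<le> d x z + d y w \<or> d x y + d z w \<le> d x w + d y z"
  using four_point_all by blast

lemma between_unique:
  assumes "d x z + d z y = d x y" "d x z' = d x z" "d z' y = d z y"
  shows "d z z' = 0"
  using four_point[of z z' x y] assms by (auto simp: d_sym)

text \<open>The equation \<open>d a' b' = d a b + 2\<close> says that the two edges point away from
  each other, so the half-trees behind them have no common point.\<close>

lemma half_trees_disjoint:
  assumes "d a a' = 1" "d b b' = 1" "d a' b' = d a b + 2" "d z a' < d z a" "d z b' < d z b"
  shows False
proof -
  have "d z a = d z a' + 1" "d z b = d z b' + 1" using adj assms by force+
  then show False
    using four_point[of z a a' b'] four_point[of z b a' b'] d_tri[of a b' b] d_tri[of a' b a] assms(1-3)
    by (auto simp: d_sym)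
qed

subsection \<open>Convex sets\<close>

definition tree_convex :: "'v set \<Rightarrow> bool"
  where "tree_convex C \<longleftrightarrow> (\<forall>x\<in>C. \<forall>y\<in>C. \<forall>z. d x z + d z y = d x y \<longrightarrow> z \<in> C)"

text \<open>\<open>m\<close> is the point between \<open>x\<close> and \<open>y\<close> nearest to
  \<open>z\<close>: a step from it towards \<open>z\<close> and also towards \<open>x\<close> or
  \<open>y\<close> would stay between \<open>x\<close> and \<open>y\<close> and come nearer.\<close>

lemma median:
  obtains m where "d x m + d m y = d x y" "d x m + d m z = d x z" "d y m + d m z = d y z"
proof -
  define P where "P m \<longleftrightarrow> d x m + d m y = d x y" for m
  have "P x" by (simp add: P_def)
  define m where "m = (ARG_MIN (d z) m. P m)"
  have m: "P m" "\<And>m'. P m' \<Longrightarrow> d z m \<le> d z m'"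
    using arg_min_nat_lemma[of P x "d z"] \<open>P x\<close> unfolding m_def by auto
  have *: "d a z = d a m + d m z" if "a = x \<or> a = y" for a
  proof (rule additive_if_diverging)
    fix u assume u: "d m u = 1" "d u a < d m a" "d u z < d m z"
    have "P u"
      using adj[OF u(1), of x] adj[OF u(1), of y] d_tri[of x y u] m(1) that u(2)
      unfolding P_def by (auto simp: d_sym)
    then show False using m(2)[of u] u(3) by (simp add: d_sym)
  qed
  show thesis using that[of m] m(1) *[of x] *[of y] unfolding P_def by simp
qed

lemma helly3:
  assumes "tree_convex A" "tree_convex B" "tree_convex C"
    and "A \<inter> B \<noteq> {}" "B \<inter> C \<noteq> {}" "A \<inter> C \<noteq> {}"
  shows "A \<inter> B \<inter> C \<noteq> {}"
proof -
  obtain x y z where xyz: "x \<in> A \<inter> B" "y \<in> B \<inter> C" "z \<in> A \<inter> C" using assms by blast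
  obtain m where m: "d x m + d m y = d x y" "d x m + d m z = d x z" "d y m + d m z = d y z"
    using median by blast
  have "m \<in> A" "m \<in> B" "m \<in> C"
    using assms(1-3) xyz m unfolding tree_convex_def by blast+
  then show ?thesis by blast
qed

text \<open>By \<open>helly3\<close> the other sets, intersected with one of them, still meet
  pairwise; this removes one set.\<close>

lemma helly:
  assumes "finite S" "S \<noteq> {}" "\<And>s. s \<in> S \<Longrightarrow> tree_convex (C s)"
    and "\<And>s t. s \<in> S \<Longrightarrow> t \<in> S \<Longrightarrow> C s \<inter> C t \<noteq> {}"
  shows "\<exists>v. \<forall>s\<in>S. v \<in> C s"
  using assms
proof (induction arbitrary: C rule: finite_ne_induct)
  case (singleton s)
  then show ?case by fastforce
next
  case (insert t S)
  have "\<exists>v. \<forall>s\<in>S. v \<in> C s \<inter> C t"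
  proof (rule insert.IH)
    show "tree_convex (C s \<inter> C t)" if "s \<in> S" for s
      using insert.prems(1)[of s] insert.prems(1)[of t] that unfolding tree_convex_def by blast
    show "C s \<inter> C t \<inter> (C s' \<inter> C t) \<noteq> {}" if "s \<in> S" "s' \<in> S" for s s'
      using helly3[of "C s" "C s'" "C t"] insert.prems that by blast
  qed
  then show ?case using insert.hyps by blast
qed

subsection \<open>Lines\<close>

definition line :: "(int \<Rightarrow> 'v) \<Rightarrow> bool"
  where "line L \<longleftrightarrow> (\<forall>m n. int (d (L m) (L n)) = \<bar>m - n\<bar>)"

lemma lineD: "line L \<Longrightarrow> int (d (L m) (L n)) = \<bar>m - n\<bar>"
  by (simp add: line_def)

lemma line_reparam:
  assumes "line L" "e \<in> {1, -1}"
  shows "line (\<lambda>n. L (a + e * n))"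
  using assms by (auto simp: line_def)

text \<open>A path in a tree that never turns back is geodesic; the four-point condition carries
  this from two steps to any number.\<close>

lemma lineI:
  assumes adj1: "\<And>k. d (L k) (L (k + 1)) = 1" and nb: "\<And>k. d (L k) (L (k + 2)) \<noteq> 0"
  shows "line L"
proof -
  have two: "d (L k) (L (k + 2)) = 2" for k
    using adj[OF adj1[of "k + 1"], of "L k"] adj1[of k] nb[of k] by (simp add: add.assoc)
  have *: "d (L m) (L (m + int n)) = n" for m n
  proof (induction n rule: less_induct)
    case (less n)
    consider "n = 0" | "n = 1" | k where "n = Suc (Suc k)" by (metis One_nat_def not0_implies_Suc)
    then show ?case
    proof cases
      case 3
      let ?a = "L m" and ?b = "L (m + int k)" and ?c = "L (m + int k + 1)" and ?e = "L (m + int k + 2)"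
      have i: "m + int (Suc k) = m + int k + 1" "m + int n = m + int k + 2" "m + int k + 1 + 1 = m + int k + 2"
        using 3 by simp_all
      have "d ?a ?b = k" using less[of k] 3 by simp
      moreover have "d ?a ?c = k + 1" using less[of "Suc k"] 3 unfolding i(1) by simp
      moreover have "d ?c ?e = 1" using adj1[of "m + int k + 1"] unfolding i(3) .
      moreover note adj1[of "m + int k"] two[of "m + int k"]
      ultimately have "d ?a ?e = k + 2"
        using four_point[of ?a ?c ?b ?e] d_tri[of ?a ?e ?c] d_sym[of ?b ?c] by linarith
      then show ?thesis unfolding i(2) using 3 by simp
    qed (simp_all add: adj1)
  qed
  have "int (d (L m) (L n)) = \<bar>m - n\<bar>" for m n
  proof (cases "m \<le> n")
    case True
    then show ?thesis using *[of m "nat (n - m)"] by simp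
  next
    case False
    then show ?thesis using *[of n "nat (m - n)"] by (simp add: d_sym)
  qed
  then show ?thesis by (simp add: line_def)
qed

lemma line_proj_up:
  assumes L: "line L" and min: "\<And>n. d y (L 0) \<le> d y (L n)"
  shows "d y (L (int k)) = d y (L 0) + k"
proof (induction k rule: less_induct)
  case (less k)
  have adj1: "d (L n) (L (n + 1)) = 1" for n using lineD[OF L, of n "n + 1"] by simp
  consider "k = 0" | "k = 1" | j where "k = Suc (Suc j)" by (metis One_nat_def not0_implies_Suc)
  then show ?case
  proof cases
    case 2
    then show ?thesis using adj[OF adj1[of 0], of y] min[of 1] by auto
  next
    case 3
    have "d (L (int j)) (L (int j + 1)) = 1" "d (L (int j + 1)) (L (int j + 2)) = 1"
      "d (L (int j)) (L (int j + 2)) = 2"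
      using lineD[OF L, of "int j" "int j + 1"] lineD[OF L, of "int j + 1" "int j + 2"]
        lineD[OF L, of "int j" "int j + 2"] by simp_all
    moreover have i: "int (Suc j) = int j + 1" "int k = int j + 2" using 3 by simp_all
    moreover have "d y (L (int j)) = d y (L 0) + j" using less[of j] 3 by simp
    moreover have "d y (L (int j + 1)) = d y (L 0) + j + 1" using less[of "Suc j"] 3 unfolding i(1) by simp
    ultimately have "d y (L (int j + 2)) = d y (L 0) + j + 2"
      using four_point[of y "L (int j + 1)" "L (int j)" "L (int j + 2)"]
        d_tri[of y "L (int j + 2)" "L (int j + 1)"] d_sym[of "L (int j)" "L (int j + 1)"] by linarith
    then show ?thesis unfolding i(2) using 3 by simp
  qed simp
qed

text \<open>\<open>L n0\<close> is the projection of \<open>y\<close> to the line and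
  \<open>D\<close> its distance. Next to a minimum parity forces an increase, and after an increase
  the four-point condition forbids a decrease.\<close>

lemma line_proj:
  assumes L: "line L"
  obtains n0 D where "\<And>n. int (d y (L n)) = int D + \<bar>n - n0\<bar>"
proof -
  define n0 where "n0 = (ARG_MIN (\<lambda>n. d y (L n)) n. True)"
  have min: "d y (L n0) \<le> d y (L n)" for n
    using arg_min_nat_lemma[of "\<lambda>_. True" 0 "\<lambda>n. d y (L n)"] unfolding n0_def by auto
  have up: "d y (L (n0 + e * int k)) = d y (L n0) + k" if "e \<in> {1, -1}" for e k
    using line_proj_up[OF line_reparam[OF L that, of n0], of y k] min by auto
  have "int (d y (L n)) = int (d y (L n0)) + \<bar>n - n0\<bar>" for n
    using up[of 1 "nat (n - n0)"] up[of "-1" "nat (n0 - n)"] by (cases "n0 \<le> n") auto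
  then show thesis using that by blast
qed

lemma int_isometry:
  fixes t :: "int \<Rightarrow> int"
  assumes "\<And>m n. \<bar>t m - t n\<bar> = \<bar>m - n\<bar>"
  obtains e where "e \<in> {1, -1}" "\<And>n. t n = e * n + t 0"
proof -
  define e where "e = t 1 - t 0"
  have e: "e = 1 \<or> e = -1" using assms[of 1 0] unfolding e_def by linarith
  have "t n = e * n + t 0" for n
  proof -
    have "\<bar>t n - t 0\<bar> = \<bar>n\<bar>" "\<bar>t n - t 1\<bar> = \<bar>n - 1\<bar>" using assms[of n 0] assms[of n 1] by simp_all
    moreover have "t 1 = t 0 + e" by (simp add: e_def)
    ultimately have "e = 1 \<and> t n = n + t 0 \<or> e = -1 \<and> t n = - n + t 0" using e by linarith
    then show ?thesis by auto
  qed
  then show thesis using that e by blast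
qed

subsection \<open>Subtrees spanned by edge paths\<close>

text \<open>An edge separates a tree into two sides, so some step of the walk changes sides; the
  four-point condition identifies this step with the edge.\<close>

lemma edge_on_walk:
  assumes R: "\<And>u u'. (u, u') \<in> R \<Longrightarrow> d u u' = 1" and xy: "(x, y) \<in> R\<^sup>*"
    and z: "d z z' = 1" "d x z < d x z'" "d y z' < d y z"
  obtains u u' where "(u, u') \<in> R" "d u z = 0" "d u' z' = 0"
proof -
  from xy z(3) have "\<exists>u u'. (u, u') \<in> R \<and> d u z = 0 \<and> d u' z' = 0"
  proof (induction rule: rtrancl_induct)
    case base
    then show ?case using z(2) by simp
  next
    case (step y w)
    show ?case
    proof (cases "d y z' < d y z")
      case False
      then have "d y z' = d y z + 1" using adj[OF z(1), of y] by linarith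
      moreover have "d w z = d w z' + 1" using adj[OF z(1), of w] step.prems by linarith
      moreover have "d y w = 1" using R step by blast
      ultimately have "d y z = 0 \<and> d w z' = 0"
        using four_point[of y z' w z] z(1) by (auto simp: d_sym)
      then show ?thesis using step by blast
    qed (use step in blast)
  qed
  then show thesis using that by blast
qed

end

locale tree_action = tree d for d :: "'v \<Rightarrow> 'v \<Rightarrow> nat" +
  fixes act :: "'g::group_add \<Rightarrow> 'v \<Rightarrow> 'v"
  assumes act_add: "act (g + h) x = act g (act h x)"
    and act_0 [simp]: "act 0 x = x"
    and act_d [simp]: "d (act g x) (act g y) = d x y"
    and act_even: "even (d x (act g x))"
begin

lemma act_minus [simp]: "act (- g) (act g x) = x" "act g (act (- g) x) = x"
  using act_add[of "- g" g x] act_add[of g "- g" x] by simp_all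

lemma d_act_left: "d (act g x) y = d x (act (- g) y)"
  using act_d[of "- g" "act g x" y] by simp

lemma fixed_transfer:
  assumes "d x y = 0" "d y (act g y) = 0"
  shows "d x (act g x) = 0"
  using d_zero_trans[OF assms] d_zero_join[of x "act g y" "act g x"] assms(1) by simp

lemma fix_convex: "tree_convex {v. d v (act g v) = 0}"
proof -
  have "d z (act g z) = 0" if "d x (act g x) = 0" "d y (act g y) = 0" "d x z + d z y = d x y" for x y z
  proof (rule between_unique[of x z y])
    show "d x (act g z) = d x z" using d_zero(1)[OF that(1), of "act g z"] by simp
    show "d (act g z) y = d z y" using d_zero(2)[OF that(2), of "act g z"] by simp
  qed (use that in simp)
  then show ?thesis unfolding tree_convex_def by blast
qed

text \<open>The fixed point \<open>b\<close> is equidistant from \<open>p\<close> and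
  \<open>act t p\<close>, so the geodesics from \<open>b\<close> to both run through the midpoint
  \<open>m\<close>. Then \<open>m\<close> and \<open>act t m\<close> lie on one geodesic at the same
  distance from \<open>b\<close>.\<close>

lemma midpoint_fixed:
  assumes b: "d b (act t b) = 0" and m: "d p (act t p) = 2 * r" "d p m = r" "d m (act t p) = r"
  shows "d m (act t m) = 0"
proof -
  have bt: "d b (act t x) = d b x" for x using d_zero(1)[OF b, of "act t x"] by simp
  have "d b p = d b m + r"
    using four_point[of b m p "act t p"] d_tri[of b p m] m bt[of p] by (auto simp: d_sym)
  moreover have "d (act t m) (act t p) = r" using m by (simp add: d_sym)
  ultimately show ?thesis
    using four_point[of m "act t m" b "act t p"] m bt[of p] bt[of m] by (auto simp: d_sym)
qed

text \<open>If \<open>s\<close>, \<open>t\<close> and \<open>s + t\<close> are elliptic and \<open>p\<close> is fixed by \<open>s + t\<close>, then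
  \<open>t p = - s p\<close>, and the midpoint of \<open>p\<close> and this point is fixed by both \<open>s\<close> and \<open>t\<close>.\<close>

lemma elliptic_product:
  assumes "d a (act s a) = 0" "d b (act t b) = 0" "d p (act (s + t) p) = 0"
  obtains m where "d m (act s m) = 0" "d m (act t m) = 0"
proof -
  obtain r where r: "d p (act t p) = 2 * r" using act_even by blast
  have "\<exists>m. d p m = k \<and> d m q = n" if "d p q = k + n" for p q k n
    using that
  proof (induction k arbitrary: p)
    case 0
    then show ?case by (metis add_0 d_refl)
  next
    case (Suc k)
    then obtain z where z: "d p z = 1" "d z q = k + n" using step[of p q "k + n"] by auto
    then obtain m where m: "d z m = k" "d m q = n" using Suc.IH by blast
    then have "d p m = Suc k" using d_tri[of p m z] d_tri[of p q m] z Suc.prems by simp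
    then show ?case using m by blast
  qed
  then obtain m where m: "d p m = r" "d m (act t p) = r" using r by (metis mult_2)
  have eq: "d (act (- s) p) (act t p) = 0"
    using assms(3) d_act_left[of "- s" p "act t p"] by (simp add: act_add)
  have "d m (act (- s) m) = 0"
  proof (rule midpoint_fixed)
    show "d a (act (- s) a) = 0" using assms(1) d_act_left[of s a a] by (simp add: d_sym)
    show "d p (act (- s) p) = 2 * r" using d_zero(2)[OF eq, of p] r by simp
    show "d m (act (- s) p) = r" using d_zero(2)[OF eq, of m] m by simp
  qed (rule m)
  then have "d m (act s m) = 0" using d_act_left[of s m m] by (simp add: d_sym)
  then show thesis using that midpoint_fixed[OF assms(2) r m] by blast
qed

subsection \<open>The axis of a fixed-point free element\<close>

lemma act_zmul_line:
  assumes "\<And>n. d (act g (L n)) (L (n + c)) = 0"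
  shows "d (act (zmul k g) (L n)) (L (n + k * c)) = 0"
proof (induction k arbitrary: n rule: int_induct[where k = 0])
  case base
  then show ?case by simp
next
  case (step1 i)
  have "d (act g (act (zmul i g) (L n))) (act g (L (n + i * c))) = 0" using step1 by simp
  moreover have "d (act g (L (n + i * c))) (L (n + (i + 1) * c)) = 0"
    using assms[of "n + i * c"] by (simp add: algebra_simps)
  ultimately show ?case
    unfolding zmul_succ act_add by (rule d_zero_trans)
next
  case (step2 i)
  have "d (act (- g) (L (n + i * c))) (L (n + (i - 1) * c)) = 0"
    using assms[of "n + (i - 1) * c"] d_act_left[of "- g" "L (n + i * c)" "L (n + (i - 1) * c)"]
    by (simp add: d_sym algebra_simps)
  moreover have "d (act (- g) (act (zmul i g) (L n))) (act (- g) (L (n + i * c))) = 0" using step2 by simp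
  ultimately show ?case
    unfolding zmul_pred act_add by (rule d_zero_trans[rotated])
qed

text \<open>Take a point \<open>x\<close> of least displacement \<open>r\<close> and concatenate the
  translates of a geodesic from \<open>x\<close> to \<open>act g x\<close>. Turning back at a joint
  would give the second point of this geodesic a displacement of at most
  \<open>r - 2\<close>.\<close>

lemma axis_exists:
  assumes "\<And>v. d v (act g v) \<noteq> 0"
  obtains L c where "line L" "c > 0" "\<And>n. d (act g (L n)) (L (n + c)) = 0"
proof -
  define x where "x = (ARG_MIN (\<lambda>x. d x (act g x)) x. True)"
  define r where "r = d x (act g x)"
  have min: "r \<le> d y (act g y)" for y
    using arg_min_nat_lemma[of "\<lambda>_. True" undefined "\<lambda>x. d x (act g x)"] unfolding x_def r_def by auto
  have "r \<noteq> 0" "even r" using assms act_even by (auto simp: r_def)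
  then have r2: "r \<ge> 2" by presburger
  have "\<exists>\<gamma>. \<gamma> 0 = x \<and> (\<forall>i<n. d (\<gamma> i) (\<gamma> (Suc i)) = 1) \<and> (\<forall>i\<le>n. d (\<gamma> i) y = n - i)"
    if "d x y = n" for x y n
    using that
  proof (induction n arbitrary: x)
    case 0
    then show ?case by (intro exI[of _ "\<lambda>_. x"]) simp
  next
    case (Suc n)
    then obtain z where z: "d x z = 1" "d z y = n" using step by blast
    then obtain \<gamma> where "\<gamma> 0 = z" "\<forall>i<n. d (\<gamma> i) (\<gamma> (Suc i)) = 1" "\<forall>i\<le>n. d (\<gamma> i) y = n - i"
      using Suc.IH by blast
    then show ?case using z Suc.prems
      by (intro exI[of _ "case_nat x \<gamma>"]) (auto split: nat.split simp: less_Suc_eq_0_disj)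
  qed
  then obtain \<gamma> where \<gamma>0: "\<gamma> 0 = x" and \<gamma>1: "\<And>i. i < r \<Longrightarrow> d (\<gamma> i) (\<gamma> (Suc i)) = 1"
    and \<gamma>d: "\<And>i. i \<le> r \<Longrightarrow> d (\<gamma> i) (act g x) = r - i"
    unfolding r_def by blast
  have chain: "d (\<gamma> i) (\<gamma> (i + k)) \<le> k" if "i + k \<le> r" for i k
    using that
  proof (induction k)
    case (Suc k)
    then show ?case using d_tri[of "\<gamma> i" "\<gamma> (i + Suc k)" "\<gamma> (i + k)"] \<gamma>1[of "i + k"] by simp
  qed simp
  define L where "L k = act (zmul (k div int r) g) (\<gamma> (nat (k mod int r)))" for k
  have LI: "L (q * int r + int m) = act (zmul q g) (\<gamma> m)" if "m < r" for q m
    using that by (simp add: L_def div_pos_pos_trivial)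
  have split: "\<exists>q m. k = q * int r + int m \<and> m < r" for k
    using r2 by (intro exI[of _ "k div int r"] exI[of _ "nat (k mod int r)"])
      (simp add: nat_less_iff)
  have shift: "L (k + int r) = act g (L k)" for k
  proof -
    obtain q m where k: "k = q * int r + int m" "m < r" using split by blast
    then have "k + int r = (q + 1) * int r + int m" by (simp add: algebra_simps)
    then have "L (k + int r) = act (zmul (q + 1) g) (\<gamma> m)" using LI[OF k(2), of "q + 1"] by (simp only:)
    also have "\<dots> = act g (act (zmul q g) (\<gamma> m))" by (simp only: zmul_succ act_add)
    finally show ?thesis using LI[OF k(2), of q] k by simp
  qed
  have LI': "L (q * int r + int m) = act (zmul q g) (if m < r then \<gamma> m else act g (\<gamma> (m - r)))"
    if "m < 2 * r" for q m
  proof (cases "m < r")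
    case False
    then have e: "q * int r + int m = (q + 1) * int r + int (m - r)" by (simp add: algebra_simps)
    have "m - r < r" using that by simp
    then have "L (q * int r + int m) = act (zmul (q + 1) g) (\<gamma> (m - r))"
      unfolding e by (rule LI)
    then show ?thesis using False zmul_add[of q 1 g] by (simp add: act_add)
  qed (simp add: LI)
  have "line L"
  proof (rule lineI)
    fix k
    obtain q m where k: "k = q * int r + int m" "m < r" using split by blast
    have k1: "k + 1 = q * int r + int (m + 1)" and k2: "k + 2 = q * int r + int (m + 2)"
      using k by simp_all
    show "d (L k) (L (k + 1)) = 1"
      unfolding k1 unfolding k
      using LI'[of m q] LI'[of "m + 1" q] k(2) r2 \<gamma>1[of m] \<gamma>d[of m] \<gamma>0
      by (cases "m + 1 < r") (auto simp: le_antisym)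
    show "d (L k) (L (k + 2)) \<noteq> 0"
    proof (cases "m + 1 = r")
      case True
      have "d (\<gamma> m) (act g (\<gamma> 1)) \<noteq> 0"
      proof
        assume "d (\<gamma> m) (act g (\<gamma> 1)) = 0"
        then have "d (\<gamma> 1) (act g (\<gamma> 1)) = d (\<gamma> 1) (\<gamma> m)" using d_zero(2) by metis
        also have "\<dots> \<le> r - 2" using chain[of 1 "r - 2"] True r2
          by (metis (no_types, lifting) Nat.add_diff_assoc Nat.diff_add_assoc2 add.commute add_diff_cancel_right' diff_le_self nat_1_add_1)
        finally show False using min[of "\<gamma> 1"] r2 by simp
      qed
      moreover have "m + 2 - r = 1" "\<not> m + 2 < r" using True by simp_all
      ultimately show ?thesis
        unfolding k2 unfolding k using LI'[of m q] LI'[of "m + 2" q] k(2) r2 by simp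
    next
      case False
      have "d (\<gamma> m) (if m + 2 < r then \<gamma> (m + 2) else act g (\<gamma> (m + 2 - r))) \<noteq> 0"
      proof (cases "m + 2 < r")
        case True
        then have "d (\<gamma> m) (act g x) \<noteq> d (\<gamma> (m + 2)) (act g x)" using \<gamma>d[of m] \<gamma>d[of "m + 2"] by simp
        then show ?thesis using d_zero(1)[of "\<gamma> m" "\<gamma> (m + 2)" "act g x"] True by auto
      next
        case False
        then have "m + 2 = r" using k(2) \<open>m + 1 \<noteq> r\<close> by simp
        then show ?thesis using \<gamma>d[of m] \<gamma>0 by auto
      qed
      then show ?thesis
        unfolding k2 unfolding k using LI'[of m q] LI'[of "m + 2" q] k(2) r2 by simp
    qed
  qed
  then show thesis using that[of L "int r"] shift r2 by simp
qed

lemma translation_reverse: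
  fixes L :: "int \<Rightarrow> 'v"
  assumes "\<And>n. d (act g (L n)) (L (n + c)) = 0"
  shows "d (act (- g) (L n)) (L (n - c)) = 0"
  using act_zmul_line[of g L c "-1" n] assms by simp

subsection \<open>Free semigroups from two axes\<close>

text \<open>Ping-pong between the half-trees behind the edges from \<open>L 0\<close> to
  \<open>L 1\<close> and from \<open>M 0\<close> to \<open>M 1\<close>. A translation moves
  everything outside the backward half-tree of its axis into the forward one, and by
  \<open>D\<close> the forward half-tree of either axis avoids both half-trees of the other. The two
  backward ones may overlap, which is why only positive words are controlled.\<close>

lemma fork:
  assumes L: "line L" "\<And>n. d (act u (L n)) (L (n + k)) = 0" "k > 0"
    and M: "line M" "\<And>n. d (act v (M n)) (M (n + l)) = 0" "l > 0"
    and D: "d (L 1) (M 1) = d (L 0) (M 0) + 2" "d (L (- 1)) (M 1) = d (L 0) (M 0) + 2"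
      "d (L 1) (M (- 1)) = d (L 0) (M 0) + 2"
  shows "free_pair u v"
proof -
  have e: "d (L 0) (L 1) = 1" "d (L 0) (L (- 1)) = 1" "d (M 0) (M 1) = 1" "d (M 0) (M (- 1)) = 1"
    using lineD[OF L(1), of 0 1] lineD[OF L(1), of 0 "-1"] lineD[OF M(1), of 0 1] lineD[OF M(1), of 0 "-1"]
    by simp_all
  define half where "half N = {z. d z (N 1) < d z (N 0)}" for N :: "int \<Rightarrow> 'v"
  have push: "act g z \<in> half N"
    if N: "line N" "\<And>n. d (act g (N n)) (N (n + c)) = 0" "c > 0" and z: "\<not> d z (N (- 1)) < d z (N 0)"
    for g N c z
  proof -
    obtain n0 D where p: "\<And>n. int (d z (N n)) = int D + \<bar>n - n0\<bar>"
      using line_proj[OF N(1)] by blast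
    have "n0 \<ge> 0" using p[of 0] p[of "-1"] z by linarith
    have "d (act g z) (N n) = d z (N (n - c))" for n
      using translation_reverse[of g N c n] N(2) d_zero(2)[of "act (- g) (N n)" "N (n - c)" z]
        d_act_left[of g z "N n"] by simp
    then show ?thesis
      using p[of "1 - c"] p[of "0 - c"] \<open>n0 \<ge> 0\<close> \<open>c > 0\<close> unfolding half_def by auto
  qed
  have backward: "\<not> d z (N (- 1)) < d z (N 0)" if "line N" "z \<in> half N" for z N
  proof -
    obtain n0 D where "\<And>n. int (d z (N n)) = int D + \<bar>n - n0\<bar>" using line_proj[OF \<open>line N\<close>] by blast
    from this[of 0] this[of 1] this[of "-1"] show ?thesis using that(2) unfolding half_def by auto
  qed
  show ?thesis
  proof (rule free_pair_pingpong[where act = act and U = "half L" and V = "half M" and p = "L 1"])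
    show "half L \<inter> half M = {}"
      using half_trees_disjoint[OF e(1) e(3) D(1)] by (auto simp: half_def)
    show "L 1 \<in> half L \<union> half M" using e(1) by (simp add: half_def d_sym)
    show "act u z \<in> half L" if "z \<in> half L \<union> half M" for z
      using that half_trees_disjoint[OF e(2) e(3), of z] D(2) backward[OF L(1)]
      by (intro push[OF L]) (auto simp: half_def)
    show "act v z \<in> half M" if "z \<in> half L \<union> half M" for z
      using that half_trees_disjoint[OF e(1) e(4), of z] D(3) backward[OF M(1)]
      by (intro push[OF M]) (auto simp: half_def)
  qed (simp_all add: act_add)
qed

text \<open>The axes are reparametrized, and \<open>u\<close>, \<open>v\<close> inverted
  accordingly, so that they diverge as \<open>fork\<close> requires. Disjoint axes are based at
  closest points; otherwise the base is the common point nearest along \<open>M\<close> to the point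
  \<open>M n\<close>, which is off \<open>L\<close>.\<close>

lemma free_pair_if_distinct_axes:
  assumes L: "line L" "\<And>n. d (act u (L n)) (L (n + k)) = 0" "k > 0"
    and M: "line M" "\<And>n. d (act v (M n)) (M (n + l)) = 0" "l > 0"
    and ne: "\<And>m. d (M n) (L m) \<noteq> 0"
  shows "\<exists>u'\<in>{u, - u}. \<exists>v'\<in>{v, - v}. free_pair u' v'"
proof -
  have reorient: "\<exists>g'\<in>{g, - g}. \<forall>n. d (act g' (N (a + e * n))) (N (a + e * (n + c))) = 0"
    if N: "\<And>n. d (act g (N n)) (N (n + c)) = 0" and e: "e \<in> {1, -1}" for g N and c a e :: int
  proof (cases "e = 1")
    case True
    then show ?thesis using N[of "a + n" for n] by (intro bexI[of _ g]) (auto simp: add.assoc)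
  next
    case False
    then have "e = -1" using e by simp
    have "d (act (- g) (N (a - n))) (N (a - n - c)) = 0" for n
      using translation_reverse[of g N c "a - n"] N by blast
    then show ?thesis using \<open>e = -1\<close>
      by (intro bexI[of _ "- g"]) (auto simp: algebra_simps)
  qed
  obtain a b e f where ef: "e \<in> {1, -1}" "f \<in> {1, -1}"
    and D: "d (L (a + e)) (M (b + f)) = d (L a) (M b) + 2" "d (L (a - e)) (M (b + f)) = d (L a) (M b) + 2"
      "d (L (a + e)) (M (b - f)) = d (L a) (M b) + 2"
  proof (cases "\<exists>i j. d (L i) (M j) = 0")
    case False
    define ab where "ab = (ARG_MIN (\<lambda>(i, j). d (L i) (M j)) p. True)"
    obtain a b where ab: "ab = (a, b)" by fastforce
    have min: "d (L a) (M b) \<le> d (L i) (M j)" for i j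
      using arg_min_nat_lemma[of "\<lambda>_. True" undefined "\<lambda>(i, j). d (L i) (M j)"]
      unfolding ab_def[symmetric] ab by auto
    have "d (L (a + e)) (M (b + f)) = d (L a) (M b) + 2" if "e \<in> {1, -1}" "f \<in> {1, -1}" for e f
    proof -
      have "d (L a) (L (a + e)) = 1" "d (M b) (M (b + f)) = 1"
        using lineD[OF L(1), of a "a + e"] lineD[OF M(1), of b "b + f"] that by auto
      moreover have "d (L a) (M b) \<noteq> 0" using False by simp
      moreover have "d (L (a + e)) (M b) = d (L a) (M b) + 1" "d (L a) (M (b + f)) = d (L a) (M b) + 1"
        using adj[of "L a" "L (a + e)" "M b"] adj[of "M b" "M (b + f)" "L a"]
          min[of "a + e" b] min[of a "b + f"] calculation by (auto simp: d_sym)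
      ultimately show ?thesis
        using four_point[of "L a" "M (b + f)" "L (a + e)" "M b"]
          d_tri[of "L (a + e)" "M (b + f)" "M b"] by (auto simp: d_sym)
    qed
    from this[of 1 1] this[of "-1" 1] this[of 1 "-1"] show thesis by (intro that[of 1 1 a b]) auto
  next
    case True
    define P where "P j \<longleftrightarrow> (\<exists>i. d (L i) (M j) = 0)" for j
    obtain j0 where "P j0" using True unfolding P_def by blast
    define b where "b = (ARG_MIN (\<lambda>j. nat \<bar>j - n\<bar>) j. P j)"
    have b: "P b" "\<And>j. P j \<Longrightarrow> nat \<bar>b - n\<bar> \<le> nat \<bar>j - n\<bar>"
      using arg_min_nat_lemma[of P j0 "\<lambda>j. nat \<bar>j - n\<bar>"] \<open>P j0\<close> unfolding b_def by auto
    have "b \<noteq> n"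
    proof
      assume "b = n"
      then obtain i where "d (L i) (M n) = 0" using b(1) unfolding P_def by blast
      then show False using ne[of i] by (simp add: d_sym)
    qed
    define f :: int where "f = (if b < n then 1 else -1)"
    have f: "f \<in> {1, -1}" by (simp add: f_def)
    have nP: "\<not> P (b + f)" using b(2)[of "b + f"] \<open>b \<noteq> n\<close> unfolding f_def by (auto split: if_splits)
    obtain a where a: "d (L a) (M b) = 0" using b(1) unfolding P_def by blast
    have two: "d (L (a + e)) (M (b + g)) = 2"
      if "e \<in> {1, -1}" "g \<in> {1, -1}" "d (L (a + e)) (M (b + g)) \<noteq> 0" for e g
    proof -
      have "d (L a) (L (a + e)) = 1" "d (M b) (M (b + g)) = 1"
        using lineD[OF L(1), of a "a + e"] lineD[OF M(1), of b "b + g"] that by auto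
      then show ?thesis
        using that(3) adj[of "M b" "M (b + g)" "L (a + e)"] d_zero(2)[OF a, of "L (a + e)"]
        by (auto simp: d_sym)
    qed
    \<comment> \<open>Backwards \<open>M\<close> may continue along \<open>L\<close>, but only in
      one of the two directions of \<open>L\<close>; \<open>e\<close> is a direction that it does
      not take.\<close>
    have "\<exists>e\<in>{1, -1}. d (L (a + e)) (M (b - f)) \<noteq> 0"
    proof (rule ccontr)
      assume "\<not> ?thesis"
      then have "d (L (a + 1)) (M (b - f)) = 0" "d (L (a - 1)) (M (b - f)) = 0" by auto
      then have "d (L (a + 1)) (L (a - 1)) = 0" using d_zero(1) by (metis d_sym)
      then show False using lineD[OF L(1), of "a + 1" "a - 1"] by simp
    qed
    then obtain e where e: "e \<in> {1, -1}" "d (L (a + e)) (M (b - f)) \<noteq> 0" by blast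
    show thesis
      using that[of e f a b] e f a two[of e f] two[of "- e" f] two[of e "- f"] nP unfolding P_def by auto
  qed
  obtain u' where u': "u' \<in> {u, - u}" "\<And>n. d (act u' (L (a + e * n))) (L (a + e * (n + k))) = 0"
    using reorient[of u L, OF L(2) ef(1), of a] by blast
  obtain v' where v': "v' \<in> {v, - v}" "\<And>n. d (act v' (M (b + f * n))) (M (b + f * (n + l))) = 0"
    using reorient[of v M, OF M(2) ef(2), of b] by blast
  have "free_pair u' v'"
    by (rule fork[where L = "\<lambda>n. L (a + e * n)" and M = "\<lambda>n. M (b + f * n)" and k = k and l = l])
      (use line_reparam L M u' v' D ef in auto)
  then show ?thesis using u' v' by blast
qed

definition preserves :: "'g \<Rightarrow> (int \<Rightarrow> 'v) \<Rightarrow> bool"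
  where "preserves s L \<longleftrightarrow> (\<exists>e\<in>{1, -1}. \<exists>c. \<forall>n. d (act s (L n)) (L (e * n + c)) = 0)"

lemma preservesI:
  assumes "line L" "\<forall>n. \<exists>m. d (act s (L n)) (L m) = 0"
  shows "preserves s L"
proof -
  obtain t where t: "\<And>n. d (act s (L n)) (L (t n)) = 0" using assms(2) by metis
  have "\<bar>t m - t n\<bar> = \<bar>m - n\<bar>" for m n
    using d_zero(1)[OF t[of m], of "L (t n)"] d_zero(2)[OF t[of n], of "act s (L m)"]
      lineD[OF assms(1), of "t m" "t n"] lineD[OF assms(1), of m n] by simp
  then obtain e where e: "e \<in> {1, -1}" "\<And>n. t n = e * n + t 0" using int_isometry[of t] by blast
  have "d (act s (L n)) (L (e * n + t 0)) = 0" for n using t[of n] e(2)[of n] by simp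
  then show ?thesis using e(1) unfolding preserves_def by blast
qed

lemma preserves_gen:
  assumes "line L" "\<And>s. s \<in> S \<Longrightarrow> preserves s L" "g \<in> gen S"
  shows "preserves g L"
proof -
  have one: "\<exists>m. d (act s (L n)) (L m) = 0" "\<exists>m. d (act (- s) (L n)) (L m) = 0" if s: "preserves s L" for s n
  proof -
    obtain e c where ec: "e \<in> {1, -1}" "\<And>n. d (act s (L n)) (L (e * n + c)) = 0"
      using s unfolding preserves_def by blast
    then show "\<exists>m. d (act s (L n)) (L m) = 0" by blast
    have "d (act (- s) (L n)) (L (e * (n - c))) = 0"
      using ec(2)[of "e * (n - c)"] ec(1) d_act_left[of "- s" "L n" "L (e * (n - c))"]
      by (auto simp: d_sym)
    then show "\<exists>m. d (act (- s) (L n)) (L m) = 0" by blast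
  qed
  have comp: "\<exists>m. d (act (x + y) (L n)) (L m) = 0"
    if xy: "\<forall>n. \<exists>m. d (act x (L n)) (L m) = 0" "\<forall>n. \<exists>m. d (act y (L n)) (L m) = 0" for x y n
  proof -
    obtain m where m: "d (act y (L n)) (L m) = 0" using xy(2) by blast
    obtain k where k: "d (act x (L m)) (L k) = 0" using xy(1) by blast
    have "d (act x (act y (L n))) (act x (L m)) = 0" using m by simp
    from d_zero(1)[OF this] show ?thesis using k by (auto simp: act_add)
  qed
  have "\<forall>n. \<exists>m. d (act g (L n)) (L m) = 0"
    using assms(3)
  proof (induction rule: gen_induct_left)
    case zero
    show ?case by (metis act_0 d_refl)
  qed (use comp one assms(2) in \<open>blast+\<close>)
  then show ?thesis using preservesI[OF assms(1)] by blast
qed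

theorem tree_alternative:
  assumes "finite S"
  obtains (free) "short_free_pair S"
    | (fixed) v where "\<And>s. s \<in> S \<Longrightarrow> d v (act s v) = 0"
    | (axis) L g c where "line L" "g \<in> gen S" "c > 0" "\<And>n. d (act g (L n)) (L (n + c)) = 0"
      "\<And>s. s \<in> gen S \<Longrightarrow> preserves s L"
proof (cases "\<exists>g\<in>word_ball S 2. \<forall>v. d v (act g v) \<noteq> 0")
  case True
  then obtain g where g: "g \<in> word_ball S 2" "\<And>v. d v (act g v) \<noteq> 0" by blast
  obtain L c where L: "line L" "c > 0" "\<And>n. d (act g (L n)) (L (n + c)) = 0"
    using axis_exists[OF g(2)] by blast
  show thesis
  proof (cases "\<forall>s\<in>S. preserves s L")
    case True
    then show thesis using axis[of L g c] L preserves_gen[OF L(1)] word_ball_gen g(1) by blast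
  next
    case False
    then obtain s where s: "s \<in> S" "\<not> preserves s L" by blast
    have "\<not> (\<forall>n. \<exists>m. d (act s (L n)) (L m) = 0)" using preservesI[OF L(1), of s] s(2) by blast
    then obtain n where n: "\<And>m. d (act s (L n)) (L m) \<noteq> 0" by auto
    let ?h = "s + g - s" and ?M = "\<lambda>n. act s (L n)"
    have M: "line ?M" using L(1) by (simp add: line_def)
    have "act ?h (?M n) = act s (act g (L n))" for n
      by (simp add: act_add del: add_uminus_conv_diff add: diff_conv_add_uminus)
    then have "d (act ?h (?M n)) (?M (n + c)) = 0" for n using L(3) by simp
    from free_pair_if_distinct_axes[OF L(1,3,2) M this L(2) n]
    obtain u v where uv: "u \<in> {g, - g}" "v \<in> {?h, - ?h}" "free_pair u v" by blast
    have sgn: "x \<in> word_ball S n" if "x \<in> {y, - y}" "y \<in> word_ball S n" for x y n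
      using that word_ball_uminus by blast
    have "s \<in> word_ball S 1" "- s \<in> word_ball S 1"
      using s(1) word_ball_base word_ball_uminus by blast+
    then have "(s + g) + - s \<in> word_ball S ((1 + 2) + 1)"
      using g(1) by (intro word_ball_add)
    moreover have "(1 + 2) + 1 = (4::nat)" by simp
    ultimately have "?h \<in> word_ball S 4" by (simp only: add_uminus_conv_diff)
    then have "u \<in> word_ball S 4" "v \<in> word_ball S 4"
      using sgn[OF uv(1) g(1)] sgn[OF uv(2)] word_ball_mono[of 2 4 S] by auto
    then show thesis using uv(3) free unfolding short_free_pair_def by blast
  qed
next
  case False
  show thesis
  proof (cases "S = {}")
    case True
    then show thesis using fixed by blast
  next
    case nonempty: False
    have "\<exists>v. \<forall>s\<in>S. v \<in> {v. d v (act s v) = 0}"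
    proof (rule helly[OF assms nonempty fix_convex])
      fix s t assume st: "s \<in> S" "t \<in> S"
      have "s \<in> word_ball S 1" "t \<in> word_ball S 1" using st word_ball_base by blast+
      then have "s + t \<in> word_ball S 2" "s \<in> word_ball S 2" "t \<in> word_ball S 2"
        using word_ball_mono[of 1 2 S] word_ball_add[of s S 1 t 1] by (auto simp: numeral_2_eq_2)
      then have "\<exists>v. d v (act s v) = 0" "\<exists>v. d v (act t v) = 0" "\<exists>v. d v (act (s + t) v) = 0"
        using False by auto
      then obtain a b p where "d a (act s a) = 0" "d b (act t b) = 0" "d p (act (s + t) p) = 0" by blast
      then obtain m where "d m (act s m) = 0" "d m (act t m) = 0" by (rule elliptic_product)
      then show "{v. d v (act s v) = 0} \<inter> {v. d v (act t v) = 0} \<noteq> {}" by blast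
    qed
    then show thesis using fixed by blast
  qed
qed

subsection \<open>Invariant subtrees\<close>

text \<open>The point \<open>y\<close> of the invariant subtree nearest to \<open>v\<close> is
  fixed: otherwise the geodesic from \<open>y\<close> to \<open>act k y\<close>, whose ends are
  equally far from \<open>v\<close>, starts with a step towards \<open>v\<close>, and this step
  stays in \<open>Y\<close> because \<open>Y\<close> is connected.\<close>

lemma fixed_point_in_subtree:
  assumes R: "\<And>u u'. (u, u') \<in> R \<Longrightarrow> d u u' = 1 \<and> u' \<in> Y" and Y: "y0 \<in> Y" "\<And>x y. x \<in> Y \<Longrightarrow> y \<in> Y \<Longrightarrow> (x, y) \<in> R\<^sup>*"
    and K: "\<And>k y. k \<in> K \<Longrightarrow> y \<in> Y \<Longrightarrow> act k y \<in> Y" and v: "\<And>k. k \<in> K \<Longrightarrow> d v (act k v) = 0"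
  obtains y where "y \<in> Y" "\<And>k. k \<in> K \<Longrightarrow> d y (act k y) = 0"
proof -
  define y where "y = (ARG_MIN (d v) y. y \<in> Y)"
  have y: "y \<in> Y" "\<And>z. z \<in> Y \<Longrightarrow> d v y \<le> d v z"
    using arg_min_nat_lemma[of "\<lambda>y. y \<in> Y" y0 "d v"] Y(1) unfolding y_def by auto
  have "d y (act k y) = 0" if k: "k \<in> K" for k
  proof (rule ccontr)
    assume "d y (act k y) \<noteq> 0"
    then obtain n where n: "d y (act k y) = Suc n" by (meson not0_implies_Suc)
    then obtain z where z: "d y z = 1" "d z (act k y) = n" using step by blast
    have vk: "d v (act k y) = d v y" using d_zero(1)[OF v[OF k], of "act k y"] by simp
    have "odd n" using act_even[of y k] n by simp
    then have "n > 0" by (rule odd_pos)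
    then have "d v z < d v y"
      using four_point[of v z y "act k y"] n z vk act_even[of y k] by (auto simp: d_sym)
    obtain u u' where "(u, u') \<in> R" "d u' z = 0"
    proof (rule edge_on_walk[of R y "act k y" y z])
      show "(y, act k y) \<in> R\<^sup>*" using Y(2) y(1) K k by blast
    qed (use R z n in \<open>auto simp: d_sym\<close>)
    then show False using y(2)[of u'] R d_zero(2)[of u' z v] \<open>d v z < d v y\<close> by auto
  qed
  then show thesis using that y(1) by blast
qed

text \<open>Translates of \<open>y\<close> by high multiples of \<open>g\<close> project to the line
  on either side of the edge from \<open>L n\<close> to \<open>L (n + 1)\<close>; a walk between
  them inside \<open>Y\<close> has to cross this edge.\<close>

lemma axis_in_subtree:
  assumes R: "\<And>u u'. (u, u') \<in> R \<Longrightarrow> d u u' = 1" and Y: "y \<in> Y" "\<And>x y. x \<in> Y \<Longrightarrow> y \<in> Y \<Longrightarrow> (x, y) \<in> R\<^sup>*"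
    and g: "\<And>k y. y \<in> Y \<Longrightarrow> act (zmul k g) y \<in> Y"
    and L: "line L" "\<And>n. d (act g (L n)) (L (n + c)) = 0" "c \<noteq> 0"
  obtains u u' where "(u, u') \<in> R" "d u (L n) = 0" "d u' (L (n + 1)) = 0"
proof -
  obtain n0 D where p: "\<And>n. int (d y (L n)) = int D + \<bar>n - n0\<bar>" using line_proj[OF L(1)] by blast
  have pk: "int (d (act (zmul k g) y) (L n)) = int D + \<bar>n - k * c - n0\<bar>" for k n
  proof -
    have "d (act (zmul k g) y) (L n) = d y (L (n - k * c))"
      using act_zmul_line[of g L c "- k" n] L(2) d_zero(2)[of "act (zmul (- k) g) (L n)" "L (n - k * c)" y]
        d_act_left[of "zmul k g" y "L n"] by (simp add: zmul_neg)
    then show ?thesis using p by simp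
  qed
  \<comment> \<open>\<open>n0\<close> is the projection of \<open>y\<close>. With \<open>s\<close>
    the sign of \<open>c\<close>, the shift \<open>s * N * c\<close> is at least \<open>N\<close>
    and so carries \<open>n0\<close> beyond \<open>n\<close>, whatever the direction of
    \<open>g\<close>.\<close>
  define N where "N = \<bar>n - n0\<bar> + 1"
  define s where "s = sgn c"
  have N: "s * N * c \<ge> N" "- (s * N) * c \<le> - N"
  proof -
    have sc: "s * c = \<bar>c\<bar>" by (simp add: s_def sgn_if)
    have "s * N * c = N * (s * c)" by simp
    then have e: "s * N * c = N * \<bar>c\<bar>" unfolding sc .
    have "N * \<bar>c\<bar> \<ge> N * 1" using L(3) unfolding N_def by (intro mult_left_mono) auto
    then show "s * N * c \<ge> N" unfolding e by simp
    then show "- (s * N) * c \<le> - N" by (simp only: mult_minus_left neg_le_iff_le)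
  qed
  let ?x = "act (zmul (- (s * N)) g) y" and ?y = "act (zmul (s * N) g) y"
  show thesis
  proof (rule edge_on_walk[of R ?x ?y "L n" "L (n + 1)"])
    show "(?x, ?y) \<in> R\<^sup>*" using Y g by blast
    show "d (L n) (L (n + 1)) = 1" using lineD[OF L(1), of n "n + 1"] by simp
    show "d ?x (L n) < d ?x (L (n + 1))"
      using pk[of "- (s * N)" n] pk[of "- (s * N)" "n + 1"] N(2) unfolding N_def by linarith
    show "d ?y (L (n + 1)) < d ?y (L n)"
      using pk[of "s * N" n] pk[of "s * N" "n + 1"] N(1) unfolding N_def by linarith
  qed (use R that in auto)
qed

end

section \<open>Amalgamated products\<close>

typedef 'a bijection = "{f::'a \<Rightarrow> 'a. bij f}" morphisms apply_bij Bijection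
  by (rule exI[of _ id]) simp

setup_lifting type_definition_bijection

instantiation bijection :: (type) group_add
begin

lift_definition zero_bijection :: "'a bijection" is "\<lambda>x. x" by (rule bij_id[unfolded id_def])
lift_definition plus_bijection :: "'a bijection \<Rightarrow> 'a bijection \<Rightarrow> 'a bijection" is "\<lambda>f g x. f (g x)"
  using bij_comp by (simp add: comp_def)
lift_definition uminus_bijection :: "'a bijection \<Rightarrow> 'a bijection" is "inv_into UNIV"
  by (rule bij_imp_bij_inv)
definition minus_bijection :: "'a bijection \<Rightarrow> 'a bijection \<Rightarrow> 'a bijection"
  where "minus_bijection f g = f + - g"

instance
proof
  fix f g h :: "'a bijection"
  show "f + g + h = f + (g + h)" by transfer simp
  show "0 + f = f" "f + 0 = f" by (transfer, simp)+
  show "- f + f = 0" by transfer (simp add: bij_is_inj)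
  show "f + - g = f - g" by (simp add: minus_bijection_def)
qed

end

lemma bijectionI:
  assumes "\<And>x. f (g x) = x" "\<And>x. g (f x) = x"
  shows "bij f"
  by (rule o_bij[of g]) (use assms in auto)

subsection \<open>Existence: the action on normal forms\<close>

text \<open>The group \<open>C\<close> of pairs is the graph of an isomorphism between two subgroups of \<open>'a\<close>. The
  amalgamated product of two copies of \<open>'a\<close> along \<open>C\<close> acts on the normal forms \<open>c + r\<^sub>1 + \<dots> + r\<^sub>n\<close>,
  where \<open>c\<close> is in \<open>C\<close> and the \<open>r\<^sub>i\<close> are nontrivial representatives of right cosets of \<open>C\<close>, taken
  alternately in the two copies.\<close>

locale pushout =
  fixes C :: "('a::group_add \<times> 'a) set"
  assumes subgrp_C: "subgrp C"
    and inj_C: "(x, 0) \<in> C \<Longrightarrow> x = 0" "(0, x) \<in> C \<Longrightarrow> x = 0"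
begin

definition pr :: "bool \<Rightarrow> 'a \<times> 'a \<Rightarrow> 'a"
  where "pr b c = (if b then fst c else snd c)"

lemma pr_simps [simp]: "pr True c = fst c" "pr False c = snd c"
  "pr b (c + c') = pr b c + pr b c'" "pr b (- c) = - pr b c" "pr b 0 = 0"
  by (simp_all add: pr_def)

text \<open>Normalised to 0 on the amalgamated subgroup itself; in that case \<open>join\<close>
  adds no letter.\<close>

definition rep :: "bool \<Rightarrow> 'a \<Rightarrow> 'a"
  where "rep b x = (if x \<in> pr b ` C then 0 else SOME y. \<exists>c\<in>C. x = pr b c + y)"

definition coef :: "bool \<Rightarrow> 'a \<Rightarrow> 'a \<times> 'a"
  where "coef b x = (THE c. c \<in> C \<and> x = pr b c + rep b x)"

lemmas C_closed = subgrpD(1-3)[OF subgrp_C]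

lemma pr_inj:
  assumes "c \<in> C" "c' \<in> C" "pr b c = pr b c'"
  shows "c = c'"
proof -
  have "c + - c' \<in> C" using assms C_closed by blast
  moreover have "pr b (c + - c') = 0" unfolding pr_simps assms(3) by simp
  moreover obtain p q where pq: "c + - c' = (p, q)" by fastforce
  ultimately have "p = 0 \<and> q = 0" using inj_C unfolding pq by (cases b) auto
  then have "c + - c' = 0" unfolding pq by (simp add: zero_prod_def)
  then show ?thesis by simp
qed

lemma rep_coset:
  assumes c: "c \<in> C"
  shows "rep b (pr b c + x) = rep b x"
proof -
  have in_iff: "pr b c + x \<in> pr b ` C \<longleftrightarrow> x \<in> pr b ` C"
  proof
    assume "pr b c + x \<in> pr b ` C"
    then obtain c' where c': "c' \<in> C" "pr b c + x = pr b c'" by blast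
    then have "x = - pr b c + pr b c'" by (metis minus_add_cancel)
    then have "x = pr b (- c + c')" by simp
    moreover have "- c + c' \<in> C" using c c' C_closed by simp
    ultimately show "x \<in> pr b ` C" by blast
  next
    assume "x \<in> pr b ` C"
    then obtain c' where "c' \<in> C" "x = pr b c'" by blast
    then have "c + c' \<in> C" "pr b c + x = pr b (c + c')" using c C_closed by simp_all
    then show "pr b c + x \<in> pr b ` C" by blast
  qed
  have "(\<exists>c'\<in>C. pr b c + x = pr b c' + y) \<longleftrightarrow> (\<exists>c'\<in>C. x = pr b c' + y)" for y
  proof
    assume "\<exists>c'\<in>C. pr b c + x = pr b c' + y"
    then obtain c' where c': "c' \<in> C" "pr b c + x = pr b c' + y" by blast
    then have "x = - pr b c + (pr b c' + y)" by (metis minus_add_cancel)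
    then have "x = pr b (- c + c') + y" by (simp add: add.assoc)
    moreover have "- c + c' \<in> C" using c c' C_closed by simp
    ultimately show "\<exists>c'\<in>C. x = pr b c' + y" by blast
  next
    assume "\<exists>c'\<in>C. x = pr b c' + y"
    then obtain c' where "c' \<in> C" "x = pr b c' + y" by blast
    then have "c + c' \<in> C" "pr b c + x = pr b (c + c') + y" using c C_closed by (simp_all add: add.assoc)
    then show "\<exists>c'\<in>C. pr b c + x = pr b c' + y" by blast
  qed
  then show ?thesis unfolding rep_def in_iff by simp
qed

lemma coef_exists: "\<exists>c. c \<in> C \<and> x = pr b c + rep b x"
proof (cases "x \<in> pr b ` C")
  case True
  then show ?thesis by (auto simp: rep_def)
next
  case False
  have "\<exists>y. \<exists>c\<in>C. x = pr b c + y" using C_closed(1) by (intro exI[of _ x] bexI[of _ 0]) simp_all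
  then have "\<exists>c\<in>C. x = pr b c + (SOME y. \<exists>c\<in>C. x = pr b c + y)" by (rule someI_ex)
  then show ?thesis using False by (auto simp: rep_def)
qed

lemma coef_eqI: "c \<in> C \<Longrightarrow> x = pr b c + rep b x \<Longrightarrow> coef b x = c"
  unfolding coef_def
proof (rule the_equality)
  fix c' assume c: "c \<in> C" "x = pr b c + rep b x" and c': "c' \<in> C \<and> x = pr b c' + rep b x"
  then have "pr b c' = pr b c" by (metis add_right_cancel)
  then show "c' = c" using pr_inj[of c' c b] c c' by blast
qed simp

lemma coef: "coef b x \<in> C" "pr b (coef b x) + rep b x = x"
  using coef_exists[of x b] coef_eqI by metis+

lemma coef_coset:
  assumes "c \<in> C"
  shows "coef b (pr b c + x) = c + coef b x"
proof (rule coef_eqI)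
  show "c + coef b x \<in> C" using assms coef C_closed by simp
  show "pr b c + x = pr b (c + coef b x) + rep b (pr b c + x)"
    using assms by (simp add: rep_coset add.assoc coef)
qed

lemma rep_eq_0_iff: "rep b x = 0 \<longleftrightarrow> x \<in> pr b ` C"
proof
  assume "rep b x = 0"
  then have "x = pr b (coef b x)" using coef(2)[of b x] by simp
  then show "x \<in> pr b ` C" using coef(1)[of b x] by (rule image_eqI)
qed (simp add: rep_def)

lemma rep_rep: "rep b (rep b x) = rep b x"
  using rep_coset[OF coef(1), of b b x "rep b x"] coef(2)[of b x] by simp

lemma coef_rep: "rep b r = r \<Longrightarrow> coef b r = 0"
  by (rule coef_eqI) (simp_all add: C_closed)

fun starts :: "bool \<Rightarrow> (bool \<times> 'a) list \<Rightarrow> bool" where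
  "starts b [] = False"
| "starts b ((b', r) # l) = (b' = b)"

fun nform :: "(bool \<times> 'a) list \<Rightarrow> bool" where
  "nform [] = True"
| "nform ((b, r) # l) = (rep b r = r \<and> r \<noteq> 0 \<and> \<not> starts b l \<and> nform l)"

definition forms :: "(('a \<times> 'a) \<times> (bool \<times> 'a) list) set"
  where "forms = {(c, l). c \<in> C \<and> nform l}"

text \<open>Splits off the part of a normal form that lies in copy \<open>b\<close>: the coefficient
  and, if it belongs to this copy, the first letter. On normal forms \<open>join\<close> inverts
  this, so the copy can act by left translation of that part. This is van der Waerden's device for
  proving normal form theorems.\<close>

definition unjoin :: "bool \<Rightarrow> ('a \<times> 'a) \<times> (bool \<times> 'a) list \<Rightarrow> 'a \<times> (bool \<times> 'a) list"
  where "unjoin b w = (if starts b (snd w) then (pr b (fst w) + snd (hd (snd w)), tl (snd w))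
    else (pr b (fst w), snd w))"

definition join :: "bool \<Rightarrow> 'a \<times> (bool \<times> 'a) list \<Rightarrow> ('a \<times> 'a) \<times> (bool \<times> 'a) list"
  where "join b p = (coef b (fst p), if rep b (fst p) = 0 then snd p else (b, rep b (fst p)) # snd p)"

lemma unjoin_join:
  assumes "nform l" "\<not> starts b l"
  shows "join b (x, l) \<in> forms" "unjoin b (join b (x, l)) = (x, l)"
  using assms coef[of b x] by (auto simp: join_def unjoin_def forms_def rep_rep)

lemma join_unjoin:
  assumes "w \<in> forms"
  shows "join b (unjoin b w) = w" "nform (snd (unjoin b w))" "\<not> starts b (snd (unjoin b w))"
proof -
  obtain c l where w: "w = (c, l)" "c \<in> C" "nform l" using assms by (auto simp: forms_def)
  have "rep b 0 = 0" unfolding rep_eq_0_iff using C_closed(1) by (auto intro: image_eqI[of _ _ 0])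
  then have "rep b (pr b c) = 0" "coef b (pr b c) = c"
    using rep_coset[OF w(2), of b 0] coef_coset[OF w(2), of b 0] coef_rep[of b 0] by simp_all
  then show "join b (unjoin b w) = w" "nform (snd (unjoin b w))" "\<not> starts b (snd (unjoin b w))"
    using w by (cases l; auto simp: unjoin_def join_def rep_coset coef_coset coef_rep)+
qed

text \<open>The identity off the normal forms, so that it is a permutation of the whole
  type.\<close>

definition move :: "bool \<Rightarrow> 'a \<Rightarrow> ('a \<times> 'a) \<times> (bool \<times> 'a) list \<Rightarrow> ('a \<times> 'a) \<times> (bool \<times> 'a) list"
  where "move b x w = (if w \<in> forms then join b (x + fst (unjoin b w), snd (unjoin b w)) else w)"

lemma move_forms: "w \<in> forms \<Longrightarrow> move b x w \<in> forms"
  using unjoin_join(1) join_unjoin by (auto simp: move_def)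

lemma move_0: "move b 0 w = w"
  by (simp add: move_def join_unjoin)

lemma move_move: "move b x (move b y w) = move b (x + y) w"
proof (cases "w \<in> forms")
  case True
  show ?thesis using True unjoin_join[OF join_unjoin(2,3)[OF True]]
    by (simp add: move_def add.assoc)
qed (simp add: move_def)

lemma move_C: "c \<in> C \<Longrightarrow> (c', l) \<in> forms \<Longrightarrow> move b (pr b c) (c', l) = (c + c', l)"
proof -
  assume c: "c \<in> C" and w: "(c', l) \<in> forms"
  let ?u = "unjoin b (c', l)"
  have j: "join b ?u = (c', l)" using join_unjoin(1)[OF w] .
  have "join b (pr b c + fst ?u, snd ?u) = (c + fst (join b ?u), snd (join b ?u))"
    using c by (simp add: join_def rep_coset coef_coset)
  then show ?thesis using w by (simp add: move_def j)
qed

definition copy :: "bool \<Rightarrow> 'a \<Rightarrow> (('a \<times> 'a) \<times> (bool \<times> 'a) list) bijection"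
  where "copy b x = Bijection (move b x)"

lemma apply_copy: "apply_bij (copy b x) = move b x"
proof -
  have "bij (move b x)"
    by (rule bijectionI[of _ "move b (- x)"]) (simp_all add: move_move move_0)
  then show ?thesis by (simp add: copy_def Bijection_inverse)
qed

lemma copy_add: "copy b (x + y) = copy b x + copy b y"
  by (rule apply_bij_inject[THEN iffD1]) (simp add: plus_bijection.rep_eq apply_copy move_move)

lemma copy_C:
  assumes "c \<in> C"
  shows "copy True (fst c) = copy False (snd c)"
proof (rule apply_bij_inject[THEN iffD1], rule ext)
  fix w
  have "move True (fst c) w = move False (snd c) w"
  proof (cases "w \<in> forms")
    case True
    then show ?thesis using move_C[OF assms, of "fst w" "snd w" True] move_C[OF assms, of "fst w" "snd w" False]
      by simp
  qed (simp add: move_def)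
  then show "apply_bij (copy True (fst c)) w = apply_bij (copy False (snd c)) w" by (simp add: apply_copy)
qed

lemma copy_eq_0:
  assumes "copy b x = 0"
  shows "x = 0"
proof -
  have "(0, []) \<in> forms" by (simp add: forms_def C_closed)
  moreover have "move b x = (\<lambda>w. w)"
    using assms apply_copy[of b x] by (simp add: zero_bijection.rep_eq)
  then have "move b x (0, []) = (0, [])" by (rule fun_cong)
  ultimately have "join b (x, []) = (0, [])" by (simp add: move_def unjoin_def)
  then have "unjoin b (join b (x, [])) = (0, [])" by (simp add: unjoin_def)
  then show ?thesis using unjoin_join(2)[of "[]" b x] by simp
qed

lemma copy_inj: "copy b x = copy b y \<Longrightarrow> x = y"
  using copy_eq_0[of b "x - y"] copy_add[of b "x - y" y] add_right_cancel[of "copy b (x - y)" "copy b y" 0]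
  by simp

text \<open>Applied to the trivial form \<open>(0, [])\<close>, each letter of a reduced word adds
  one letter, because it lies outside the amalgamated subgroup; the result has the length of the
  word.\<close>

lemma copy_word_ne_0:
  assumes "red (\<lambda>b. range (copy b)) b0 xs" "xs \<noteq> []"
  shows "sum_list xs \<noteq> 0"
proof -
  have notin: "x \<notin> pr b ` C" if "copy b x \<notin> range (copy (\<not> b))" for b x
  proof
    assume "x \<in> pr b ` C"
    then obtain c where c: "c \<in> C" "x = pr b c" by blast
    then have "copy b x = copy (\<not> b) (pr (\<not> b) c)" using copy_C[OF c(1)] by (cases b) simp_all
    then show False using that by simp
  qed
  have "\<exists>c l. (c, l) \<in> forms \<and> apply_bij (sum_list xs) (0, []) = (c, l) \<and> length l = length xs \<and>
      (\<forall>b. starts b l \<longrightarrow> b = b0)"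
    using assms(1)
  proof (induction xs arbitrary: b0)
    case Nil
    then show ?case using C_closed(1)
      by (intro exI[of _ "0 :: 'a \<times> 'a"] exI[of _ "[]"]) (simp add: zero_bijection.rep_eq forms_def)
  next
    case (Cons y ys)
    then obtain x where x: "y = copy b0 x" "x \<notin> pr b0 ` C" using notin by auto
    obtain c l where w: "(c, l) \<in> forms" "apply_bij (sum_list ys) (0, []) = (c, l)" "length l = length ys"
      "\<And>b. starts b l \<Longrightarrow> b = (\<not> b0)"
      using Cons.IH[of "\<not> b0"] Cons.prems by auto
    have ns: "\<not> starts b0 l" using w(4) by blast
    have c: "c \<in> C" using w(1) by (simp add: forms_def)
    have "rep b0 (x + pr b0 c) \<noteq> 0"
    proof
      assume "rep b0 (x + pr b0 c) = 0"
      then obtain c' where c': "c' \<in> C" "x + pr b0 c = pr b0 c'" unfolding rep_eq_0_iff by blast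
      then have "x = pr b0 (c' + - c)" by (metis pr_simps(3,4) add.assoc right_minus add_0_right)
      moreover have "c' + - c \<in> C" by (intro C_closed(2,3) c c')
      ultimately show False using x(2) by blast
    qed
    then have "apply_bij (sum_list (y # ys)) (0, []) = (coef b0 (x + pr b0 c), (b0, rep b0 (x + pr b0 c)) # l)"
      using w(1,2) ns by (simp add: plus_bijection.rep_eq x(1) apply_copy move_def unjoin_def join_def)
    moreover have "apply_bij (sum_list (y # ys)) (0, []) \<in> forms"
      using w move_forms by (simp add: plus_bijection.rep_eq x(1) apply_copy)
    ultimately show ?case using w(3)
      by (intro exI[of _ "coef b0 (x + pr b0 c)"] exI[of _ "(b0, rep b0 (x + pr b0 c)) # l"]) simp
  qed
  then show ?thesis using assms(2) by (auto simp: zero_bijection.rep_eq zero_prod_def)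
qed

text \<open>If \<open>(x, y)\<close> were not in \<open>C\<close>, the left side would give the
  trivial form a letter of copy \<open>True\<close>, which the right side cannot do.\<close>

lemma copy_Int:
  assumes "copy True x = copy False y"
  shows "(x, y) \<in> C"
proof (rule ccontr)
  assume n: "(x, y) \<notin> C"
  have "x \<notin> fst ` C"
  proof
    assume "x \<in> fst ` C"
    then obtain y' where y': "(x, y') \<in> C" by force
    then have "copy False y' = copy False y" using copy_C assms by fastforce
    then show False using n y' copy_inj by blast
  qed
  have "(0, []) \<in> forms" by (simp add: forms_def C_closed)
  then have "move True x (0, []) = (coef True x, [(True, rep True x)])"
    using \<open>x \<notin> fst ` C\<close> rep_eq_0_iff[of True x] by (simp add: move_def unjoin_def join_def)
  moreover have "move True x (0, []) = move False y (0, [])"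
    using assms apply_copy by metis
  ultimately show False
    using \<open>(0, []) \<in> forms\<close> by (auto simp: move_def unjoin_def join_def split: if_splits)
qed

text \<open>For comparing other groups with the amalgam: \<open>f\<close> is applied letter by
  letter and may be a projection, a choice function or a homomorphism.\<close>

lemma copy_word_ne_0':
  assumes "red Y b0 xs" "xs \<noteq> []" "\<And>b x. x \<in> Y b \<Longrightarrow> x \<notin> Y (\<not> b) \<Longrightarrow> \<exists>y. f x = copy b y \<and> y \<notin> pr b ` C"
  shows "sum_list (map f xs) \<noteq> 0"
proof -
  have "red (\<lambda>b. range (copy b)) b0 (map f xs)"
    using assms(1)
  proof (induction xs arbitrary: b0)
    case (Cons x xs)
    have x: "x \<in> Y b0" "x \<notin> Y (\<not> b0)" "red Y (\<not> b0) xs" using Cons.prems by simp_all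
    obtain y where y: "f x = copy b0 y" "y \<notin> pr b0 ` C" using assms(3)[OF x(1,2)] by blast
    have "copy b0 y \<notin> range (copy (\<not> b0))"
      using y(2) copy_Int by (cases b0) (force simp: image_iff)+
    then show ?case using Cons.IH[OF x(3)] y(1) by simp
  qed simp
  then show ?thesis using copy_word_ne_0 assms(2) by auto
qed

end

subsection \<open>Subgroups forming an amalgam\<close>

text \<open>The subgroup generated by \<open>M True\<close> and \<open>M False\<close> is their amalgamated product along their
  intersection.\<close>

locale amalgam =
  fixes M :: "bool \<Rightarrow> 'g::group_add set"
  assumes subgrp_M: "subgrp (M b)"
    and red_ne_0: "red M b xs \<Longrightarrow> xs \<noteq> [] \<Longrightarrow> sum_list xs \<noteq> 0"
begin

lemmas M_closed = subgrpD(1-3)[OF subgrp_M]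

lemma red_absorb:
  assumes "red M b (w # ws)" "e \<in> M b" "e \<in> M (\<not> b)"
  shows "red M b ((e + w) # ws)"
  using assms by (simp add: subgrp_cancel[OF subgrp_M])

text \<open>Otherwise the negative of the sum, prepended as a letter or, if it lies in both
  subgroups, merged into the first letter, gives a nonempty reduced word with sum 0.\<close>

lemma red_not_in_other:
  assumes xs: "red M b xs" "xs \<noteq> []"
  shows "sum_list xs \<notin> M (\<not> b)"
proof
  assume e: "sum_list xs \<in> M (\<not> b)"
  define e where "e = - sum_list xs"
  have em: "e \<in> M (\<not> b)" using e M_closed by (simp add: e_def)
  obtain w ws where ws: "xs = w # ws" using xs(2) by (meson neq_Nil_conv)
  show False
  proof (cases "e \<in> M b")
    case True
    then have "red M b ((e + w) # ws)" using red_absorb em xs(1) ws by blast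
    then have "sum_list ((e + w) # ws) \<noteq> 0" using red_ne_0 by blast
    then show False by (simp add: ws e_def add.assoc del: add_uminus_conv_diff)
  next
    case False
    then have "red M (\<not> b) (e # xs)" using em xs by simp
    then have "sum_list (e # xs) \<noteq> 0" using red_ne_0 by blast
    then show False by (simp add: e_def)
  qed
qed

lemma red_not_in:
  assumes xs: "red M b (x # y # ys)"
  shows "sum_list (x # y # ys) \<notin> M b'"
proof (cases "b' = b")
  case False
  then show ?thesis using red_not_in_other[OF xs] by (cases b; cases b') auto
next
  case True
  have "sum_list (y # ys) \<notin> M (\<not> (\<not> b))"
    by (rule red_not_in_other) (use xs in simp_all)
  moreover have "x \<in> M b" using xs by simp
  ultimately show ?thesis using True by (simp add: subgrp_cancel(1)[OF subgrp_M])
qed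

text \<open>The condition \<open>eq\<close> makes reduced words over \<open>P\<close> reduced over
  \<open>M\<close>, so those with two or more letters lie in neither \<open>M b\<close>. Several
  intersections of subgroups of the Higman group are computed with this.\<close>

lemma sub_amalgam:
  assumes P: "\<And>b. subgrp (P b)" "\<And>b. P b \<subseteq> M b"
    and eq: "P True \<inter> M False = P False \<inter> M True"
  shows "gen (P True \<union> P False) \<inter> M b = P b"
proof -
  have D: "x \<in> P (\<not> b)" if "x \<in> P b" "x \<in> M (\<not> b)" for x b
    using that eq P(2) by (cases b) auto
  have red: "red M b xs" if "red P b xs" for b xs
    using that
  proof (induction xs arbitrary: b)
    case (Cons x xs)
    then show ?case using P(2)[of b] D[of x b] by auto
  qed simp
  have "x \<in> P b" if x: "x \<in> gen (P True \<union> P False)" "x \<in> M b" for x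
    using P(1) x(1)
  proof (cases rule: gen_red_cases)
    case 1
    then show ?thesis by (cases b) auto
  next
    case (2 b' xs)
    show ?thesis
    proof (cases xs)
      case (Cons y ys)
      show ?thesis
      proof (cases ys)
        case Nil
        then have "x = y" "y \<in> P b'" using 2 Cons by simp_all
        then show ?thesis using D[of y b'] x(2) by (cases b; cases b') auto
      next
        case (Cons z zs)
        then show ?thesis using red_not_in[of b' y z zs b] red 2 \<open>xs = y # ys\<close> x(2) by blast
      qed
    qed (use 2 in simp)
  qed
  moreover have "P b \<subseteq> gen (P True \<union> P False)" by (cases b) (auto intro: gen.base)
  ultimately show ?thesis using P(2)[of b] by auto
qed

end

section \<open>The Higman group as an amalgam\<close>

subsection \<open>The dyadic affine group\<close>

text \<open>\<open>Aff k q\<close> is the map \<open>x \<mapsto> 2\<^sup>k x + q\<close>.\<close>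

datatype aff = Aff int real

instantiation aff :: group_add
begin

definition zero_aff :: aff where "zero_aff = Aff 0 0"

fun plus_aff :: "aff \<Rightarrow> aff \<Rightarrow> aff"
  where "plus_aff (Aff k q) (Aff l r) = Aff (k + l) (q + 2 powi k * r)"

fun uminus_aff :: "aff \<Rightarrow> aff"
  where "uminus_aff (Aff k q) = Aff (- k) (- (2 powi (- k) * q))"

definition minus_aff :: "aff \<Rightarrow> aff \<Rightarrow> aff" where "minus_aff f g = f + - g"

instance
proof
  fix f g h :: aff
  show "f + g + h = f + (g + h)"
    by (cases f; cases g; cases h) (simp add: power_int_add algebra_simps)
  show "0 + f = f" "f + 0 = f" by (cases f; simp add: zero_aff_def)+
  show "- f + f = 0" by (cases f) (simp add: zero_aff_def)
  show "f + - g = f - g" by (simp add: minus_aff_def)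
qed

end

lemma zmul_aff: "zmul k (Aff 1 0) = Aff k 0" "zmul k (Aff 0 q) = Aff 0 (of_int k * q)"
proof -
  show "zmul k (Aff 1 0) = Aff k 0"
    by (induction k rule: int_induct[where k = 0])
      (simp_all only: zmul_succ zmul_pred zmul_0, simp_all add: zero_aff_def)
  show "zmul k (Aff 0 q) = Aff 0 (of_int k * q)"
    by (induction k rule: int_induct[where k = 0])
      (simp_all only: zmul_succ zmul_pred zmul_0, simp_all add: zero_aff_def algebra_simps)
qed

lemma diff_aff: "Aff k q - Aff l r = Aff (k - l) (q - 2 powi (k - l) * r)"
  by (simp add: minus_aff_def power_int_diff power_int_minus field_simps)

subsection \<open>Two models\<close>

text \<open>\<open>C3\<close> identifies the translation \<open>x \<mapsto> x + 1\<close> of one affine group with the scaling \<open>x \<mapsto> 2x\<close> of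
  another one; in the amalgam, \<open>m0\<close>, \<open>m1\<close> and \<open>m2\<close> satisfy two of the four Higman relations. \<open>C4\<close> identifies
  the free groups on \<open>m0\<close> and \<open>m2\<close> in two copies of this amalgam by exchanging the generators, which
  gives a model of the Higman group.\<close>

definition C3 :: "(aff \<times> aff) set" where "C3 = gen {(Aff 0 1, Aff 1 0)}"

lemma C3_iff: "p \<in> C3 \<longleftrightarrow> (\<exists>k. p = (Aff 0 (of_int k), Aff k 0))"
proof -
  have "zmul k (Aff 0 1, Aff 1 0) = (Aff 0 (of_int k), Aff k 0)" for k
    by (rule prod_eqI) (simp_all add: zmul_aff)
  then show ?thesis by (auto simp: C3_def gen_singleton)
qed

interpretation P3: pushout C3
proof
  show "subgrp C3" by (simp add: C3_def)
qed (auto simp: C3_iff zero_aff_def)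

type_synonym w3 = "((aff \<times> aff) \<times> (bool \<times> aff) list) bijection"

definition m0 :: w3 where "m0 = P3.copy True (Aff 1 0)"
definition m1 :: w3 where "m1 = P3.copy True (Aff 0 1)"
definition m2 :: w3 where "m2 = P3.copy False (Aff 0 1)"

lemma m1_alt: "m1 = P3.copy False (Aff 1 0)"
  using P3.copy_C[of "(Aff 0 1, Aff 1 0)"] by (auto simp: m1_def C3_def intro: gen.base)

lemma zmul_m: "zmul k m0 = P3.copy True (Aff k 0)" "zmul k m1 = P3.copy True (Aff 0 (of_int k))"
  "zmul k m1 = P3.copy False (Aff k 0)" "zmul k m2 = P3.copy False (Aff 0 (of_int k))"
proof -
  have *: "zmul k (P3.copy b x) = P3.copy b (zmul k x)" for b x
    by (rule additive_zmul[symmetric]) (rule P3.copy_add)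
  show "zmul k m0 = P3.copy True (Aff k 0)" "zmul k m2 = P3.copy False (Aff 0 (of_int k))"
    "zmul k m1 = P3.copy True (Aff 0 (of_int k))"
    by (simp_all add: m0_def m1_def m2_def * zmul_aff)
  show "zmul k m1 = P3.copy False (Aff k 0)"
    by (simp add: m1_alt * zmul_aff)
qed

lemma m_rel: "m0 + m1 - m0 = m1 + m1" "m1 + m2 - m1 = m2 + m2"
proof -
  have b: "P3.copy b (x + y) = P3.copy b x + P3.copy b y" "P3.copy b (- x) = - P3.copy b x" for b x y
    using P3.copy_add additive_uminus[of "P3.copy b" x] by blast+
  have aff: "Aff 1 0 + Aff 0 1 + - Aff 1 0 = Aff 0 1 + Aff 0 1" by simp
  show "m0 + m1 - m0 = m1 + m1"
    using arg_cong[OF aff, of "P3.copy True"] unfolding b m0_def m1_def by simp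
  show "m1 + m2 - m1 = m2 + m2"
    using arg_cong[OF aff, of "P3.copy False"] unfolding b m2_def m1_alt by simp
qed

definition C4 :: "(w3 \<times> w3) set" where "C4 = gen {(m0, m2), (m2, m0)}"

text \<open>Nonzero multiples of \<open>m0\<close> and \<open>m2\<close> lie in different copies and
  outside the amalgamated subgroup, so an alternating word in the two generating pairs has a nonzero
  first coordinate. Hence exchanging \<open>m0\<close> and \<open>m2\<close> is well defined on the
  group they generate.\<close>

lemma C4_fst_0:
  assumes "(0, y) \<in> C4"
  shows "y = 0"
proof -
  define M where "M b = gen {if b then (m0, m2) else (m2, m0)}" for b
  have "(0, y) \<in> gen (M True \<union> M False)"
    using assms unfolding M_def gen_gen_Un C4_def by (simp add: insert_commute)
  then show ?thesis
  proof (rule gen_red_cases[rotated])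
    show "subgrp (M b)" for b by (simp add: M_def)
    assume "(0, y) \<in> M True"
    then obtain k where k: "(0, y) = zmul k (m0, m2)" by (auto simp: M_def gen_singleton)
    from arg_cong[OF k, of fst] have "P3.copy True (Aff k 0) = 0" by (simp add: zmul_m)
    then have "k = 0" using P3.copy_eq_0 by (fastforce simp: zero_aff_def)
    then show "y = 0" using arg_cong[OF k, of snd] by simp
  next
    fix b xs assume xs: "xs \<noteq> []" "red M b xs" "(0, y) = sum_list xs"
    have "sum_list (map fst xs) \<noteq> 0"
    proof (rule P3.copy_word_ne_0'[OF xs(2,1)])
      fix b x assume x: "x \<in> M b" "x \<notin> M (\<not> b)"
      obtain k where k: "x = zmul k (if b then (m0, m2) else (m2, m0))"
        using x(1) by (auto simp: M_def gen_singleton)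
      have "k \<noteq> 0" using x(2) k by (auto simp: M_def gen.zero)
      then show "\<exists>y. fst x = P3.copy b y \<and> y \<notin> P3.pr b ` C3"
        unfolding k by (intro exI[of _ "if b then Aff k 0 else Aff 0 (of_int k)"])
          (cases b; auto simp: zmul_m C3_iff)
    qed
    moreover have "sum_list (map fst xs) = fst (sum_list xs)"
      by (rule additive_sum_list[symmetric]) simp
    ultimately have False using xs(3) by (metis fst_conv)
    then show "y = 0" ..
  qed
qed

interpretation P4: pushout C4
proof
  show "subgrp C4" by (simp add: C4_def)
  have "prod.swap ` C4 = C4"
    unfolding C4_def by (subst gen_image) (auto simp: prod.swap_def insert_commute intro: prod_eqI)
  then show "x = 0" if "(x, 0) \<in> C4" for x using that C4_fst_0 by (metis imageI swap_simp)
qed (rule C4_fst_0)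

subsection \<open>The Higman group as a type\<close>

typedef hig = "carrier higman_group"
  using higman_gen_closed by blast

interpretation H: group higman_group by (rule group_higman_group)

setup_lifting type_definition_hig

instantiation hig :: group_add
begin

lift_definition zero_hig :: hig is "\<one>\<^bsub>higman_group\<^esub>" by (rule H.one_closed)
lift_definition plus_hig :: "hig \<Rightarrow> hig \<Rightarrow> hig" is "(\<otimes>\<^bsub>higman_group\<^esub>)" by (rule H.m_closed)
lift_definition uminus_hig :: "hig \<Rightarrow> hig" is "m_inv higman_group" by (rule H.inv_closed)
definition minus_hig :: "hig \<Rightarrow> hig \<Rightarrow> hig" where "minus_hig x y = x + - y"

instance
proof
  fix x y z :: hig
  show "x + y + z = x + (y + z)" by transfer (rule H.m_assoc)
  show "0 + x = x" "x + 0 = x" by (transfer, simp)+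
  show "- x + x = 0" by transfer simp
  show "x + - y = x - y" by (simp add: minus_hig_def)
qed

end

lift_definition ha :: "4 \<Rightarrow> hig" is higman_gen by (rule higman_gen_closed)

lift_definition hword :: "4 group_word \<Rightarrow> hig" is "pres_class higman_relations"
  by (simp add: higman_group_def carrier_presented_group)

lemma hword_append: "hword (u @ v) = hword u + hword v"
  by transfer (simp add: higman_group_def mult_presented_group)

lemma hword_single: "hword [(i, b)] = (if b then ha i else - ha i)"
proof -
  have "hword [(i, True)] = ha i" "hword [(i, False)] = - ha i"
    by (transfer, simp add: higman_gen_def) (transfer, simp add: inv_higman_gen)
  then show ?thesis by simp
qed

lemma hword_Nil: "hword [] = 0"
  by transfer (simp add: higman_group_def one_presented_group)

lemma hword_cases: obtains w where "x = hword w"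
  by transfer (auto simp: higman_group_def carrier_presented_group)

lemma ha_rel: "ha i + ha (i + 1) - ha i = ha (i + 1) + ha (i + 1)"
proof -
  have "ha i + ha (i + 1) + - ha i = ha (i + 1) + ha (i + 1)"
  proof transfer
    fix i
    show "higman_gen i \<otimes>\<^bsub>higman_group\<^esub> higman_gen (i + 1) \<otimes>\<^bsub>higman_group\<^esub> inv\<^bsub>higman_group\<^esub> higman_gen i =
        higman_gen (i + 1) \<otimes>\<^bsub>higman_group\<^esub> higman_gen (i + 1)"
      using higman_relation[of i] by (simp add: numeral_2_eq_2 higman_gen_closed)
  qed
  then show ?thesis by simp
qed

lemma gen_ha: "gen (range ha) = UNIV"
proof -
  have "hword w \<in> gen (range ha)" for w
  proof (induction w)
    case (Cons p w)
    have "hword (p # w) = hword [p] + hword w" using hword_append[of "[p]" w] by simp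
    moreover have "hword [p] \<in> gen (range ha)"
      by (cases p) (auto simp: hword_single intro: gen.intros)
    ultimately show ?case using Cons by (simp add: gen.add)
  qed (simp add: hword_Nil gen.zero)
  then show ?thesis by (metis UNIV_eq_I hword_cases)
qed

lemma hig_hom:
  fixes f :: "4 \<Rightarrow> 'b::group_add"
  assumes f: "\<And>i. f i + f (i + 1) - f i = f (i + 1) + f (i + 1)"
  obtains \<Phi> :: "hig \<Rightarrow> 'b" where "\<And>x y. \<Phi> (x + y) = \<Phi> x + \<Phi> y" "\<And>i. \<Phi> (ha i) = f i"
proof -
  define ev where "ev w = sum_list (map (\<lambda>(i, b). if b then f i else - f i) w)" for w
  have "ev u = ev v" if "pres_eq higman_relations u v" for u v
    using that
  proof induction
    case (relation u v)
    then show ?case using f by (auto simp: higman_relations_def ev_def add_diff_eq)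
  qed (auto simp: ev_def)
  then have *: "ev u = ev v" if "hword u = hword v" for u v
    using that by (metis hword.rep_eq pres_class_eq_iff)
  define \<Phi> where "\<Phi> x = ev (SOME w. x = hword w)" for x
  have \<Phi>: "\<Phi> (hword w) = ev w" for w
  proof -
    have "hword w = hword (SOME w'. hword w = hword w')" by (rule someI) simp
    then show ?thesis using * unfolding \<Phi>_def by metis
  qed
  show thesis
  proof
    show "\<Phi> (x + y) = \<Phi> x + \<Phi> y" for x y
      by (rule hword_cases[of x], rule hword_cases[of y]) (simp add: \<Phi> ev_def flip: hword_append)
    show "\<Phi> (ha i) = f i" for i
      using \<Phi>[of "[(i, True)]"] by (simp add: hword_single ev_def)
  qed
qed

lemma four_cases:
  fixes i j :: 4
  obtains "j = i" | "j = i + 1" | "j = i + 2" | "j = i + 3"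
proof -
  obtain z where z: "j - i = of_int z" "0 \<le> z" "z < 4" by (cases "j - i" rule: bit0_cases) auto
  then have "z = 0 \<or> z = 1 \<or> z = 2 \<or> z = 3" by linarith
  then have "j = i \<or> j = i + 1 \<or> j = i + 2 \<or> j = i + 3"
    using z(1) by (auto simp: algebra_simps)
  then show thesis using that by blast
qed

lemma four_plus: "(i::4) + 2 + 2 = i" "i + 1 + 1 = i + 2" "i + 1 + 2 = i + 3" "i + 2 + 1 = i + 3"
  "i + 3 + 1 = i" "i + 3 + 2 = i + 1" "i + 2 + 3 = i + 1" "i + 1 + 3 = i" "i + 3 + 3 = i + 2"
  by (simp_all add: add.assoc)

subsection \<open>Comparison with the models\<close>

text \<open>Meant as graphs of isomorphisms from \<open>Bs i\<close> and \<open>As i\<close> to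
  subgroups of the models, written down before any such map is known to be well defined. That each
  coordinate determines the other is shown by \<open>G2_snd_0\<close>, \<open>G3_snd_0\<close> and,
  through the action of the whole group, by \<open>G3_fst_0\<close>,
  \<open>G2_fst_0\<close>.\<close>

definition G2 :: "4 \<Rightarrow> (hig \<times> aff) set" where "G2 i = gen {(ha i, Aff 1 0), (ha (i + 1), Aff 0 1)}"
definition G3 :: "4 \<Rightarrow> (hig \<times> w3) set" where "G3 i = gen {(ha i, m0), (ha (i + 1), m1), (ha (i + 2), m2)}"

definition Zs :: "4 \<Rightarrow> hig set" where "Zs i = gen {ha i}"
definition Bs :: "4 \<Rightarrow> hig set" where "Bs i = gen {ha i, ha (i + 1)}"
definition Fs :: "4 \<Rightarrow> hig set" where "Fs i = gen {ha i, ha (i + 2)}"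
definition As :: "4 \<Rightarrow> hig set" where "As i = gen {ha i, ha (i + 1), ha (i + 2)}"

lemma subgrp_G: "subgrp (G2 i)" "subgrp (G3 i)" "subgrp (Zs i)" "subgrp (Bs i)" "subgrp (Fs i)" "subgrp (As i)"
  by (simp_all add: G2_def G3_def Zs_def Bs_def Fs_def As_def)

lemma fst_G: "fst ` G2 i = Bs i" "fst ` G3 i = As i"
  unfolding G2_def G3_def Bs_def As_def by (subst gen_image; simp)+

lemma Zs_iff: "x \<in> Zs i \<longleftrightarrow> (\<exists>k. x = zmul k (ha i))"
  by (auto simp: Zs_def gen_singleton)

lemma G2_zmul: "(zmul k (ha i), Aff k 0) \<in> G2 i" "(zmul k (ha (i + 1)), Aff 0 (of_int k)) \<in> G2 i"
proof -
  have "zmul k (ha i, Aff 1 0) \<in> G2 i" "zmul k (ha (i + 1), Aff 0 1) \<in> G2 i"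
    unfolding G2_def by (rule subgrpD(5)[OF subgrp_gen], rule gen.base, simp)+
  moreover have "zmul k (ha i, Aff 1 0) = (zmul k (ha i), Aff k 0)"
    "zmul k (ha (i + 1), Aff 0 1) = (zmul k (ha (i + 1)), Aff 0 (of_int k))"
    by (rule prod_eqI; simp add: zmul_aff)+
  ultimately show "(zmul k (ha i), Aff k 0) \<in> G2 i" "(zmul k (ha (i + 1)), Aff 0 (of_int k)) \<in> G2 i"
    by simp_all
qed

section \<open>Normal forms in the Baumslag-Solitar groups\<close>

lemma zmul_zmul: "zmul m (zmul n x) = zmul (m * n) x"
proof (induction m rule: int_induct[where k = 0])
  case (step1 i)
  have "(i + 1) * n = n + i * n" by (simp add: algebra_simps)
  then have "zmul ((i + 1) * n) x = zmul n x + zmul (i * n) x" by (simp only: zmul_add)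
  then show ?case using step1 zmul_succ[of i "zmul n x"] by simp
next
  case (step2 i)
  have "(i - 1) * n = - n + i * n" by (simp add: algebra_simps)
  then have "zmul ((i - 1) * n) x = - zmul n x + zmul (i * n) x" by (simp only: zmul_add zmul_neg)
  then show ?case using step2 zmul_pred[of i "zmul n x"] by simp
qed simp

lemma commutation:
  fixes t b :: "'a::group_add"
  assumes "t + b - t = b + b"
  shows "zmul (int k) t + zmul m b = zmul (2 ^ k * m) b + zmul (int k) t"
proof -
  have conj: "t + zmul m b - t = zmul m (t + b - t)" for m
    by (rule additive_zmul) (simp add: grp_simps del: add_uminus_conv_diff)
  have "b + b = zmul 2 b" using zmul_add[of 1 1 b] by simp
  then have one: "t + zmul m b = zmul (2 * m) b + t" for m
    using conj[of m] unfolding assms by (simp add: zmul_zmul mult.commute diff_eq_eq)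
  show ?thesis
  proof (induction k)
    case (Suc k)
    have "zmul (int (Suc k)) t + zmul m b = t + (zmul (int k) t + zmul m b)"
      using zmul_succ[of "int k" t] by (simp add: add.assoc add.commute)
    also have "\<dots> = (t + zmul (2 ^ k * m) b) + zmul (int k) t" unfolding Suc by (simp add: add.assoc)
    also have "\<dots> = zmul (2 ^ Suc k * m) b + (t + zmul (int k) t)"
      unfolding one by (simp add: add.assoc mult.assoc)
    finally show ?case using zmul_succ[of "int k" t] by (simp add: add.commute)
  qed simp
qed

text \<open>Follows from the relation t + b - t = b + b alone, which holds in both coordinates:
  moving a multiple of b to the right across - t doubles it, so the negative multiples of t collect
  on the left.\<close>

lemma G2_normal_form:
  assumes "p \<in> G2 i"
  obtains k m l where "p = - zmul (int k) (ha i, Aff 1 0) + zmul m (ha (i + 1), Aff 0 1) + zmul l (ha i, Aff 1 0)"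
proof -
  define t b where "t = (ha i, Aff 1 0)" and "b = (ha (i + 1), Aff 0 1)"
  have rel: "t + b - t = b + b"
    by (rule prod_eqI) (simp_all add: t_def b_def ha_rel diff_aff)
  define P where "P p \<longleftrightarrow> (\<exists>k m l. p = - zmul (int k) t + zmul m b + zmul l t)" for p
  have t: "P (t + p)" if Pp: "P p" for p
  proof -
    obtain k m l where p: "p = - zmul (int k) t + zmul m b + zmul l t" using Pp P_def by blast
    show ?thesis
    proof (cases k)
      case 0
      have "t + zmul m b = zmul (2 * m) b + t" using commutation[OF rel, of 1 m] by simp
      then have "t + p = - zmul (int 0) t + zmul (2 * m) b + zmul (l + 1) t"
        unfolding p 0 zmul_succ by (simp flip: add.assoc)
      then show ?thesis unfolding P_def by blast
    next
      case (Suc j)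
      have "- zmul (int k) t = - t + - zmul (int j) t"
      proof -
        have "zmul (int k) t = zmul (int j) t + t" using Suc zmul_add[of "int j" 1 t] by (simp add: add.commute)
        then show ?thesis by (simp add: minus_add del: add_uminus_conv_diff)
      qed
      then have "t + p = - zmul (int j) t + zmul m b + zmul l t"
        unfolding p by (simp add: add.assoc del: add_uminus_conv_diff)
      then show ?thesis unfolding P_def by blast
    qed
  qed
  have mt: "P (- t + p)" if Pp: "P p" for p
  proof -
    obtain k m l where p: "p = - zmul (int k) t + zmul m b + zmul l t" using Pp P_def by blast
    have "zmul (int (Suc k)) t = zmul (int k) t + t" using zmul_add[of "int k" 1 t] by (simp add: add.commute)
    then have "- t + p = - zmul (int (Suc k)) t + zmul m b + zmul l t"
      unfolding p by (simp add: minus_add add.assoc del: add_uminus_conv_diff)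
    then show ?thesis unfolding P_def by blast
  qed
  have b: "P (zmul n b + p)" if Pp: "P p" for p n
  proof -
    obtain k m l where p: "p = - zmul (int k) t + zmul m b + zmul l t" using Pp P_def by blast
    have "zmul n b = - zmul (int k) t + zmul (2 ^ k * n) b + zmul (int k) t"
      using commutation[OF rel, of k n] by (metis add.assoc minus_add_cancel)
    then have "zmul n b + p = - zmul (int k) t + zmul (2 ^ k * n + m) b + zmul l t"
      unfolding p zmul_add by (simp add: add.assoc del: add_uminus_conv_diff)
    then show ?thesis unfolding P_def by blast
  qed
  have "P p"
    using assms unfolding G2_def
  proof (induction rule: gen_induct_left)
    case zero
    have "0 = - zmul (int 0) t + zmul 0 b + zmul 0 t" by simp
    then show ?case unfolding P_def by blast
  next
    case (plus s p)
    then show ?case using t[of p] b[of p 1] by (auto simp: t_def b_def)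
  next
    case (minus s p)
    then show ?case using mt[of p] b[of p "-1"] by (auto simp: t_def b_def)
  qed
  then show thesis using that unfolding P_def t_def b_def by blast
qed

lemma G2_snd_0:
  assumes "(x, 0) \<in> G2 i"
  shows "x = 0"
proof -
  obtain k m l where
    p: "(x, 0) = - zmul (int k) (ha i, Aff 1 0) + zmul m (ha (i + 1), Aff 0 1) + zmul l (ha i, Aff 1 0)"
    using G2_normal_form[OF assms] by blast
  have "0 = - zmul (int k) (Aff 1 0) + zmul m (Aff 0 1) + zmul l (Aff 1 0)"
    using arg_cong[OF p, of snd] by (simp del: add_uminus_conv_diff)
  then have "l = int k" "m = 0" by (auto simp: zmul_aff zero_aff_def)
  then show ?thesis using arg_cong[OF p, of fst] by simp
qed

lemma G2_dyadic:
  assumes "(x, Aff k q) \<in> G2 i"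
  shows "\<exists>N m. q * 2 ^ N = of_int m"
proof -
  obtain n m l where
    p: "(x, Aff k q) = - zmul (int n) (ha i, Aff 1 0) + zmul m (ha (i + 1), Aff 0 1) + zmul l (ha i, Aff 1 0)"
    using G2_normal_form[OF assms] by blast
  have "Aff k q = - zmul (int n) (Aff 1 0) + zmul m (Aff 0 1) + zmul l (Aff 1 0)"
    using arg_cong[OF p, of snd] by (simp del: add_uminus_conv_diff)
  then have "q * 2 ^ n = of_int m" by (simp add: zmul_aff power_int_minus field_simps)
  then show ?thesis by blast
qed

section \<open>Comparison of \<open>As i\<close> with the amalgam over \<open>C3\<close>\<close>

lemma additive_map_snd:
  assumes "\<And>x y. f (x + y) = f x + (f y :: 'b::group_add)"
  shows "map_prod id f (p + q) = map_prod id f p + map_prod id f (q :: 'c::group_add \<times> 'a::group_add)"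
  by (rule prod_eqI) (simp_all add: fst_map_prod snd_map_prod assms)

lemma G2_in_G3: "map_prod id (P3.copy True) ` G2 i = gen {(ha i, m0), (ha (i + 1), m1)}"
  "map_prod id (P3.copy False) ` G2 i = gen {(ha i, m1), (ha (i + 1), m2)}"
  unfolding G2_def
  by (subst gen_image[OF additive_map_snd[OF P3.copy_add]]; simp add: m0_def m1_def m2_def flip: m1_alt)+

definition GM :: "4 \<Rightarrow> bool \<Rightarrow> (hig \<times> w3) set"
  where "GM i b = map_prod id (P3.copy b) ` G2 (if b then i else i + 1)"

lemma GM_alt: "GM i True = gen {(ha i, m0), (ha (i + 1), m1)}"
  "GM i False = gen {(ha (i + 1), m1), (ha (i + 2), m2)}"
  by (simp_all add: GM_def G2_in_G3 add.assoc)

lemma gen_GM: "gen (GM i True \<union> GM i False) = G3 i"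
  unfolding GM_alt gen_gen_Un G3_def by (simp add: insert_commute Un_commute)

lemma GM_subset: "GM i b \<subseteq> G3 i"
  unfolding gen_GM[symmetric] by (cases b) (auto intro: gen.base)

lemma GM_copy:
  assumes "(x, y) \<in> G2 (if b then i else i + 1)"
  shows "(x, P3.copy b y) \<in> GM i b"
  using assms unfolding GM_def by (intro image_eqI[of _ _ "(x, y)"]) auto

lemma G2_unique:
  assumes "(x, y) \<in> G2 i" "(x', y) \<in> G2 i"
  shows "x = x'"
proof -
  have "(x, y) - (x', y) \<in> G2 i" using assms subgrpD(4)[OF subgrp_G(1)] by blast
  then show ?thesis using G2_snd_0[of "x - x'" i] by (simp add: minus_prod_def)
qed

lemma G2_in_C3:
  assumes "(x, y) \<in> G2 (if b then i else i + 1)" "y \<in> P3.pr b ` C3"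
  shows "\<exists>k. x = zmul k (ha (i + 1)) \<and> (x, P3.copy b y) \<in> GM i (\<not> b)"
proof -
  obtain k where k: "y = (if b then Aff 0 (of_int k) else Aff k 0)"
    using assms(2) by (cases b) (auto simp: C3_iff)
  have "(zmul k (ha (i + 1)), y) \<in> G2 (if b then i else i + 1)"
    using G2_zmul[of k] k by simp
  then have x: "x = zmul k (ha (i + 1))" using G2_unique assms(1) by blast
  have "P3.copy b y = P3.copy (\<not> b) (if b then Aff k 0 else Aff 0 (of_int k))"
    using P3.copy_C[of "(Aff 0 (of_int k), Aff k 0)"] k by (cases b) (auto simp: C3_iff)
  moreover have "(x, if b then Aff k 0 else Aff 0 (of_int k)) \<in> G2 (if \<not> b then i else i + 1)"
    using G2_zmul[of k] x by simp
  ultimately show ?thesis using GM_copy[of x _ "\<not> b" i] x by fastforce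
qed

text \<open>A letter whose model coordinate lies in the amalgamated subgroup is a multiple of
  \<open>ha (i + 1)\<close> and belongs to both \<open>GM i True\<close> and
  \<open>GM i False\<close>. So reduced words stay reduced in the model.\<close>

lemma G3_snd_0:
  assumes "(x, 0) \<in> G3 i"
  shows "x = 0"
proof -
  have "(x, 0) \<in> gen (GM i True \<union> GM i False)" using assms gen_GM by simp
  then show ?thesis
  proof (rule gen_red_cases[rotated])
    show "subgrp (GM i b)" for b by (cases b) (simp_all add: GM_alt)
    assume "(x, 0) \<in> GM i True"
    then obtain y where y: "(x, y) \<in> G2 i" "P3.copy True y = 0" by (auto simp: GM_def)
    then show "x = 0" using P3.copy_eq_0 G2_snd_0 by metis
  next
    fix b xs assume xs: "xs \<noteq> []" "red (GM i) b xs" "(x, 0) = sum_list xs"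
    have "sum_list (map snd xs) \<noteq> 0"
    proof (rule P3.copy_word_ne_0'[OF xs(2,1)])
      fix b p assume p: "p \<in> GM i b" "p \<notin> GM i (\<not> b)"
      then obtain x y where xy: "p = (x, P3.copy b y)" "(x, y) \<in> G2 (if b then i else i + 1)"
        by (auto simp: GM_def)
      then show "\<exists>y. snd p = P3.copy b y \<and> y \<notin> P3.pr b ` C3" using G2_in_C3[OF xy(2)] p(2) by auto
    qed
    moreover have "sum_list (map snd xs) = snd (sum_list xs)"
      by (rule additive_sum_list[symmetric]) simp
    ultimately have False using xs(3) by (metis snd_conv)
    then show "x = 0" ..
  qed
qed

lemma G3_unique:
  assumes "(x, y) \<in> G3 i" "(x', y) \<in> G3 i"
  shows "x = x'"
proof -
  have "(x, y) - (x', y) \<in> G3 i" using assms subgrpD(4)[OF subgrp_G(2)] by blast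
  then show ?thesis using G3_snd_0[of "x - x'" i] by (simp add: minus_prod_def)
qed

text \<open>One copy of the model receives \<open>ha i\<close>, \<open>ha (i + 1)\<close>,
  \<open>ha (i + 2)\<close> and the other \<open>ha (i + 2)\<close>, \<open>ha (i + 3)\<close>,
  \<open>ha i\<close>, each as \<open>m0\<close>, \<open>m1\<close>, \<open>m2\<close>; the exchange
  in \<open>C4\<close> makes the two assignments agree on \<open>ha i\<close> and
  \<open>ha (i + 2)\<close>. Each of the four relations then holds inside one copy.\<close>

lemma higman_action:
  obtains \<Phi> where "\<And>x y. \<Phi> (x + y) = \<Phi> x + \<Phi> y"
    "\<And>x y. (x, y) \<in> G3 i \<Longrightarrow> \<Phi> x = P4.copy True y"
    "\<And>x y. (x, y) \<in> G3 (i + 2) \<Longrightarrow> \<Phi> x = P4.copy False y"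
proof -
  let ?q = "P4.copy"
  have c: "?q True m0 = ?q False m2" "?q True m2 = ?q False m0"
    using P4.copy_C[of "(m0, m2)"] P4.copy_C[of "(m2, m0)"] by (auto simp: C4_def intro: gen.base)
  define f where "f j = (if j = i then ?q True m0 else if j = i + 1 then ?q True m1
    else if j = i + 2 then ?q True m2 else ?q False m1)" for j
  have f: "f i = ?q True m0" "f (i + 1) = ?q True m1" "f (i + 2) = ?q True m2" "f (i + 3) = ?q False m1"
    by (simp_all add: f_def)
  have q: "?q b (x + y) = ?q b x + ?q b y" "?q b (- x) = - ?q b x" for b x y
    using P4.copy_add additive_uminus[of "?q b" x] by blast+
  have qrel: "?q b m0 + ?q b m1 - ?q b m0 = ?q b m1 + ?q b m1"
    "?q b m1 + ?q b m2 - ?q b m1 = ?q b m2 + ?q b m2" for b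
  proof -
    have "m0 + m1 + - m0 = m1 + m1" "m1 + m2 + - m1 = m2 + m2" using m_rel by simp_all
    from this[THEN arg_cong, of "?q b"] show "?q b m0 + ?q b m1 - ?q b m0 = ?q b m1 + ?q b m1"
      "?q b m1 + ?q b m2 - ?q b m1 = ?q b m2 + ?q b m2"
      unfolding q by simp_all
  qed
  have "f j + f (j + 1) - f j = f (j + 1) + f (j + 1)" for j
    by (rule four_cases[of j i])
      (use qrel[of True] qrel[of False] c in \<open>simp_all add: four_plus f\<close>)
  then obtain \<Phi> where \<Phi>: "\<And>x y. \<Phi> (x + y) = \<Phi> x + \<Phi> y" "\<And>j. \<Phi> (ha j) = f j"
    using hig_hom[of f] by blast
  have ext: "\<Phi> x = ?q b y"
    if "(x, y) \<in> G3 j" and j: "\<Phi> (ha j) = ?q b m0" "\<Phi> (ha (j + 1)) = ?q b m1" "\<Phi> (ha (j + 2)) = ?q b m2" for x y j b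
  proof -
    define E where "E = {p. \<Phi> (fst p) = ?q b (snd p)}"
    have "subgrp E"
      unfolding subgrp_def E_def
      using additive_zero[of \<Phi>, OF \<Phi>(1)] additive_zero[of "?q b", OF q(1)] additive_uminus[of \<Phi>, OF \<Phi>(1)]
      by (simp add: \<Phi>(1) q)
    then have "G3 j \<subseteq> E" unfolding G3_def by (rule gen_minimal) (simp add: E_def j)
    then show ?thesis using that(1) by (auto simp: E_def)
  qed
  show thesis
  proof
    show "\<Phi> x = ?q True y" if "(x, y) \<in> G3 i" for x y
      by (rule ext[OF that]) (simp_all add: \<Phi>(2) f)
    show "\<Phi> x = ?q False y" if "(x, y) \<in> G3 (i + 2)" for x y
      by (rule ext[OF that]) (simp_all add: \<Phi>(2) f four_plus c)
  qed (rule \<Phi>(1))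
qed

lemma G3_fst_0:
  assumes "(0, y) \<in> G3 i"
  shows "y = 0"
proof -
  obtain \<Phi> where \<Phi>: "\<And>x y. \<Phi> (x + y) = \<Phi> x + \<Phi> y"
    "\<And>x y. (x, y) \<in> G3 i \<Longrightarrow> \<Phi> x = P4.copy True y"
    "\<And>x y. (x, y) \<in> G3 (i + 2) \<Longrightarrow> \<Phi> x = P4.copy False y"
    by (rule higman_action[of i]) blast
  have "P4.copy True y = 0" using \<Phi>(2)[OF assms] additive_zero[of \<Phi>, OF \<Phi>(1)] by simp
  then show ?thesis by (rule P4.copy_eq_0)
qed

lemma G2_fst_0:
  assumes "(0, y) \<in> G2 i"
  shows "y = 0"
  using assms GM_copy[of 0 y True i] GM_subset G3_fst_0 P3.copy_eq_0 by (metis subsetD)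

lemma functional_unique:
  assumes "subgrp G" "\<And>y. (0, y) \<in> G \<Longrightarrow> y = 0" "(x, y) \<in> G" "(x, y') \<in> (G :: ('a::group_add \<times> 'b::group_add) set)"
  shows "y = y'"
proof -
  have "(x, y) - (x, y') \<in> G" using assms subgrpD(4) by blast
  then show ?thesis using assms(2)[of "y - y'"] by (simp add: minus_prod_def)
qed

lemma G2_functional: "(x, y) \<in> G2 i \<Longrightarrow> (x, y') \<in> G2 i \<Longrightarrow> y = y'"
  by (rule functional_unique[of "G2 i"]) (auto intro: subgrp_G G2_fst_0)

lemma G3_functional: "(x, y) \<in> G3 i \<Longrightarrow> (x, y') \<in> G3 i \<Longrightarrow> y = y'"
  by (rule functional_unique[of "G3 i"]) (auto intro: subgrp_G G3_fst_0)

lemma graph_sum_list: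
  assumes "subgrp G" "\<And>x. x \<in> set xs \<Longrightarrow> (x, f x) \<in> G"
  shows "(sum_list xs, sum_list (map f xs)) \<in> G"
  using assms(2)
proof (induction xs)
  case Nil
  then show ?case using subgrpD(1)[OF assms(1)] by (simp add: zero_prod_def)
next
  case (Cons x xs)
  then have "(x, f x) + (sum_list xs, sum_list (map f xs)) \<in> G"
    by (intro subgrpD(2)[OF assms(1)]) simp_all
  then show ?case by (simp add: plus_prod_def)
qed

subsection \<open>The two levels of amalgams\<close>

text \<open>The factors of two amalgams: of \<open>As i\<close> along \<open>Zs (i + 1)\<close>, and
  of the Higman group along \<open>Fs i\<close>. As \<open>AA (i + 2)\<close> is \<open>AA i\<close>
  with the sides exchanged, even and odd indices give one tree each.\<close>

definition BB :: "4 \<Rightarrow> bool \<Rightarrow> hig set" where "BB i b = Bs (if b then i else i + 1)"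
definition AA :: "4 \<Rightarrow> bool \<Rightarrow> hig set" where "AA i b = As (if b then i else i + 2)"

lemma red_set: "red M b xs \<Longrightarrow> x \<in> set xs \<Longrightarrow> \<exists>b. x \<in> M b"
  by (induction xs arbitrary: b) auto

lemma Bs_graph: "x \<in> Bs i \<Longrightarrow> \<exists>y. (x, y) \<in> G2 i"
  using fst_G(1)[of i] by fastforce

lemma As_graph: "x \<in> As i \<Longrightarrow> \<exists>y. (x, y) \<in> G3 i"
  using fst_G(2)[of i] by fastforce

lemma graph_Bs: "(x, y) \<in> G2 i \<Longrightarrow> x \<in> Bs i"
  using fst_G(1)[of i] by force

lemma Zs_subset: "Zs i \<subseteq> Bs i" "Zs (i + 1) \<subseteq> Bs i" "Zs i \<subseteq> Fs i" "Zs (i + 2) \<subseteq> Fs i"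
  unfolding Zs_def Bs_def Fs_def by (rule gen_mono, simp)+

lemma Bs_subset: "Bs i \<subseteq> As i" "Bs (i + 1) \<subseteq> As i" "Fs i \<subseteq> As i" "Fs i \<subseteq> As (i + 2)"
  unfolding Bs_def As_def Fs_def by (rule gen_mono, simp add: four_plus)+

lemma Fs_plus2: "Fs (i + 2) = Fs i"
  by (simp add: Fs_def four_plus insert_commute)

lemma gen_BB: "gen (BB i True \<union> BB i False) = As i"
  by (simp add: BB_def Bs_def As_def gen_gen_Un four_plus insert_commute)

lemma BB_Int: "Bs i \<inter> Bs (i + 1) = Zs (i + 1)"
proof
  show "Zs (i + 1) \<subseteq> Bs i \<inter> Bs (i + 1)" using Zs_subset by blast
  show "Bs i \<inter> Bs (i + 1) \<subseteq> Zs (i + 1)"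
  proof
    fix x assume "x \<in> Bs i \<inter> Bs (i + 1)"
    then obtain y y' where y: "(x, y) \<in> G2 i" "(x, y') \<in> G2 (i + 1)" using Bs_graph by blast
    have "(x, P3.copy True y) \<in> G3 i" "(x, P3.copy False y') \<in> G3 i"
      using GM_copy[of x y True i] GM_copy[of x y' False i] y GM_subset by auto
    then have "P3.copy True y = P3.copy False y'" by (rule G3_functional)
    then have "(y, y') \<in> C3" by (rule P3.copy_Int)
    then have "y \<in> P3.pr True ` C3" by force
    then show "x \<in> Zs (i + 1)" using G2_in_C3[of x y True i] y(1) by (auto simp: Zs_iff)
  qed
qed

text \<open>A letter in only one factor has a model coordinate outside the amalgamated subgroup, so
  the normal form theorem of the model applies; \<open>G3_fst_0\<close> brings the result
  back.\<close>

lemma amalgam_BB: "amalgam (BB i)"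
proof
  show "subgrp (BB i b)" for b by (simp add: BB_def subgrp_G)
  fix b xs assume xs: "red (BB i) b xs" "xs \<noteq> []"
  define f where "f x = (SOME y. (x, y) \<in> G3 i)" for x
  have f: "f x = y" if "(x, y) \<in> G3 i" for x y
    using that someI[of "\<lambda>y. (x, y) \<in> G3 i" y] G3_functional unfolding f_def by blast
  have fb: "\<exists>y. (x, y) \<in> G2 (if b then i else i + 1) \<and> f x = P3.copy b y" if "x \<in> BB i b" for x b
  proof -
    obtain y where y: "(x, y) \<in> G2 (if b then i else i + 1)" using \<open>x \<in> BB i b\<close> Bs_graph by (auto simp: BB_def)
    then have "(x, P3.copy b y) \<in> G3 i" using GM_copy GM_subset by blast
    then show ?thesis using f y by blast
  qed
  have "sum_list (map f xs) \<noteq> 0"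
  proof (rule P3.copy_word_ne_0'[OF xs])
    fix b x assume x: "x \<in> BB i b" "x \<notin> BB i (\<not> b)"
    obtain y where y: "(x, y) \<in> G2 (if b then i else i + 1)" "f x = P3.copy b y" using fb[OF x(1)] by blast
    have "y \<notin> P3.pr b ` C3"
    proof
      assume "y \<in> P3.pr b ` C3"
      then have "x \<in> Zs (i + 1)" using G2_in_C3[OF y(1)] by (auto simp: Zs_iff)
      then show False using x(2) Zs_subset by (cases b) (auto simp: BB_def)
    qed
    then show "\<exists>y. f x = P3.copy b y \<and> y \<notin> P3.pr b ` C3" using y by blast
  qed
  moreover have "(sum_list xs, sum_list (map f xs)) \<in> G3 i"
  proof (rule graph_sum_list[OF subgrp_G(2)])
    fix x assume "x \<in> set xs"
    then obtain b where "x \<in> BB i b" using red_set[OF xs(1)] by blast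
    then have "x \<in> As i" using Bs_subset(1)[of i] Bs_subset(2)[of i] by (cases b) (auto simp: BB_def)
    then show "(x, f x) \<in> G3 i" using As_graph f by blast
  qed
  ultimately show "sum_list xs \<noteq> 0" using G3_fst_0 by metis
qed

lemma G3_in_C4:
  assumes "(x, y) \<in> G3 (if b then i else i + 2)" "y \<in> P4.pr b ` C4"
  shows "x \<in> Fs i"
proof -
  have pr: "P4.pr b ` C4 = gen {m0, m2}"
    unfolding C4_def by (subst gen_image) (cases b; simp add: insert_commute)+
  let ?j = "if b then i else i + 2"
  have "snd ` gen {(ha ?j, m0), (ha (?j + 2), m2)} = gen {m0, m2}"
    by (subst gen_image) simp_all
  then obtain x' where x': "(x', y) \<in> gen {(ha ?j, m0), (ha (?j + 2), m2)}"
    using assms(2) pr by force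
  have "gen {(ha ?j, m0), (ha (?j + 2), m2)} \<subseteq> G3 ?j" unfolding G3_def by (rule gen_mono) auto
  then have "x = x'" using G3_unique[OF assms(1)] x' by blast
  moreover have "fst ` gen {(ha ?j, m0), (ha (?j + 2), m2)} = Fs ?j"
    unfolding Fs_def by (subst gen_image) simp_all
  then have "x' \<in> Fs ?j" using x' by force
  ultimately show ?thesis using Fs_plus2 by (auto split: if_splits)
qed

lemma gen_AA: "gen (AA i True \<union> AA i False) = UNIV"
proof -
  have "ha j \<in> {ha i, ha (i + 1), ha (i + 2), ha (i + 3)}" for j by (rule four_cases[of j i]) auto
  then have "range ha \<subseteq> {ha i, ha (i + 1), ha (i + 2), ha (i + 3)}" by blast
  then have "gen (range ha) \<subseteq> gen {ha i, ha (i + 1), ha (i + 2), ha (i + 3)}" by (rule gen_mono)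
  also have "\<dots> \<subseteq> gen (AA i True \<union> AA i False)"
    by (intro gen_mono) (auto simp: AA_def As_def four_plus intro: gen.base)
  finally show ?thesis using gen_ha by auto
qed

lemma AA_Int: "As i \<inter> As (i + 2) = Fs i"
proof
  show "Fs i \<subseteq> As i \<inter> As (i + 2)" using Bs_subset by blast
  show "As i \<inter> As (i + 2) \<subseteq> Fs i"
  proof
    fix x assume "x \<in> As i \<inter> As (i + 2)"
    then obtain y y' where y: "(x, y) \<in> G3 i" "(x, y') \<in> G3 (i + 2)" using As_graph by blast
    obtain \<Phi> where \<Phi>: "\<And>x y. \<Phi> (x + y) = \<Phi> x + \<Phi> y"
    "\<And>x y. (x, y) \<in> G3 i \<Longrightarrow> \<Phi> x = P4.copy True y"
    "\<And>x y. (x, y) \<in> G3 (i + 2) \<Longrightarrow> \<Phi> x = P4.copy False y"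
      by (rule higman_action[of i]) blast
    have "P4.copy True y = P4.copy False y'" using \<Phi>(2)[OF y(1)] \<Phi>(3)[OF y(2)] by simp
    then have "(y, y') \<in> C4" by (rule P4.copy_Int)
    then have "y \<in> P4.pr True ` C4" by force
    then show "x \<in> Fs i" using G3_in_C4[of x y True i] y(1) by simp
  qed
qed

lemma amalgam_AA: "amalgam (AA i)"
proof
  show "subgrp (AA i b)" for b by (simp add: AA_def subgrp_G)
  fix b xs assume xs: "red (AA i) b xs" "xs \<noteq> []"
  obtain \<Phi> where \<Phi>: "\<And>x y. \<Phi> (x + y) = \<Phi> x + \<Phi> y"
    "\<And>x y. (x, y) \<in> G3 i \<Longrightarrow> \<Phi> x = P4.copy True y"
    "\<And>x y. (x, y) \<in> G3 (i + 2) \<Longrightarrow> \<Phi> x = P4.copy False y"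
    by (rule higman_action[of i]) blast
  have "sum_list (map \<Phi> xs) \<noteq> 0"
  proof (rule P4.copy_word_ne_0'[OF xs])
    fix b x assume x: "x \<in> AA i b" "x \<notin> AA i (\<not> b)"
    obtain y where y: "(x, y) \<in> G3 (if b then i else i + 2)" using x(1) As_graph by (auto simp: AA_def)
    have "y \<notin> P4.pr b ` C4"
    proof
      assume "y \<in> P4.pr b ` C4"
      then have "x \<in> Fs i" using G3_in_C4[OF y] by blast
      then show False using x(2) Bs_subset(3)[of i] Bs_subset(4)[of i] by (cases b) (auto simp: AA_def)
    qed
    moreover have "\<Phi> x = P4.copy b y" using y \<Phi>(2,3) by (cases b) auto
    ultimately show "\<exists>y. \<Phi> x = P4.copy b y \<and> y \<notin> P4.pr b ` C4" by blast
  qed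
  then show "sum_list xs \<noteq> 0"
    using additive_sum_list[of \<Phi> xs, OF \<Phi>(1)] additive_zero[of \<Phi>, OF \<Phi>(1)] by metis
qed

section \<open>The tree of an amalgam\<close>

text \<open>The point \<open>(g, b)\<close> stands for the coset \<open>g + M b\<close>; the cosets \<open>g + M True\<close> and \<open>g + M False\<close>
  are adjacent.\<close>

definition turn :: "bool \<Rightarrow> nat \<Rightarrow> bool"
  where "turn b n = (if even n then b else \<not> b)"

lemma turn_simps [simp]: "turn b 0 = b" "turn b (Suc n) = turn (\<not> b) n" "turn (\<not> b) n = (\<not> turn b n)"
  "turn (turn b n) m = turn b (n + m)"
  by (auto simp: turn_def)

locale amalgam_tree = amalgam M for M :: "bool \<Rightarrow> 'g::group_add set" +
  assumes gen_M: "gen (M True \<union> M False) = UNIV"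
begin

text \<open>\<open>prods b n\<close> has n + 1 factors: an element w of it gives a path of n edges
  from the coset of 0 on side \<open>b\<close> to the coset of w on side \<open>turn b n\<close>,
  and the last factor does not change that coset.\<close>

fun prods :: "bool \<Rightarrow> nat \<Rightarrow> 'g set" where
  "prods b 0 = M b"
| "prods b (Suc n) = {x + y | x y. x \<in> M b \<and> y \<in> prods (\<not> b) n}"

lemma prods_absorb: "x \<in> M b \<Longrightarrow> w \<in> prods b n \<Longrightarrow> x + w \<in> prods b n"
proof (cases n)
  case (Suc m)
  assume "x \<in> M b" "w \<in> prods b n"
  then obtain y z where "w = y + z" "y \<in> M b" "z \<in> prods (\<not> b) m" using Suc by auto
  then have "x + w = (x + y) + z" "x + y \<in> M b" using \<open>x \<in> M b\<close> M_closed by (simp_all add: add.assoc)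
  then show ?thesis using Suc \<open>z \<in> prods (\<not> b) m\<close> by auto
qed (simp add: M_closed)

lemma prods_Cons: "x \<in> M b \<Longrightarrow> w \<in> prods (\<not> b) n \<Longrightarrow> x + w \<in> prods b (Suc n)"
  by auto

lemma prods_0: "w \<in> prods (\<not> b) n \<Longrightarrow> w \<in> prods b (Suc n)"
  using prods_Cons[of 0 b w n] M_closed by simp

lemma prods_add:
  "w \<in> prods b n \<Longrightarrow> v \<in> prods (turn b n) m \<Longrightarrow> w + v \<in> prods b (n + m)"
proof (induction n arbitrary: b w)
  case 0
  then show ?case using prods_absorb by simp
next
  case (Suc n)
  then obtain x y where "w = x + y" "x \<in> M b" "y \<in> prods (\<not> b) n" by auto
  then show ?case using Suc.IH[of y "\<not> b"] Suc.prems prods_Cons[of x b "y + v"] by (simp add: add.assoc)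
qed

lemma prods_uminus: "w \<in> prods b n \<Longrightarrow> - w \<in> prods (turn b n) n"
proof (induction n arbitrary: b w)
  case 0
  then show ?case using M_closed by simp
next
  case (Suc n)
  then obtain x y where xy: "w = x + y" "x \<in> M b" "y \<in> prods (\<not> b) n" by auto
  have "- y \<in> prods (turn (\<not> b) n) n" using Suc.IH xy by blast
  moreover have "- x \<in> prods (turn (turn (\<not> b) n) n) 1"
    using prods_Cons[of 0 "\<not> b" "- x" 0] xy M_closed by (simp add: turn_def)
  ultimately have "- y + - x \<in> prods (turn (\<not> b) n) (n + 1)" by (rule prods_add)
  then show ?case using xy by (simp add: minus_add del: add_uminus_conv_diff)
qed

lemma prods_exists: "\<exists>n. w \<in> prods b n \<and> turn b n = b'"
proof -
  have "w \<in> gen (M True \<union> M False)" using gen_M by simp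
  then show ?thesis
  proof (induction rule: gen_induct_left)
    case zero
    show ?case
    proof (cases "b' = b")
      case True
      then show ?thesis using M_closed by (intro exI[of _ 0]) simp
    next
      case False
      then show ?thesis using prods_Cons[of 0 b 0 0] M_closed by (intro exI[of _ 1]) auto
    qed
  next
    case (plus s w)
    then obtain n where n: "w \<in> prods b n" "turn b n = b'" by blast
    show ?case
    proof (cases "s \<in> M b")
      case True
      then show ?thesis using n prods_absorb by blast
    next
      case False
      then have "s \<in> M (\<not> b)" using plus by (cases b) auto
      then have "s + w \<in> prods b (Suc (Suc n))" using n by (intro prods_0 prods_Cons) simp_all
      then show ?thesis using n by (intro exI[of _ "Suc (Suc n)"]) simp
    qed
  next
    case (minus s w)
    then obtain n where n: "w \<in> prods b n" "turn b n = b'" by blast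
    show ?case
    proof (cases "s \<in> M b")
      case True
      then show ?thesis using n prods_absorb M_closed by blast
    next
      case False
      then have "- s \<in> M (\<not> b)" using minus M_closed by (cases b) auto
      then have "- s + w \<in> prods b (Suc (Suc n))" using n by (intro prods_0 prods_Cons) simp_all
      then show ?thesis using n by (intro exI[of _ "Suc (Suc n)"]) simp
    qed
  qed
qed

definition len :: "bool \<Rightarrow> bool \<Rightarrow> 'g \<Rightarrow> nat"
  where "len b b' w = (LEAST n. w \<in> prods b n \<and> turn b n = b')"

lemma len_in: "w \<in> prods b (len b b' w)" "turn b (len b b' w) = b'"
  using LeastI_ex[OF prods_exists[of w b b']] unfolding len_def by auto

lemma len_le: "w \<in> prods b n \<Longrightarrow> turn b n = b' \<Longrightarrow> len b b' w \<le> n"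
  unfolding len_def by (rule Least_le) simp

lemma len_even: "even (len b b' w) \<longleftrightarrow> b = b'"
  using len_in(2)[of b b' w] by (auto simp: turn_def split: if_splits)

lemma len_eq_0_iff: "len b b' w = 0 \<longleftrightarrow> b = b' \<and> w \<in> M b"
proof
  assume "len b b' w = 0"
  then show "b = b' \<and> w \<in> M b" using len_in(1)[of w b b'] len_in(2)[of b b' w] by simp
next
  assume "b = b' \<and> w \<in> M b"
  then show "len b b' w = 0" using len_le[of w b 0 b'] by auto
qed

text \<open>A factor that lies in both subgroups merges with its neighbour, which leaves one factor
  less, a start on the other side and the same end.\<close>

lemma prods_reduced:
  assumes "u \<in> prods c n"
  shows "(\<exists>xs e. red M c xs \<and> length xs = n \<and> e \<in> M (turn c n) \<and> u = sum_list xs + e) \<or>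
    (\<exists>m. n = Suc m \<and> u \<in> prods (\<not> c) m)"
  using assms
proof (induction n arbitrary: c u)
  case 0
  then show ?case by (intro disjI1 exI[of _ "[]"]) simp
next
  case (Suc n)
  then obtain x y where xy: "u = x + y" "x \<in> M c" "y \<in> prods (\<not> c) n" by auto
  show ?case
  proof (cases "x \<in> M (\<not> c)")
    case True
    then show ?thesis using xy prods_absorb by blast
  next
    case False
    from Suc.IH[OF xy(3)] show ?thesis
    proof (elim disjE exE conjE)
      fix xs e assume "red M (\<not> c) xs" "length xs = n" "e \<in> M (turn (\<not> c) n)" "y = sum_list xs + e"
      then show ?thesis using xy False
        by (intro disjI1 exI[of _ "x # xs"] exI[of _ e]) (simp add: add.assoc)
    next
      fix m assume m: "n = Suc m" "y \<in> prods (\<not> \<not> c) m"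
      then have "u \<in> prods (\<not> c) n" unfolding xy(1) m(1) using xy(2) by (intro prods_0 prods_absorb) simp_all
      then show ?thesis by blast
    qed
  qed
qed

lemma red_join:
  "red M (\<not> b) xs \<Longrightarrow> red M b (v # ys) \<Longrightarrow> red M (turn b (length xs)) (rev (map uminus xs) @ v # ys)"
proof (induction xs arbitrary: b v ys)
  case (Cons x xs)
  have "red M (\<not> b) (- x # v # ys)"
    using Cons.prems by (auto simp: subgrp_cancel(3)[OF subgrp_M, of 0] M_closed)
  then show ?case using Cons.IH[of "\<not> b" "- x" "v # ys"] Cons.prems by simp
qed simp

section \<open>The coset tree and the action on it\<close>

definition cdist :: "'g \<times> bool \<Rightarrow> 'g \<times> bool \<Rightarrow> nat"
  where "cdist x y = len (snd x) (snd y) (- fst x + fst y)"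

definition cact :: "'g \<Rightarrow> 'g \<times> bool \<Rightarrow> 'g \<times> bool"
  where "cact g x = (g + fst x, snd x)"

lemma cdist_0_iff: "cdist (g, b) (h, b') = 0 \<longleftrightarrow> b = b' \<and> - g + h \<in> M b"
  by (simp add: cdist_def len_eq_0_iff)

lemma cdist_even: "even (cdist x y) \<longleftrightarrow> snd x = snd y"
  by (simp add: cdist_def len_even)

lemma cdist_sym_le: "cdist y x \<le> cdist x y"
proof -
  let ?w = "- fst x + fst y" and ?b = "snd x" and ?b' = "snd y"
  have "- ?w \<in> prods ?b' (len ?b ?b' ?w)"
    using prods_uminus[OF len_in(1), of ?w ?b ?b'] len_in(2)[of ?b ?b' ?w] by simp
  moreover have "turn ?b' (len ?b ?b' ?w) = ?b" using len_even[of ?b ?b' ?w] by (auto simp: turn_def)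
  ultimately have "len ?b' ?b (- ?w) \<le> len ?b ?b' ?w" by (rule len_le)
  then show ?thesis by (simp add: cdist_def minus_add del: add_uminus_conv_diff)
qed

lemma cdist_tri: "cdist x z \<le> cdist x y + cdist y z"
proof -
  let ?w = "- fst x + fst y" and ?v = "- fst y + fst z"
  have "?w + ?v \<in> prods (snd x) (cdist x y + cdist y z)"
    unfolding cdist_def by (intro prods_add) (simp_all only: len_in)
  moreover have "turn (snd x) (cdist x y + cdist y z) = snd z"
    unfolding cdist_def turn_simps(4)[symmetric] by (simp only: len_in)
  ultimately show ?thesis using len_le by (simp add: cdist_def add.assoc)
qed

lemma cdist_edge: "cdist (g, b) (g, \<not> b) = 1"
proof -
  have "len b (\<not> b) 0 \<le> 1" using prods_Cons[of 0 b 0 0] M_closed by (intro len_le) simp_all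
  moreover have "len b (\<not> b) 0 \<noteq> 0" by (simp add: len_eq_0_iff)
  ultimately show ?thesis by (simp add: cdist_def)
qed

lemma cdist_Suc:
  assumes "cdist (g, b) y = Suc n"
  obtains x where "x \<in> M b" "- (g + x) + fst y \<in> prods (\<not> b) n"
proof -
  have "- g + fst y \<in> prods b (Suc n)" using len_in(1) assms unfolding cdist_def by (metis fst_conv snd_conv)
  then obtain x z where "- g + fst y = x + z" "x \<in> M b" "z \<in> prods (\<not> b) n" by auto
  moreover from this have "- (g + x) + fst y = z"
    by (metis add.assoc minus_add minus_add_cancel)
  ultimately show thesis using that by blast
qed

text \<open>Geodesics through \<open>z\<close> and \<open>z'\<close> express \<open>- g + h\<close>
  in two ways, each with a reduced middle part. Unless the two first factors differ by an element
  \<open>w\<close> of both subgroups, one middle part inverted, \<open>w\<close> and the other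
  middle part form a reduced word whose sum lies in \<open>M b'\<close>, against
  \<open>red_not_in_other\<close>.\<close>

lemma cdist_unique:
  assumes d: "cdist x y = Suc n" "cdist x z = 1" "cdist x z' = 1" "cdist z y = n" "cdist z' y = n"
  shows "cdist z z' = 0"
proof -
  obtain g b where x: "x = (g, b)" by fastforce
  have side: "snd p = (\<not> b)" if "cdist x p = 1" for p
    using cdist_even[of x p] that x by auto
  obtain k k' where z: "z = (k, \<not> b)" "z' = (k', \<not> b)"
    using side[OF d(2)] side[OF d(3)] by (cases z; cases z') auto
  obtain h b' where y: "y = (h, b')" by fastforce
  have b': "turn b (Suc n) = b'"
    using len_in(2)[of b b' "- g + h"] d(1) by (simp add: cdist_def x y)
  have form: "\<exists>v xs e. v \<in> M b \<and> - (g + v) + p \<in> M (\<not> b) \<and> red M (\<not> b) xs \<and> length xs = n \<and> e \<in> M b'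
      \<and> - g + h = v + sum_list xs + e"
    if p: "cdist x (p, \<not> b) = 1" "cdist (p, \<not> b) y = n" for p
  proof -
    obtain v where v: "v \<in> M b" "- (g + v) + p \<in> M (\<not> b)"
      using cdist_Suc[of g b "(p, \<not> b)" 0] p(1) unfolding x by auto
    have "- p + h \<in> prods (\<not> b) n"
      using len_in(1)[of "- p + h" "\<not> b" b'] p(2) by (simp add: cdist_def y)
    then have u: "(- (g + v) + p) + (- p + h) \<in> prods (\<not> b) n" using v(2) prods_absorb by blast
    have eq: "- g + h = v + ((- (g + v) + p) + (- p + h))"
      by (simp add: minus_add add.assoc del: add_uminus_conv_diff)
    \<comment> \<open>In the second case of \<open>prods_reduced\<close> the factor \<open>v\<close>
      would be absorbed, and \<open>y\<close> would be too close to \<open>x\<close>.\<close>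
    have "\<not> (\<exists>m. n = Suc m \<and> (- (g + v) + p) + (- p + h) \<in> prods (\<not> \<not> b) m)"
    proof
      assume "\<exists>m. n = Suc m \<and> (- (g + v) + p) + (- p + h) \<in> prods (\<not> \<not> b) m"
      then obtain m where m: "n = Suc m" "(- (g + v) + p) + (- p + h) \<in> prods b m" by auto
      then have "- g + h \<in> prods b m" using v(1) prods_absorb eq by metis
      moreover have "turn b m = b'" using b' m(1) by simp
      ultimately have "len b b' (- g + h) \<le> m" by (rule len_le)
      then show False using d(1) m(1) by (simp add: cdist_def x y)
    qed
    then obtain xs e where xs: "red M (\<not> b) xs" "length xs = n" "e \<in> M (turn (\<not> b) n)"
      "(- (g + v) + p) + (- p + h) = sum_list xs + e"
      using prods_reduced[OF u] by blast
    have "- g + h = v + (sum_list xs + e)" by (subst eq) (simp only: xs(4))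
    then have "- g + h = v + sum_list xs + e" by (simp only: add.assoc)
    moreover have "e \<in> M b'" using xs(3) b' by simp
    ultimately show ?thesis using v xs(1,2) by blast
  qed
  obtain v xs e where v: "v \<in> M b" "- (g + v) + k \<in> M (\<not> b)" "red M (\<not> b) xs" "length xs = n" "e \<in> M b'"
    "- g + h = v + sum_list xs + e"
    using form[of k] d z by blast
  obtain v' xs' e' where v': "v' \<in> M b" "- (g + v') + k' \<in> M (\<not> b)" "red M (\<not> b) xs'" "length xs' = n"
    "e' \<in> M b'" "- g + h = v' + sum_list xs' + e'"
    using form[of k'] d z by blast
  define w where "w = - v + v'"
  have w: "w \<in> M b" using v v' M_closed by (simp add: w_def)
  have wn: "w \<in> M (\<not> b)"
  proof (rule ccontr)
    assume nw: "w \<notin> M (\<not> b)"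
    let ?L = "rev (map uminus xs) @ w # xs'"
    have "red M (turn b n) ?L" using red_join[of b xs w xs'] v v' w nw by simp
    moreover have "turn b n = (\<not> b')" using b' by auto
    ultimately have "sum_list ?L \<notin> M b'" using red_not_in_other[of "\<not> b'" ?L] by simp
    moreover have "sum_list ?L = e + - e'"
    proof -
      have "sum_list ?L = - sum_list xs + (w + sum_list xs')" by (simp add: minus_sum_list rev_map)
      also have "\<dots> = - (v + sum_list xs) + (v' + sum_list xs')"
        by (simp add: w_def minus_add add.assoc del: add_uminus_conv_diff)
      also have "v + sum_list xs = - g + h + - e"
        unfolding v(6) by (simp add: add.assoc del: add_uminus_conv_diff)
      also have "v' + sum_list xs' = - g + h + - e'"
        unfolding v'(6) by (simp add: add.assoc del: add_uminus_conv_diff)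
      finally show ?thesis by (simp add: minus_add add.assoc del: add_uminus_conv_diff)
    qed
    moreover have "e + - e' \<in> M b'" by (intro M_closed v v')
    ultimately show False by simp
  qed
  have "- (- (g + v) + k) + (w + (- (g + v') + k')) \<in> M (\<not> b)"
    by (intro M_closed(2,3) wn v(2) v'(2))
  moreover have "- (- (g + v) + k) + (w + (- (g + v') + k')) = - k + k'"
    by (simp add: w_def minus_add add.assoc del: add_uminus_conv_diff)
  ultimately show ?thesis by (simp add: z cdist_0_iff)
qed

sublocale tree_action cdist cact
proof
  fix x y z z' :: "'g \<times> bool" and g h :: 'g and n
  show "cdist x x = 0" using cdist_0_iff[of "fst x" "snd x" "fst x" "snd x"] M_closed by simp
  show "cdist x y = cdist y x" using cdist_sym_le by (simp add: le_antisym)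
  show "cdist x z \<le> cdist x y + cdist y z" by (rule cdist_tri)
  show "\<exists>z. cdist x z = 1 \<and> cdist z y = n" if "cdist x y = Suc n"
  proof -
    obtain v where v: "v \<in> M (snd x)" "- (fst x + v) + fst y \<in> prods (\<not> snd x) n"
      using cdist_Suc[of "fst x" "snd x" y n] \<open>cdist x y = Suc n\<close> by auto
    let ?z = "(fst x + v, \<not> snd x)"
    have "turn (snd x) (Suc n) = snd y" using len_in(2) that unfolding cdist_def by metis
    then have zy: "cdist ?z y \<le> n" using len_le[OF v(2)] by (simp add: cdist_def)
    have "cdist x (fst x + v, snd x) = 0"
      using v(1) cdist_0_iff[of "fst x" "snd x"] by (simp add: add.assoc[symmetric])
    then have "cdist x ?z \<le> 1" using cdist_tri[of x ?z "(fst x + v, snd x)"] cdist_edge[of "fst x + v" "snd x"] by simp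
    then have "cdist x ?z = 1 \<and> cdist ?z y = n" using zy cdist_tri[of x y ?z] that by linarith
    then show ?thesis by blast
  qed
  show "even (cdist z x) \<longleftrightarrow> odd (cdist z y)" if "cdist x y = 1"
    using cdist_even[of x y] that by (auto simp: cdist_even)
  show "cdist z z' = 0" if "cdist x y = Suc n" "cdist x z = 1" "cdist x z' = 1" "cdist z y = n" "cdist z' y = n"
    using cdist_unique that by blast
  show "cact (g + h) x = cact g (cact h x)" by (simp add: cact_def add.assoc)
  show "cact 0 x = x" by (simp add: cact_def)
  show "cdist (cact g x) (cact g y) = cdist x y"
    by (simp add: cdist_def cact_def minus_add add.assoc del: add_uminus_conv_diff)
  show "even (cdist x (cact g x))" by (simp add: cdist_even cact_def)
qed

lemma fix_iff: "cdist (g, b) (cact x (g, b)) = 0 \<longleftrightarrow> - g + x + g \<in> M b"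
  by (simp add: cact_def cdist_0_iff add.assoc)

lemma common_edge:
  assumes "cdist x y = 1"
  obtains k b where "cdist (k, b) x = 0" "cdist (k, \<not> b) y = 0"
proof -
  obtain v where v: "v \<in> M (snd x)" "- (fst x + v) + fst y \<in> M (\<not> snd x)"
    using cdist_Suc[of "fst x" "snd x" y 0] assms by auto
  have "snd y = (\<not> snd x)" using cdist_even[of x y] assms by simp
  then have "cdist (fst x + v, \<not> snd x) (fst y, snd y) = 0" unfolding cdist_0_iff using v(2) by simp
  moreover have "cdist (fst x, snd x) (fst x + v, snd x) = 0"
    unfolding cdist_0_iff using v(1) by (simp add: add.assoc[symmetric])
  ultimately show thesis using that[of "fst x + v" "snd x"] by (simp add: d_sym)
qed

subsection \<open>Subtrees spanned by subgroups\<close>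

context
  fixes Q :: "'g set" and g :: 'g
  assumes Q: "gen ((Q \<inter> M True) \<union> (Q \<inter> M False)) = Q"
begin

text \<open>The edges of the subtree formed by the cosets of the elements of \<open>g + Q\<close>,
  with any representatives from \<open>g + Q\<close> as endpoints. The assumption on
  \<open>Q\<close> makes it connected, and the conjugate g + Q - g preserves it.\<close>

definition span_edges :: "(('g \<times> bool) \<times> ('g \<times> bool)) set"
  where "span_edges = {(u, u'). fst u \<in> (+) g ` Q \<and> fst u' \<in> (+) g ` Q \<and>
    (\<exists>q\<in>Q. \<exists>b. cdist (g + q, b) u = 0 \<and> cdist (g + q, \<not> b) u' = 0)}"

lemma subgrp_Q: "subgrp Q"
  using subgrp_gen[of "(Q \<inter> M True) \<union> (Q \<inter> M False)"] unfolding Q .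

lemma span_edges_1: "(u, u') \<in> span_edges \<Longrightarrow> cdist u u' = 1 \<and> fst u' \<in> (+) g ` Q"
proof -
  assume "(u, u') \<in> span_edges"
  then obtain q b where q: "fst u' \<in> (+) g ` Q" "cdist (g + q, b) u = 0" "cdist (g + q, \<not> b) u' = 0"
    unfolding span_edges_def by blast
  have "cdist u u' = cdist (g + q, b) (g + q, \<not> b)"
    using d_zero(1)[OF q(2), of u'] d_zero(2)[OF q(3), of "(g + q, b)"] by simp
  then show ?thesis using q(1) cdist_edge by simp
qed

lemma span_connected:
  assumes "fst x \<in> (+) g ` Q" "fst y \<in> (+) g ` Q"
  shows "(x, y) \<in> span_edges\<^sup>*"
proof -
  note Qc = subgrpD[OF subgrp_Q]
  have edge: "((g + q, b), (g + q', \<not> b)) \<in> span_edges" if "q \<in> Q" "q' \<in> Q" "- q + q' \<in> M b" for q q' b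
  proof -
    have "cdist (g + q', b) (g + q, b) = 0"
      using that(3) cdist_0_iff[of "g + q" b "g + q'" b]
      by (simp add: d_sym minus_add add.assoc del: add_uminus_conv_diff)
    moreover have "cdist (g + q', \<not> b) (g + q', \<not> b) = 0" by simp
    ultimately have "\<exists>r\<in>Q. \<exists>c. cdist (g + r, c) (g + q, b) = 0 \<and> cdist (g + r, \<not> c) (g + q', \<not> b) = 0"
      using that(2) by blast
    then show ?thesis using that(1,2) unfolding span_edges_def by simp
  qed
  have "\<forall>q\<in>Q. \<forall>b b'. ((g + q, b), (g + (q + w), b')) \<in> span_edges\<^sup>*" if "w \<in> Q" for w
  proof -
    have "w \<in> gen ((Q \<inter> M True) \<union> (Q \<inter> M False))" using \<open>w \<in> Q\<close> Q by simp
    then show ?thesis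
    proof (induction rule: gen_induct_left)
      case zero
      have "((g + q, b), (g + q, b')) \<in> span_edges\<^sup>*" if "q \<in> Q" for q b b'
        using edge[OF that that, of b] M_closed by (cases "b' = b") auto
      then show ?case by simp
    next
      case (plus s w)
      have "((g + q, b), (g + (q + (s + w)), b')) \<in> span_edges\<^sup>*" if q: "q \<in> Q" for q b b'
      proof -
        obtain c where c: "s \<in> M c" "s \<in> Q" using plus(1) by blast
        have "((g + q, b), (g + q, c)) \<in> span_edges\<^sup>*"
          using edge[OF q q, of b] M_closed by (cases "c = b") auto
        also have "((g + q, c), (g + (q + s), \<not> c)) \<in> span_edges"
          by (rule edge) (use q c Qc in auto)
        also have "((g + (q + s), \<not> c), (g + (q + s + w), b')) \<in> span_edges\<^sup>*"
          using plus(2) Qc(2)[OF q c(2)] by blast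
        finally show ?thesis by (simp add: add.assoc)
      qed
      then show ?case by blast
    next
      case (minus s w)
      have "((g + q, b), (g + (q + (- s + w)), b')) \<in> span_edges\<^sup>*" if q: "q \<in> Q" for q b b'
      proof -
        obtain c where c: "- s \<in> M c" "- s \<in> Q" using minus(1) Qc(3) M_closed by blast
        have "((g + q, b), (g + q, c)) \<in> span_edges\<^sup>*"
          using edge[OF q q, of b] M_closed by (cases "c = b") auto
        also have "((g + q, c), (g + (q + - s), \<not> c)) \<in> span_edges"
          by (rule edge[OF q Qc(2)[OF q c(2)]]) (use c in \<open>simp del: add_uminus_conv_diff\<close>)
        also have "((g + (q + - s), \<not> c), (g + (q + - s + w), b')) \<in> span_edges\<^sup>*"
          using minus(2) Qc(2)[OF q c(2)] by blast
        finally show ?thesis by (simp add: add.assoc del: add_uminus_conv_diff)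
      qed
      then show ?case by blast
    qed
  qed
  moreover obtain q q' where q: "fst x = g + q" "fst y = g + q'" "q \<in> Q" "q' \<in> Q" using assms by blast
  ultimately have "((g + q, snd x), (g + (q + (- q + q')), snd y)) \<in> span_edges\<^sup>*"
    using Qc(2)[OF Qc(3)[OF q(3)] q(4)] by blast
  then show ?thesis using q by (metis add_minus_cancel prod.collapse)
qed

lemma cact_span:
  assumes "- g + k + g \<in> Q" "fst y \<in> (+) g ` Q"
  shows "fst (cact k y) \<in> (+) g ` Q"
proof -
  obtain q where q: "q \<in> Q" "fst y = g + q" using assms(2) by blast
  have "k + (g + q) = g + ((- g + k + g) + q)" by (simp add: add.assoc)
  then show ?thesis using assms(1) q subgrpD(2)[OF subgrp_Q] by (auto simp: cact_def)
qed

text \<open>A conjugator \<open>g\<close> that brings \<open>K\<close> into \<open>Q\<close> can be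
  corrected by an element of \<open>Q\<close> so that it also brings \<open>K\<close> into a vertex
  group: the fixed point \<open>v\<close> is projected to the span.\<close>

lemma fixed_in_span:
  assumes "\<And>k. k \<in> K \<Longrightarrow> - g + k + g \<in> Q" "\<And>k. k \<in> K \<Longrightarrow> cdist v (cact k v) = 0"
  obtains q b where "q \<in> Q" "\<And>k. k \<in> K \<Longrightarrow> - (g + q) + k + (g + q) \<in> M b"
proof -
  let ?Y = "{y :: 'g \<times> bool. fst y \<in> (+) g ` Q}"
  obtain y where y: "y \<in> ?Y" "\<And>k. k \<in> K \<Longrightarrow> cdist y (cact k y) = 0"
  proof (rule fixed_point_in_subtree[of span_edges ?Y "(g + 0, True)" K v])
    show "(g + 0, True) \<in> ?Y" using subgrpD(1)[OF subgrp_Q] by force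
  qed (use span_edges_1 span_connected cact_span assms in auto)
  then obtain q b where q: "q \<in> Q" "y = (g + q, b)" by (metis (mono_tags, lifting) imageE mem_Collect_eq prod.collapse)
  then show thesis using that y(2) fix_iff by metis
qed

lemma axis_in_span:
  assumes "- g + x + g \<in> Q" "line L" "\<And>n. cdist (cact x (L n)) (L (n + c)) = 0" "c \<noteq> 0"
  obtains q b where "q \<in> Q" "cdist (g + q, b) (L n) = 0" "cdist (g + q, \<not> b) (L (n + 1)) = 0"
proof -
  let ?Y = "{y :: 'g \<times> bool. fst y \<in> (+) g ` Q}"
  have conj: "- g + zmul k x + g = zmul k (- g + x + g)" for k
    by (rule additive_zmul) (simp add: add.assoc)
  obtain u u' where u: "(u, u') \<in> span_edges" "cdist u (L n) = 0" "cdist u' (L (n + 1)) = 0"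
  proof (rule axis_in_subtree[of span_edges "(g + 0, True)" ?Y x L c n])
    show "(g + 0, True) \<in> ?Y" using subgrpD(1)[OF subgrp_Q] by force
    show "cact (zmul k x) y \<in> ?Y" if "y \<in> ?Y" for k y
      using cact_span[of "zmul k x" y] that subgrpD(5)[OF subgrp_Q assms(1)] by (simp add: conj)
  qed (use span_edges_1 span_connected assms in auto)
  then obtain q b where "q \<in> Q" "cdist (g + q, b) u = 0" "cdist (g + q, \<not> b) u' = 0"
    unfolding span_edges_def by blast
  then show thesis using that u d_zero_trans by blast
qed

end

end

section \<open>Subgroups of the Higman group\<close>

subsection \<open>Intersections of the vertex groups\<close>

lemma zmul_ha_eq_0: "zmul k (ha i) = 0 \<Longrightarrow> k = 0"
  using G2_zmul(1)[of k i] G2_fst_0[of "Aff k 0" i] by (auto simp: zero_aff_def)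

lemma zmul_ha_inj: "zmul k (ha i) = zmul l (ha i) \<Longrightarrow> k = l"
  using zmul_ha_eq_0[of "k - l" i] by (simp add: zmul_diff)

lemma Zs_Int: "Zs i \<inter> Zs (i + 1) = {0}"
proof -
  have "x = 0" if x: "x \<in> Zs i" "x \<in> Zs (i + 1)" for x
  proof -
    obtain k l where kl: "x = zmul k (ha i)" "x = zmul l (ha (i + 1))" using x unfolding Zs_iff by blast
    then have "Aff k 0 = Aff 0 (of_int l)" using G2_zmul(1)[of k i] G2_zmul(2)[of l i] G2_functional by metis
    then show ?thesis using kl by simp
  qed
  then show ?thesis using subgrpD(1)[OF subgrp_G(3)] by blast
qed

text \<open>By \<open>sub_amalgam\<close>: \<open>Zs i\<close> and \<open>Zs (i + 2)\<close>, taken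
  in the two factors of \<open>As i\<close>, each meet the opposite factor trivially and together
  generate \<open>Fs i\<close>.\<close>

lemma Fs_Int_Bs: "Fs i \<inter> Bs i = Zs i" "Fs i \<inter> Bs (i + 1) = Zs (i + 2)"
proof -
  define P where "P b = (if b then Zs i else Zs (i + 2))" for b
  have sub: "Zs (i + 2) \<subseteq> Bs (i + 1)" using Zs_subset(2)[of "i + 1"] by (simp add: four_plus)
  have "Zs i \<inter> Bs (i + 1) \<subseteq> Zs i \<inter> Zs (i + 1)" using BB_Int[of i] Zs_subset(1)[of i] by blast
  moreover have "Zs (i + 2) \<inter> Bs i \<subseteq> Zs (i + 1) \<inter> Zs (i + 2)" using BB_Int[of i] sub by blast
  ultimately have "Zs i \<inter> Bs (i + 1) \<subseteq> {0}" "Zs (i + 2) \<inter> Bs i \<subseteq> {0}"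
    using Zs_Int[of i] Zs_Int[of "i + 1"] unfolding four_plus by blast+
  moreover have "0 \<in> Zs j" "0 \<in> Bs j" for j by (simp_all add: subgrpD(1) subgrp_G)
  ultimately have zero: "Zs i \<inter> Bs (i + 1) = {0}" "Zs (i + 2) \<inter> Bs i = {0}" by blast+
  have gP: "gen (P True \<union> P False) = Fs i"
    by (simp add: P_def Zs_def Fs_def gen_gen_Un insert_commute)
  have "gen (P True \<union> P False) \<inter> BB i b = P b" for b
  proof (rule amalgam.sub_amalgam[OF amalgam_BB])
    show "P b \<subseteq> BB i b" for b
      using Zs_subset(1)[of i] sub by (simp add: P_def BB_def)
  qed (use zero in \<open>simp_all add: P_def subgrp_G BB_def\<close>)
  from this[of True] this[of False] show "Fs i \<inter> Bs i = Zs i" "Fs i \<inter> Bs (i + 1) = Zs (i + 2)"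
    unfolding gP by (simp_all add: BB_def P_def)
qed

text \<open>Killing \<open>ha (i + 2)\<close> maps \<open>As i\<close> onto the affine group, sends \<open>ha (i + 1)\<close> to a translation and
  \<open>Fs i\<close> to the linear maps.\<close>

lemma As_hom:
  obtains G where "subgrp G" "fst ` G = As i" "\<And>x. x \<in> Fs i \<Longrightarrow> \<exists>m. (x, Aff m 0) \<in> G"
    "\<And>k. (zmul k (ha (i + 1)), Aff 0 (of_int k)) \<in> G" "\<And>y. (0, y) \<in> G \<Longrightarrow> y = 0"
proof
  \<comment> \<open>On \<open>Bs (i + 1)\<close>, killing \<open>ha (i + 2)\<close> leaves the
    exponent of \<open>ha (i + 1)\<close>, which is the slope. It is turned into a translation
    length because \<open>ha (i + 1)\<close> is a translation in the model of
    \<open>Bs i\<close>.\<close>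
  define \<kappa> where "\<kappa> f = (case f of Aff m q \<Rightarrow> Aff 0 (of_int m))" for f :: aff
  have \<kappa>: "\<kappa> (f + g) = \<kappa> f + \<kappa> g" for f g by (cases f; cases g) (simp add: \<kappa>_def)
  define N where "N b = (if b then G2 i else map_prod id \<kappa> ` G2 (i + 1))" for b
  have NF: "N False = gen {(ha (i + 1), Aff 0 1), (ha (i + 2), 0)}"
    unfolding N_def G2_def
    by (simp add: gen_image[OF additive_map_snd[OF \<kappa>]] \<kappa>_def zero_aff_def add.assoc)
  define G where "G = gen {(ha i, Aff 1 0), (ha (i + 1), Aff 0 1), (ha (i + 2), 0)}"
  have GN: "G = gen (N True \<union> N False)"
    unfolding NF by (simp add: N_def G2_def gen_gen_Un G_def insert_commute)
  show "subgrp G" by (simp add: G_def)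
  show "fst ` G = As i" unfolding G_def As_def by (subst gen_image) simp_all
  have "zmul k (ha (i + 1), Aff 0 1) \<in> G" for k
    unfolding G_def by (rule subgrpD(5)[OF subgrp_gen], rule gen.base, simp)
  moreover have zm: "zmul k (ha (i + 1), Aff 0 1) = (zmul k (ha (i + 1)), Aff 0 (of_int k))" for k
    by (rule prod_eqI) (simp_all add: zmul_aff)
  ultimately show "(zmul k (ha (i + 1)), Aff 0 (of_int k)) \<in> G" for k by simp
  show "\<exists>m. (x, Aff m 0) \<in> G" if "x \<in> Fs i" for x
  proof -
    have "fst ` gen {(ha i, Aff 1 0), (ha (i + 2), 0)} = Fs i"
      unfolding Fs_def by (subst gen_image) simp_all
    then obtain y where y: "(x, y) \<in> gen {(ha i, Aff 1 0), (ha (i + 2), 0)}" using \<open>x \<in> Fs i\<close> by force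
    have "snd ` gen {(ha i, Aff 1 0), (ha (i + 2), 0)} = gen {Aff 1 0, 0}"
      by (subst gen_image) simp_all
    also have "gen {Aff 1 0, 0} \<subseteq> gen {Aff 1 0}" by (rule gen_minimal) (auto intro: gen.intros)
    finally obtain m where "y = Aff m 0" using y by (force simp: gen_singleton zmul_aff)
    moreover have "gen {(ha i, Aff 1 0), (ha (i + 2), 0)} \<subseteq> G" unfolding G_def by (rule gen_mono) auto
    ultimately show ?thesis using y by blast
  qed
  have uniq: "y = Aff 0 (of_int k)" if yN: "(zmul k (ha (i + 1)), y) \<in> N b" for k y b
  proof (cases b)
    case True
    then show ?thesis using that G2_zmul(2)[of k i] G2_functional by (auto simp: N_def)
  next
    case False
    then obtain f where f: "(zmul k (ha (i + 1)), f) \<in> G2 (i + 1)" "y = \<kappa> f"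
      using yN by (auto simp: N_def)
    then have "f = Aff k 0" using G2_zmul(1)[of k "i + 1"] G2_functional by blast
    then show ?thesis using f(2) by (simp add: \<kappa>_def)
  qed
  have inN: "(zmul k (ha (i + 1)), Aff 0 (of_int k)) \<in> N b" for k b
  proof (cases b)
    case True
    then show ?thesis using G2_zmul(2)[of k i] by (simp add: N_def)
  next
    case False
    have "zmul k (ha (i + 1), Aff 0 1) \<in> N False"
      unfolding NF by (rule subgrpD(5)[OF subgrp_gen], rule gen.base, simp)
    then show ?thesis using False zm by simp
  qed
  have N_BB: "fst p \<in> BB i b" if "p \<in> N b" for p b
    using that by (cases b; cases p) (auto simp: N_def BB_def intro: graph_Bs)
  \<comment> \<open>Both parts of \<open>G\<close> agree on the common multiples of
    \<open>ha (i + 1)\<close>, so a letter outside the opposite \<open>N\<close> has its first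
    coordinate outside the opposite factor: reduced words project to reduced words.\<close>
  show "y = 0" if "(0, y) \<in> G" for y
    using _ \<open>(0, y) \<in> G\<close>[unfolded GN]
  proof (rule gen_red_cases)
    show "subgrp (N b)" for b by (cases b) (simp_all add: NF, simp add: N_def subgrp_G)
    assume "(0, y) \<in> N True"
    then show "y = 0" by (simp add: N_def G2_fst_0)
  next
    fix b xs assume xs: "xs \<noteq> []" "red N b xs" "(0, y) = sum_list xs"
    have "red (BB i) b (map fst xs)"
      using xs(2)
    proof (induction xs arbitrary: b)
      case (Cons p ps)
      have p: "p \<in> N b" "p \<notin> N (\<not> b)" using Cons.prems by auto
      have "fst p \<notin> BB i (\<not> b)"
      proof
        assume "fst p \<in> BB i (\<not> b)"
        then have "fst p \<in> Zs (i + 1)" using N_BB[OF p(1)] BB_Int[of i] by (cases b) (auto simp: BB_def)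
        then obtain k where k: "fst p = zmul k (ha (i + 1))" by (auto simp: Zs_iff)
        then have "snd p = Aff 0 (of_int k)" using uniq[of k "snd p" b] p(1) by (cases p) simp
        then have "p = (zmul k (ha (i + 1)), Aff 0 (of_int k))" using k by (cases p) simp
        then show False using p(2) inN by simp
      qed
      then show ?case using Cons N_BB[OF p(1)] by simp
    qed simp
    then have "sum_list (map fst xs) \<noteq> 0" using amalgam.red_ne_0[OF amalgam_BB] xs(1) by blast
    moreover have "sum_list (map fst xs) = fst (sum_list xs)"
      by (rule additive_sum_list[symmetric]) simp
    ultimately have False using xs(3) by (metis fst_conv)
    then show "y = 0" ..
  qed
qed

text \<open>In the affine image given by \<open>As_hom\<close> a conjugate of a translation is a
  translation, while \<open>Fs i\<close> goes to linear maps; only the identity is both.\<close>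

lemma not_conjugate:
  assumes "u \<in> As i" "u + zmul k (ha (i + 1)) - u \<in> Fs i"
  shows "k = 0"
proof -
  obtain G where G: "subgrp G" "fst ` G = As i" "\<And>x. x \<in> Fs i \<Longrightarrow> \<exists>m. (x, Aff m 0) \<in> G"
    "\<And>k. (zmul k (ha (i + 1)), Aff 0 (of_int k)) \<in> G" "\<And>y. (0, y) \<in> G \<Longrightarrow> y = 0"
    using As_hom[of i] by blast
  obtain y where y: "(u, y) \<in> G" using assms(1) G(2) by force
  obtain m where m: "(u + zmul k (ha (i + 1)) - u, Aff m 0) \<in> G" using G(3) assms(2) by blast
  have "(u, y) + (zmul k (ha (i + 1)), Aff 0 (of_int k)) - (u, y) \<in> G"
    by (intro subgrpD(2,4)[OF G(1)] y G(4))
  then have "(u + zmul k (ha (i + 1)) - u, y + Aff 0 (of_int k) - y) \<in> G"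
    by (simp add: plus_prod_def minus_prod_def)
  then have "y + Aff 0 (of_int k) - y = Aff m 0" using functional_unique[OF G(1,5) _ m] by blast
  then show ?thesis by (cases y) (simp add: diff_aff)
qed

lemma Zs_Int_Fs: "Zs (i + 1) \<inter> Fs i = {0}"
proof -
  have "x = 0" if x: "x \<in> Zs (i + 1)" "x \<in> Fs i" for x
  proof -
    obtain k where k: "x = zmul k (ha (i + 1))" using x(1) unfolding Zs_iff by blast
    then have "k = 0" using not_conjugate[of 0 i k] x(2) subgrpD(1)[OF subgrp_G(6)] by simp
    then show ?thesis using k by simp
  qed
  then show ?thesis using subgrpD(1)[OF subgrp_G(3)] subgrpD(1)[OF subgrp_G(5)] by blast
qed

lemma As_Int: "As (i + 1) \<inter> As i = Bs (i + 1)" "As (i + 1) \<inter> As (i + 2) = Bs (i + 2)"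
proof -
  define P where "P b = (if b then Bs (i + 1) else Bs (i + 2))" for b
  have "Bs (i + 1) \<inter> As (i + 2) = Zs (i + 2)"
    using Fs_Int_Bs(2)[of i] AA_Int[of i] Bs_subset(2)[of i] by blast
  moreover have "Bs (i + 2) \<inter> As i = Zs (i + 2)"
    using Fs_Int_Bs(1)[of "i + 2"] AA_Int[of i] Bs_subset(1)[of "i + 2"] Fs_plus2[of i] by blast
  moreover have gP: "gen (P True \<union> P False) = As (i + 1)"
    using gen_BB[of "i + 1"] by (simp add: P_def BB_def four_plus)
  note eqs = calculation
  have "gen (P True \<union> P False) \<inter> AA i b = P b" for b
  proof (rule amalgam.sub_amalgam[OF amalgam_AA])
    show "P b \<subseteq> AA i b" for b
      using Bs_subset(2)[of i] Bs_subset(1)[of "i + 2"] by (auto simp: P_def AA_def)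
  qed (use eqs in \<open>simp_all add: P_def subgrp_G AA_def\<close>)
  from this[of True] this[of False]
  show "As (i + 1) \<inter> As i = Bs (i + 1)" "As (i + 1) \<inter> As (i + 2) = Bs (i + 2)"
    unfolding gP by (simp_all add: AA_def P_def)
qed

lemma Fs_Int_As: "Fs (i + 1) \<inter> As i = Zs (i + 1)" "Fs (i + 1) \<inter> As (i + 2) = Zs (i + 3)"
proof -
  define P where "P b = (if b then Zs (i + 1) else Zs (i + 3))" for b
  have sub: "Zs (i + 1) \<subseteq> As i" "Zs (i + 3) \<subseteq> As (i + 2)"
    using Zs_subset(2)[of i] Zs_subset(2)[of "i + 2"] Bs_subset(1)[of i] Bs_subset(1)[of "i + 2"]
    by (auto simp: four_plus)
  have "Zs (i + 1) \<inter> As (i + 2) = {0}"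
    using sub AA_Int[of i] Zs_Int_Fs[of i] Bs_subset(4)[of i] by blast
  moreover have "Zs (i + 3) \<inter> As i = {0}"
    using sub AA_Int[of i] Zs_Int_Fs[of "i + 2"] Fs_plus2[of i] Bs_subset(3)[of i] by (auto simp: four_plus)
  moreover have gP: "gen (P True \<union> P False) = Fs (i + 1)"
    by (simp add: P_def Zs_def Fs_def gen_gen_Un insert_commute four_plus)
  note eqs = calculation
  have "gen (P True \<union> P False) \<inter> AA i b = P b" for b
  proof (rule amalgam.sub_amalgam[OF amalgam_AA])
    show "P b \<subseteq> AA i b" for b using sub by (simp add: P_def AA_def)
  qed (use eqs in \<open>simp_all add: P_def subgrp_G AA_def\<close>)
  from this[of True] this[of False]
  show "Fs (i + 1) \<inter> As i = Zs (i + 1)" "Fs (i + 1) \<inter> As (i + 2) = Zs (i + 3)"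
    unfolding gP by (simp_all add: AA_def P_def)
qed

lemma Fs_Int: "Fs i \<inter> Fs (i + 1) = {0}"
proof -
  have "Fs i \<inter> Fs (i + 1) = Fs (i + 1) \<inter> As i \<inter> Fs i" using Bs_subset(3)[of i] by blast
  then show ?thesis using Fs_Int_As(1)[of i] Zs_Int_Fs[of i] by simp
qed

subsection \<open>Subgroups acting on two trees\<close>

interpretation T: amalgam_tree "AA i" for i :: 4
  by (intro amalgam_tree.intro amalgam_AA amalgam_tree_axioms.intro gen_AA)

text \<open>The two trees of \<open>H\<close> are those of index \<open>i\<close> and \<open>i + 1\<close>.\<close>

lemma span_As: "gen ((As i \<inter> AA (i + 1) True) \<union> (As i \<inter> AA (i + 1) False)) = As i"
proof -
  have "As i \<inter> As (i + 1) = Bs (i + 1)" "As i \<inter> As (i + 3) = Bs i"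
    using As_Int(1)[of i] As_Int(2)[of "i + 2"] As_Int(1)[of "i + 3"] by (auto simp: four_plus)
  then have "As i \<inter> AA (i + 1) True = BB i False" "As i \<inter> AA (i + 1) False = BB i True"
    by (simp_all add: AA_def BB_def four_plus)
  then show ?thesis using gen_BB[of i] by (simp add: Un_commute)
qed

lemma Fs_Int_AA: "Fs i \<inter> AA (i + 1) True = Zs (i + 2)" "Fs i \<inter> AA (i + 1) False = Zs i"
  using Fs_Int_As(1)[of "i + 1"] Fs_Int_As(2)[of "i + 1"] Fs_plus2[of i]
  by (simp_all add: AA_def four_plus)

lemma span_Fs: "gen ((Fs i \<inter> AA (i + 1) True) \<union> (Fs i \<inter> AA (i + 1) False)) = Fs i"
  unfolding Fs_Int_AA by (simp add: Zs_def Fs_def gen_gen_Un insert_commute)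

lemma conj_in_subgrp:
  assumes "subgrp Q" "q \<in> Q" "- g + x + g \<in> Q"
  shows "- (g + q) + x + (g + q) \<in> Q"
proof -
  have "- (g + q) + x + (g + q) = - q + (- g + x + g) + q"
    by (simp add: minus_add add.assoc del: add_uminus_conv_diff)
  then show ?thesis using assms subgrpD[OF assms(1)] by simp
qed

lemma fixed_fixed:
  assumes "\<And>k. k \<in> K \<Longrightarrow> - g + k + g \<in> As i"
    and "\<And>k. k \<in> K \<Longrightarrow> T.cdist (i + 1) v (T.cact k v) = 0"
  obtains h j where "\<And>k. k \<in> K \<Longrightarrow> - h + k + h \<in> Bs j"
proof -
  obtain q b where q: "q \<in> As i" "\<And>k. k \<in> K \<Longrightarrow> - (g + q) + k + (g + q) \<in> AA (i + 1) b"
    using T.fixed_in_span[OF span_As assms] by blast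
  have "- (g + q) + k + (g + q) \<in> As i \<inter> AA (i + 1) b" if "k \<in> K" for k
    using q conj_in_subgrp[OF subgrp_G(6)] assms(1) that by blast
  moreover have "As i \<inter> AA (i + 1) b = Bs (if b then i + 1 else i)"
    using As_Int(1)[of i] As_Int(1)[of "i + 3"] by (auto simp: AA_def four_plus)
  ultimately show thesis using that by blast
qed

text \<open>In the affine model \<open>Zs j\<close> consists of scalings about 0, and
  \<open>r\<close> moves 0 by some \<open>p\<close> that is not 0. Comparing translation parts gives
  \<open>2 powi k * p = p\<close>.\<close>

lemma malnormal:
  assumes r: "r \<in> Bs j" "r \<notin> Zs j" and y: "y \<in> Zs j" "y' \<in> Zs j" and eq: "y + r = r + y'"
  shows "y' = 0"
proof -
  obtain m p where m: "(r, Aff m p) \<in> G2 j" using r(1) Bs_graph by (metis aff.exhaust)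
  have "p \<noteq> 0" using m G2_zmul(1)[of m j] G2_unique r(2) Zs_iff by blast
  obtain k l where kl: "y = zmul k (ha j)" "y' = zmul l (ha j)" using y unfolding Zs_iff by blast
  have "(y, Aff k 0) + (r, Aff m p) \<in> G2 j" "(r, Aff m p) + (y', Aff l 0) \<in> G2 j"
    unfolding kl by (intro subgrpD(2)[OF subgrp_G(1)] G2_zmul(1) m)+
  then have "(r + y', Aff k 0 + Aff m p) \<in> G2 j" "(r + y', Aff m p + Aff l 0) \<in> G2 j"
    using eq by (simp_all add: plus_prod_def)
  then have "Aff k 0 + Aff m p = Aff m p + Aff l 0" by (rule G2_functional)
  then have "k = l" "2 powi k * p = p" by auto
  then have "(2::real) powi k = 1" using \<open>p \<noteq> 0\<close> by simp
  then have "k = 0" by (cases k rule: int_cases2) (auto simp: power_int_minus power_inject_exp[of "2::real" _ 0, simplified])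
  then show ?thesis using kl \<open>k = l\<close> by simp
qed

text \<open>The line lies in the span of \<open>g + As i\<close>, so at each of two consecutive
  edges \<open>x\<close> is conjugate into \<open>Zs (i + 1)\<close>. The elements \<open>q\<close>,
  \<open>q'\<close> of \<open>As i\<close> that name these edges differ by an element of
  \<open>Bs (i + 1)\<close> outside \<open>Zs (i + 1)\<close>, and \<open>malnormal\<close>
  applies.\<close>

lemma fixed_line:
  assumes K: "\<And>k. k \<in> K \<Longrightarrow> - g + k + g \<in> As i"
    and L: "T.line (i + 1) L" "x0 \<in> K" "\<And>n. T.cdist (i + 1) (T.cact x0 (L n)) (L (n + c)) = 0" "c \<noteq> 0"
    and x: "x \<in> K" "\<And>n. T.cdist (i + 1) (T.cact x (L n)) (L n) = 0"
  shows "x = 0"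
proof -
  let ?d = "T.cdist (i + 1)"
  have d1: "?d (L n) (L (n + 1)) = 1" for n using T.lineD[OF L(1), of n "n + 1"] by simp
  \<comment> \<open>The vertex between the two edges has to be of the type \<open>True\<close>,
    where \<open>As i\<close> and \<open>As (i + 1)\<close> meet in \<open>Bs (i + 1)\<close> and
    \<open>ha (i + 1)\<close> is a scaling. At the other type it would be a translation in
    \<open>Bs i\<close>, and \<open>malnormal\<close> would not apply.\<close>
  have "\<exists>n0. snd (L n0) = True"
    using T.cdist_even[of "i + 1" "L 0" "L (0 + 1)"] d1[of 0] by (cases "snd (L 0)") auto
  then obtain n0 where n0: "snd (L n0)" by blast
  obtain q b where q: "q \<in> As i" "?d (g + q, b) (L (n0 - 1)) = 0" "?d (g + q, \<not> b) (L n0) = 0"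
    using T.axis_in_span[OF span_As K[OF L(2)] L(1,3,4), of "n0 - 1"] by auto
  obtain q' b' where q': "q' \<in> As i" "?d (g + q', b') (L n0) = 0" "?d (g + q', \<not> b') (L (n0 + 1)) = 0"
    using T.axis_in_span[OF span_As K[OF L(2)] L(1,3,4), of n0] by auto
  have b: "b = False" "b' = True"
    using T.cdist_even[of "i + 1" "(g + q, \<not> b)" "L n0"] T.cdist_even[of "i + 1" "(g + q', b')" "L n0"] q(3) q'(2) n0
    by auto
  have fix_at: "?d v (T.cact x v) = 0" if "?d v (L n) = 0" for v n
    using T.fixed_transfer[OF that] x(2)[of n] by (simp add: T.d_sym)
  define x' where "x' = - g + x + g"
  have conj: "- r + x' + r = - (g + r) + x + (g + r)" for r
    by (simp add: x'_def minus_add add.assoc del: add_uminus_conv_diff)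
  have inZ: "- r + x' + r \<in> Zs (i + 1)"
    if r: "r \<in> As i" "?d (g + r, True) (T.cact x (g + r, True)) = 0" "?d (g + r, False) (T.cact x (g + r, False)) = 0" for r
  proof -
    have "- (g + r) + x + (g + r) \<in> As (i + 1) \<inter> As (i + 3)"
      using r(2,3) unfolding T.fix_iff by (simp add: AA_def four_plus)
    moreover have "- (g + r) + x + (g + r) \<in> As i"
      using conj_in_subgrp[OF subgrp_G(6) r(1)] K[OF x(1)] by blast
    ultimately have "- (g + r) + x + (g + r) \<in> Fs (i + 1) \<inter> As i"
      using AA_Int[of "i + 1"] unfolding four_plus by blast
    then show ?thesis unfolding Fs_Int_As conj .
  qed
  have y: "- q + x' + q \<in> Zs (i + 1)" "- q' + x' + q' \<in> Zs (i + 1)"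
    using inZ[OF q(1)] inZ[OF q'(1)] fix_at q(2,3) q'(2,3) b by auto
  let ?r = "- q + q'"
  have "?d (g + q, True) (g + q', True) = 0" using T.d_zero_join[OF q(3) q'(2)] b by simp
  then have "?r \<in> As (i + 1)"
    unfolding T.cdist_0_iff by (simp add: AA_def minus_add add.assoc del: add_uminus_conv_diff)
  moreover have "?r \<in> As i" using q(1) q'(1) subgrpD(2,3)[OF subgrp_G(6)] by blast
  ultimately have r: "?r \<in> Bs (i + 1)" using As_Int(1)[of i] by blast
  have "?r \<notin> Zs (i + 1)"
  proof
    assume "?r \<in> Zs (i + 1)"
    then have "?r \<in> As (i + 3)" using Zs_subset(3)[of "i + 1"] Bs_subset(4)[of "i + 1"] by (auto simp: four_plus)
    then have "?d (g + q, False) (g + q', False) = 0"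
      unfolding T.cdist_0_iff by (simp add: AA_def minus_add add.assoc four_plus del: add_uminus_conv_diff)
    then have "?d (g + q, False) (L (n0 + 1)) = 0" using q'(3) b T.d_zero_trans by simp
    then have "?d (L (n0 - 1)) (L (n0 + 1)) = 0" using T.d_zero(1)[OF q(2)] b by simp
    then show False using T.lineD[OF L(1), of "n0 - 1" "n0 + 1"] by simp
  qed
  moreover have "(- q + x' + q) + ?r = ?r + (- q' + x' + q')" by (simp add: add.assoc)
  ultimately have "- q' + x' + q' = 0" using malnormal[OF r _ y] by blast
  then have "- g + x + g = 0" unfolding x'_def by (rule conj_eq_0)
  then show ?thesis by (rule conj_eq_0)
qed

text \<open>An axis would give \<open>x\<close> infinite order, so \<open>x\<close> fixes a vertex
  in both trees and is conjugate into some \<open>Bs j\<close>, where the affine model excludes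
  order 2.\<close>

lemma torsion_free:
  fixes x :: hig
  assumes "x + x = 0"
  shows "x = 0"
proof -
  have fixed: "\<exists>v. T.cdist j v (T.cact x v) = 0" for j
  proof (rule ccontr)
    assume "\<not> ?thesis"
    then have ne: "T.cdist j v (T.cact x v) \<noteq> 0" for v by (metis (full_types))
    obtain L c where L: "T.line j L" "c > 0" "\<And>n. T.cdist j (T.cact x (L n)) (L (n + c)) = 0"
      by (rule T.axis_exists[OF ne]) blast
    have "zmul 2 x = 0" using assms zmul_add[of 1 1 x] by simp
    then have "T.cdist j (L 0) (L (0 + 2 * c)) = 0"
      using T.act_zmul_line[of j x L c 2 0] L(3) by simp
    then show False using T.lineD[OF L(1), of 0 "0 + 2 * c"] L(2) by simp
  qed
  obtain g b where g: "T.cdist 0 (g, b) (T.cact x (g, b)) = 0" using fixed[of 0] by force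
  define i :: 4 where "i = (if b then 0 else 2)"
  have gi: "- g + x + g \<in> As i" using g unfolding T.fix_iff by (cases b) (simp_all add: i_def AA_def)
  obtain v where v: "T.cdist (i + 1) v (T.cact x v) = 0" using fixed by blast
  obtain h j where "- h + x + h \<in> Bs j"
    using fixed_fixed[of "{x}" g i v] gi v by blast
  then obtain m q where m: "(- h + x + h, Aff m q) \<in> G2 j" using Bs_graph by (metis aff.exhaust)
  have "(- h + x + h, Aff m q) + (- h + x + h, Aff m q) \<in> G2 j" by (intro subgrpD(2)[OF subgrp_G(1)] m)
  moreover have "(- h + x + h) + (- h + x + h) = - h + (x + x) + h" by (simp add: add.assoc)
  ultimately have "(0, Aff m q + Aff m q) \<in> G2 j" using assms by (simp add: plus_prod_def)
  then have "Aff m q + Aff m q = 0" by (rule G2_fst_0)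
  then have "m = 0" "q = 0" by (auto simp: zero_aff_def)
  then have "- h + x + h = 0" using m G2_snd_0 by (simp add: zero_aff_def)
  then show ?thesis by (rule conj_eq_0)
qed

text \<open>The square of a reflection acts trivially on the line, so by faithfulness and
  \<open>torsion_free\<close> there are no reflections; the translation length is then an injective
  homomorphism to the integers.\<close>

lemma cyclic_if_faithful_on_line:
  assumes K: "subgrp K" and L: "T.line i L" "\<And>k. k \<in> K \<Longrightarrow> T.preserves i k L"
    and faithful: "\<And>x. x \<in> K \<Longrightarrow> (\<And>n. T.cdist i (T.cact x (L n)) (L n) = 0) \<Longrightarrow> x = 0"
  shows "\<exists>x\<in>K. K = range (\<lambda>k. zmul k x)"
proof -
  let ?d = "T.cdist i"
  have ex: "\<exists>c. \<forall>n. ?d (T.cact k (L n)) (L (n + c)) = 0" if k: "k \<in> K" for k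
  proof -
    obtain e c where e: "e \<in> {1, -1}" "\<And>n. ?d (T.cact k (L n)) (L (e * n + c)) = 0"
      using L(2)[OF k] unfolding T.preserves_def by blast
    show ?thesis
    proof (cases "e = 1")
      case True
      then show ?thesis using e(2) by auto
    next
      case False
      then have m: "e = -1" using e(1) by simp
      have "?d (T.cact (k + k) (L n)) (L n) = 0" for n
      proof -
        have "?d (T.cact k (T.cact k (L n))) (T.cact k (L (e * n + c))) = 0" using e(2)[of n] by simp
        moreover have "?d (T.cact k (L (e * n + c))) (L n) = 0" using e(2)[of "e * n + c"] m by simp
        ultimately show ?thesis unfolding T.act_add by (rule T.d_zero_trans)
      qed
      then have "k + k = 0" using faithful k subgrpD(2)[OF K] by blast
      then have "k = 0" by (rule torsion_free)
      then show ?thesis by (intro exI[of _ 0]) simp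
    qed
  qed
  define c where "c k = (SOME c. \<forall>n. ?d (T.cact k (L n)) (L (n + c)) = 0)" for k
  have c: "?d (T.cact k (L n)) (L (n + c k)) = 0" if "k \<in> K" for k n
    using someI_ex[OF ex[OF that]] unfolding c_def by blast
  have c_unique: "c k = m" if "k \<in> K" "?d (T.cact k (L 0)) (L m) = 0" for k m
  proof -
    have "?d (L (c k)) (L m) = 0" using T.d_zero(1)[OF c[OF that(1), of 0], of "L m"] that(2) by simp
    then show ?thesis using T.lineD[OF L(1), of "c k" m] by simp
  qed
  show ?thesis
  proof (rule cyclic_if_int_valued[OF K])
    show "c (x + y) = c x + c y" if "x \<in> K" "y \<in> K" for x y
    proof (rule c_unique)
      show "x + y \<in> K" using that subgrpD(2)[OF K] by blast
      have "?d (T.cact x (T.cact y (L 0))) (T.cact x (L (c y))) = 0" using c[OF that(2), of 0] by simp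
      moreover have "?d (T.cact x (L (c y))) (L (c x + c y)) = 0" using c[OF that(1), of "c y"] by (simp add: add.commute)
      ultimately show "?d (T.cact (x + y) (L 0)) (L (c x + c y)) = 0" unfolding T.act_add by (rule T.d_zero_trans)
    qed
    show "x = 0" if "x \<in> K" "c x = 0" for x
      using faithful[OF that(1)] c[OF that(1)] that(2) by simp
  qed
qed

text \<open>An edge fixed in the first tree conjugates \<open>z\<close> into \<open>Fs i\<close>,
  and a vertex fixed in the second one improves this to some \<open>Zs j\<close>. That vertex has
  group \<open>As (j + 3)\<close> up to conjugacy, with middle generator \<open>ha j\<close>. An
  edge fixed at this vertex conjugates \<open>z\<close> into \<open>Fs (j + 3)\<close> as well,
  which \<open>not_conjugate\<close> permits only for 0.\<close>

lemma fixes_two_edges: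
  assumes u: "T.cdist i u u' = 1" "T.cdist i u (T.cact z u) = 0" "T.cdist i u' (T.cact z u') = 0"
    and v: "T.cdist (i + 1) v v' = 1" "T.cdist (i + 1) v (T.cact z v) = 0" "T.cdist (i + 1) v' (T.cact z v') = 0"
  shows "z = 0"
proof -
  let ?d = "T.cdist (i + 1)"
  have edge_stab: "\<exists>k. - k + z + k \<in> Fs j \<and> T.cdist j (k, snd u) u = 0"
    if e: "T.cdist j u u' = 1" "T.cdist j u (T.cact z u) = 0" "T.cdist j u' (T.cact z u') = 0" for j u u'
  proof -
    obtain k b where k: "T.cdist j (k, b) u = 0" "T.cdist j (k, \<not> b) u' = 0" using T.common_edge[OF e(1)] by blast
    have "- k + z + k \<in> AA j b" "- k + z + k \<in> AA j (\<not> b)"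
      using T.fixed_transfer[OF k(1) e(2)] T.fixed_transfer[OF k(2) e(3)] unfolding T.fix_iff by simp_all
    then have "- k + z + k \<in> As j \<inter> As (j + 2)" by (cases b) (simp_all add: AA_def)
    moreover have "b = snd u" using T.cdist_even[of j "(k, b)" u] k(1) by simp
    ultimately show ?thesis using k(1) AA_Int by blast
  qed
  obtain k where k: "- k + z + k \<in> Fs i" using edge_stab[OF u] by blast
  obtain q b where q: "q \<in> Fs i" "- (k + q) + z + (k + q) \<in> AA (i + 1) b"
    using T.fixed_in_span[OF span_Fs, where K = "{z}" and g = k and v = v] k v(2) by blast
  define w where "w = k + q"
  define j where "j = (if b then i + 2 else i)"
  have "- w + z + w \<in> Fs i" using conj_in_subgrp[OF subgrp_G(5) q(1) k] by (simp only: w_def)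
  then have "- w + z + w \<in> Zs j" using q(2) Fs_Int_AA[of i] unfolding w_def j_def by (cases b) auto
  then obtain m where m: "- w + z + w = zmul m (ha j)" unfolding Zs_iff by blast
  have Aj: "AA (i + 1) b = As (j + 3)" by (cases b) (simp_all add: AA_def j_def four_plus)
  have fw: "?d (w, b) (T.cact z (w, b)) = 0" unfolding T.fix_iff using q(2) by (simp only: w_def)
  \<comment> \<open>The fixed set is convex and has more than one vertex, so it contains a neighbour
    of the vertex just found.\<close>
  have "\<exists>p. ?d (w, b) p = 1 \<and> ?d p (T.cact z p) = 0"
  proof -
    have "\<exists>p. ?d (w, b) p \<noteq> 0 \<and> ?d p (T.cact z p) = 0"
      using v T.d_zero(1)[of "i + 1" v "(w, b)" v'] by (metis T.d_sym zero_neq_one)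
    then obtain p n where p: "?d (w, b) p = Suc n" "?d p (T.cact z p) = 0" by (metis not0_implies_Suc)
    then obtain p1 where p1: "?d (w, b) p1 = 1" "?d p1 p = n" using T.step by blast
    then have "?d (w, b) p1 + ?d p1 p = ?d (w, b) p" using p(1) by simp
    then have "?d p1 (T.cact z p1) = 0"
      using T.fix_convex[of "i + 1" z] fw p(2) unfolding T.tree_convex_def by blast
    then show ?thesis using p1 by blast
  qed
  then obtain p where p: "?d (w, b) p = 1" "?d p (T.cact z p) = 0" by blast
  obtain k' where k': "- k' + z + k' \<in> Fs (i + 1)" "?d (k', b) (w, b) = 0"
    using edge_stab[OF p(1) fw p(2)] by auto
  let ?r = "- k' + w"
  have r: "?r \<in> As (j + 3)" using k'(2) unfolding T.cdist_0_iff Aj by simp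
  have "Fs (i + 1) = Fs (j + 3)" using Fs_plus2[of "i + 1"] by (simp add: j_def four_plus)
  moreover have "?r + (- w + z + w) - ?r = - k' + z + k'"
    by (simp add: grp_simps del: add_uminus_conv_diff)
  ultimately have "?r + zmul m (ha (j + 3 + 1)) - ?r \<in> Fs (j + 3)"
    using k'(1) m by (simp add: four_plus)
  then have "m = 0" using not_conjugate[OF r] by blast
  then have "- w + z + w = 0" using m by simp
  then show ?thesis by (rule conj_eq_0)
qed

subsection \<open>No periodic flats\<close>

text \<open>Compares slopes and translation parts of the two sides in the affine model of
  \<open>Bs j\<close>.\<close>

lemma rectangle:
  assumes "zmul q (ha j) + zmul p' (ha (j + 1)) = zmul p (ha (j + 1)) + zmul q' (ha j)"
  shows "q = q' \<and> real_of_int p = 2 powi q * real_of_int p'"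
proof -
  have "(zmul q (ha j), Aff q 0) + (zmul p' (ha (j + 1)), Aff 0 (of_int p')) \<in> G2 j"
    "(zmul p (ha (j + 1)), Aff 0 (of_int p)) + (zmul q' (ha j), Aff q' 0) \<in> G2 j"
    by (intro subgrpD(2)[OF subgrp_G(1)] G2_zmul)+
  then have "(zmul q (ha j) + zmul p' (ha (j + 1)), Aff q (2 powi q * of_int p')) \<in> G2 j"
    "(zmul q (ha j) + zmul p' (ha (j + 1)), Aff q' (of_int p)) \<in> G2 j"
    using assms by (simp_all add: plus_prod_def)
  then have "Aff q (2 powi q * of_int p') = Aff q' (of_int p)" by (rule G2_functional)
  then show ?thesis by auto
qed

lemma exponential_gap:
  assumes "real_of_int a = 2 powi q * real_of_int b" "a \<noteq> 0" "b \<noteq> 0"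
  shows "\<bar>q\<bar> < \<bar>a\<bar> \<or> \<bar>q\<bar> < \<bar>b\<bar>"
proof -
  have gap: "int n < \<bar>x\<bar>" if "real_of_int x = 2 ^ n * real_of_int y" "y \<noteq> 0" for x y n
  proof -
    have "real_of_int x = real_of_int (2 ^ n * y)" using that(1) by simp
    then have "x = 2 ^ n * y" by (simp only: of_int_eq_iff)
    then have "\<bar>x\<bar> = 2 ^ n * \<bar>y\<bar>" by (simp add: abs_mult)
    moreover have "\<bar>y\<bar> \<ge> 1" using that(2) by simp
    then have "2 ^ n * 1 \<le> 2 ^ n * \<bar>y\<bar>" by (intro mult_left_mono) simp_all
    moreover have "int n < 2 ^ n" by (rule of_nat_less_two_power)
    ultimately show ?thesis by linarith
  qed
  show ?thesis
  proof (cases q rule: int_cases2)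
    case (nonneg n)
    then show ?thesis using gap[of a n b] assms by simp
  next
    case (nonpos n)
    then have "real_of_int b = 2 ^ n * real_of_int a" using assms(1) by (simp add: power_int_minus field_simps)
    then show ?thesis using gap[of b n a] assms nonpos by simp
  qed
qed

lemma periodic_bounded:
  fixes f :: "int \<Rightarrow> int \<Rightarrow> int"
  assumes "c \<noteq> 0" "c' \<noteq> 0" "\<And>m n. f (m + c) n = f m n" "\<And>m n. f m (n + c') = f m n"
  shows "finite (range (\<lambda>(m, n). f m n))"
proof -
  have per: "g (n + k * c) = g n" if "\<And>n. g (n + c) = g n" for g :: "int \<Rightarrow> int" and n k c
  proof (induction k rule: int_induct[where k = 0])
    case (step1 i)
    then show ?case using that[of "n + i * c"] by (simp add: algebra_simps)
  next
    case (step2 i)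
    then show ?case using that[of "n + (i - 1) * c"] by (simp add: algebra_simps)
  qed simp
  have red: "\<exists>m'. \<bar>m'\<bar> \<le> \<bar>c\<bar> \<and> (\<forall>g. (\<forall>n. g (n + c) = g n) \<longrightarrow> g m = (g m' :: int))" if "c \<noteq> 0" for m c :: int
  proof (intro exI conjI allI impI)
    show "\<bar>m mod c\<bar> \<le> \<bar>c\<bar>" using abs_mod_less[OF that, of m] by simp
    fix g :: "int \<Rightarrow> int" assume "\<forall>n. g (n + c) = g n"
    then show "g m = g (m mod c)" using per[of g c "m mod c" "m div c"] by simp
  qed
  have "range (\<lambda>(m, n). f m n) \<subseteq> (\<lambda>(m, n). f m n) ` ({-\<bar>c\<bar>..\<bar>c\<bar>} \<times> {-\<bar>c'\<bar>..\<bar>c'\<bar>})"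
  proof clarify
    fix m n
    obtain m' where m': "\<bar>m'\<bar> \<le> \<bar>c\<bar>" "\<forall>g. (\<forall>n. g (n + c) = g n) \<longrightarrow> g m = (g m' :: int)"
      using red[OF assms(1), of m] by blast
    obtain n' where n': "\<bar>n'\<bar> \<le> \<bar>c'\<bar>" "\<forall>g. (\<forall>n. g (n + c') = g n) \<longrightarrow> g n = (g n' :: int)"
      using red[OF assms(2), of n] by blast
    have "f m n = f m' n'"
      using m'(2)[rule_format, of "\<lambda>k. f k n"] n'(2)[rule_format, of "f m'"] assms(3,4) by simp
    show "f m n \<in> (\<lambda>(m, n). f m n) ` ({-\<bar>c\<bar>..\<bar>c\<bar>} \<times> {-\<bar>c'\<bar>..\<bar>c'\<bar>})"
      using m'(1) n'(1) \<open>f m n = f m' n'\<close> by (intro image_eqI[of _ _ "(m', n')"]) auto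
  qed
  then show ?thesis by (rule finite_subset) simp
qed

text \<open>By \<open>exponential_gap\<close> in a suitable square, every absolute value of
  \<open>q\<close> is smaller than one of \<open>p\<close>, and conversely; a finite set of values
  would have no maximum.\<close>

lemma no_growing_grid:
  fixes p q :: "int \<Rightarrow> int \<Rightarrow> int"
  assumes nz: "\<And>m n. p m n \<noteq> 0" "\<And>m n. q m n \<noteq> 0"
    and fin: "finite (range (\<lambda>(m, n). p m n))" "finite (range (\<lambda>(m, n). q m n))"
    and same: "\<And>m n. even (m + n) \<Longrightarrow> q m n = q m (n + 1) \<and> real_of_int (p m n) = 2 powi q m n * real_of_int (p (m + 1) n)"
    and diff: "\<And>m n. odd (m + n) \<Longrightarrow> p m n = p (m + 1) n \<and> real_of_int (q m n) = 2 powi p m n * real_of_int (q m (n + 1))"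
  shows False
proof -
  have q_less: "\<exists>m' n'. \<bar>q m n\<bar> < \<bar>p m' n'\<bar>" for m n
  proof (cases "even (m + n)")
    case True
    then show ?thesis using exponential_gap[of "p m n" "q m n" "p (m + 1) n"] same nz by blast
  next
    case False
    \<comment> \<open>The square below has the other parity and the same \<open>q\<close>.\<close>
    then have "even (m + (n - 1))" by simp
    then show ?thesis using exponential_gap[of "p m (n - 1)" "q m (n - 1)" "p (m + 1) (n - 1)"]
        same[of m "n - 1"] nz by fastforce
  qed
  have p_less: "\<exists>m' n'. \<bar>p m n\<bar> < \<bar>q m' n'\<bar>" for m n
  proof (cases "even (m + n)")
    case False
    then show ?thesis using exponential_gap[of "q m n" "p m n" "q m (n + 1)"] diff nz by blast
  next
    case True
    then have "odd ((m - 1) + n)" by simp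
    then show ?thesis using exponential_gap[of "q (m - 1) n" "p (m - 1) n" "q (m - 1) (n + 1)"]
        diff[of "m - 1" n] nz by fastforce
  qed
  define V where "V = abs ` (range (\<lambda>(m, n). p m n) \<union> range (\<lambda>(m, n). q m n))"
  have "finite V" "V \<noteq> {}" using fin by (auto simp: V_def)
  then have "Max V \<in> V" by (rule Max_in)
  moreover have "\<exists>w\<in>V. v < w" if vV: "v \<in> V" for v
  proof -
    consider m n where "v = \<bar>p m n\<bar>" | m n where "v = \<bar>q m n\<bar>" using vV unfolding V_def by fast
    then show ?thesis
    proof cases
      case 1
      then obtain m' n' where "v < \<bar>q m' n'\<bar>" using p_less by blast
      then show ?thesis by (intro bexI[of _ "\<bar>q m' n'\<bar>"]) (auto simp: V_def)
    next
      case 2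
      then obtain m' n' where "v < \<bar>p m' n'\<bar>" using q_less by blast
      then show ?thesis by (intro bexI[of _ "\<bar>p m' n'\<bar>"]) (auto simp: V_def)
    qed
  qed
  ultimately show False using Max_ge[OF \<open>finite V\<close>] by (metis not_le)
qed

text \<open>If \<open>x\<close> fixes the line \<open>L\<close> of one tree and translates the line \<open>L'\<close> of the other one, the product
  of \<open>L\<close> and \<open>L'\<close> is tiled by squares with trivial stabilizers, labelled by elements \<open>h m n\<close>.
  Neighbouring labels differ by powers \<open>q m n\<close> and \<open>p m n\<close> of generators; the relations of \<open>H\<close> force
  these exponents to grow, which is impossible when the tiling is doubly periodic.\<close>

lemma no_periodic_flat:
  assumes L: "T.line i L" "\<And>n. snd (L n) \<longleftrightarrow> even n" and L': "T.line (i + 1) L'" "\<And>n. snd (L' n) \<longleftrightarrow> even n"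
    and x: "\<And>m. T.cdist i (T.cact x (L m)) (L m) = 0"
      "\<And>n. T.cdist (i + 1) (T.cact x (L' n)) (L' (n + c')) = 0" "c' \<noteq> 0"
    and y: "\<And>n. T.cdist (i + 1) (T.cact y (L' n)) (L' n) = 0"
      "\<And>m. T.cdist i (T.cact y (L m)) (L (m + c)) = 0" "c \<noteq> 0"
  shows False
proof -
  let ?d = "T.cdist i" and ?d' = "T.cdist (i + 1)"
  \<comment> \<open>\<open>h\<close> labels the square of the edges from \<open>L m\<close> to
    \<open>L (m + 1)\<close> and from \<open>L' n\<close> to \<open>L' (n + 1)\<close>: its cosets
    are the endpoints of both edges. The type of \<open>L m\<close> is \<open>even m\<close>, that
    of \<open>L (m + 1)\<close> is \<open>odd m\<close>.\<close>
  define P where "P h m n \<longleftrightarrow> ?d (h, even m) (L m) = 0 \<and> ?d (h, odd m) (L (m + 1)) = 0 \<and>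
    ?d' (h, even n) (L' n) = 0 \<and> ?d' (h, odd n) (L' (n + 1)) = 0" for h m n
  have ex: "\<exists>h. P h m n" for m n
  proof -
    have "?d (L m) (L (m + 1)) = 1" using T.lineD[OF L(1), of m "m + 1"] by simp
    then obtain g b where g: "?d (g, b) (L m) = 0" "?d (g, \<not> b) (L (m + 1)) = 0" using T.common_edge by blast
    have b: "b = even m" using T.cdist_even[of i "(g, b)" "L m"] g(1) L(2) by simp
    have fixd: "?d (g, b) (T.cact x (g, b)) = 0" "?d (g, \<not> b) (T.cact x (g, \<not> b)) = 0"
      using T.fixed_transfer[OF g(1)] T.fixed_transfer[OF g(2)] x(1) by (simp_all add: T.d_sym)
    then have "- g + x + g \<in> As i \<inter> As (i + 2)" unfolding T.fix_iff by (cases b) (simp_all add: AA_def)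
    then have "- g + x + g \<in> Fs i" by (simp add: AA_Int)
    \<comment> \<open>\<open>x\<close> is in the stabilizer of the edge of \<open>L\<close>, a
      conjugate of \<open>Fs i\<close>, and translates \<open>L'\<close>; so \<open>L'\<close> lies
      in the span of \<open>g + Fs i\<close>, and the label can be corrected by an element of
      \<open>Fs i\<close>.\<close>
    then obtain q b' where q: "q \<in> Fs i" "?d' (g + q, b') (L' n) = 0" "?d' (g + q, \<not> b') (L' (n + 1)) = 0"
      using T.axis_in_span[OF span_Fs _ L'(1) x(2,3), of g n] by blast
    have b': "b' = even n" using T.cdist_even[of "i + 1" "(g + q, b')" "L' n"] q(2) L'(2) by simp
    have "?d (g + q, e) (g, e) = 0" for e
      using q(1) Bs_subset(3)[of i] Bs_subset(4)[of i] subgrpD(3)[OF subgrp_G(6)]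
      unfolding T.cdist_0_iff by (auto simp: AA_def minus_add add.assoc simp del: add_uminus_conv_diff)
    then have "?d (g + q, b) (L m) = 0" "?d (g + q, \<not> b) (L (m + 1)) = 0"
      using g T.d_zero_trans by blast+
    then have "P (g + q) m n" using q(2,3) b b' by (simp add: P_def)
    then show ?thesis by blast
  qed
  have diffA: "- h + h' \<in> AA i b" if "?d (h, b) v = 0" "?d (h', b) v = 0" for h h' b v
    using T.d_zero_join[OF that] unfolding T.cdist_0_iff by simp
  have diffA': "- h + h' \<in> AA (i + 1) b" if "?d' (h, b) v = 0" "?d' (h', b) v = 0" for h h' b v
    using T.d_zero_join[OF that] unfolding T.cdist_0_iff by simp
  have in_Fs: "u \<in> Fs i" if "u \<in> AA i b" "u \<in> AA i (\<not> b)" for u b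
    using that AA_Int[of i] by (cases b) (auto simp: AA_def)
  have in_Fs': "u \<in> Fs (i + 1)" if "u \<in> AA (i + 1) b" "u \<in> AA (i + 1) (\<not> b)" for u b
    using that AA_Int[of "i + 1"] by (cases b) (auto simp: AA_def)
  have uniq: "h = h'" if "P h m n" "P h' m n" for h h' m n
  proof -
    have "- h + h' \<in> Fs i" using that unfolding P_def by (intro in_Fs[of _ "even m"] diffA) auto
    moreover have "- h + h' \<in> Fs (i + 1)" using that unfolding P_def by (intro in_Fs'[of _ "even n"] diffA') auto
    ultimately have "- h + h' = 0" using Fs_Int by blast
    then show ?thesis by (simp add: neg_eq_iff_add_eq_0[symmetric])
  qed
  obtain h where h: "\<And>m n. P (h m n) m n" using ex by metis
  \<comment> \<open>The squares at \<open>(m, n)\<close> and \<open>(m + 1, n)\<close> share the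
    vertex \<open>L (m + 1)\<close> and an edge of \<open>L'\<close>. Their labels differ by an
    element of a vertex group of one tree and of the edge group of the other; the intersection is
    cyclic, generated by \<open>\<alpha> m\<close>. Likewise for \<open>\<beta> n\<close>.\<close>
  define \<alpha> where "\<alpha> m = ha (if odd m then i + 1 else i + 3)" for m :: int
  define \<beta> where "\<beta> n = ha (if odd n then i + 2 else i)" for n :: int
  have "\<exists>q. h (m + 1) n = h m n + zmul q (\<alpha> m)" for m n
  proof -
    let ?u = "- h m n + h (m + 1) n"
    have "?u \<in> AA i (odd m)" using h[of m n] h[of "m + 1" n] unfolding P_def by (intro diffA) auto
    moreover have "?u \<in> Fs (i + 1)"
      using h[of m n] h[of "m + 1" n] unfolding P_def by (intro in_Fs'[of _ "even n"] diffA') auto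
    ultimately have "?u \<in> Zs (if odd m then i + 1 else i + 3)"
      using Fs_Int_As[of i] by (auto simp: AA_def split: if_splits)
    then obtain q where "?u = zmul q (\<alpha> m)" unfolding Zs_iff \<alpha>_def by blast
    then show ?thesis by (metis add_minus_cancel)
  qed
  then obtain q where q: "\<And>m n. h (m + 1) n = h m n + zmul (q m n) (\<alpha> m)" by metis
  have "\<exists>p. h m (n + 1) = h m n + zmul p (\<beta> n)" for m n
  proof -
    let ?u = "- h m n + h m (n + 1)"
    have "?u \<in> AA (i + 1) (odd n)" using h[of m n] h[of m "n + 1"] unfolding P_def by (intro diffA') auto
    moreover have "?u \<in> Fs i"
      using h[of m n] h[of m "n + 1"] unfolding P_def by (intro in_Fs[of _ "even m"] diffA) auto
    ultimately have "?u \<in> Zs (if odd n then i + 2 else i)"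
      using Fs_Int_AA[of i] by (cases "odd n") auto
    then obtain p where "?u = zmul p (\<beta> n)" unfolding Zs_iff \<beta>_def by blast
    then show ?thesis by (metis add_minus_cancel)
  qed
  then obtain p where p: "\<And>m n. h m (n + 1) = h m n + zmul (p m n) (\<beta> n)" by metis
  have q0: "q m n \<noteq> 0" for m n
  proof
    assume "q m n = 0"
    then have "h (m + 1) n = h m n" using q by simp
    then have "?d (h m n, even m) (L (m + 2)) = 0" "?d (h m n, even m) (L m) = 0"
      using h[of m n] h[of "m + 1" n] unfolding P_def by (auto simp: add.assoc)
    then have "?d (L m) (L (m + 2)) = 0" using T.d_zero(1) by metis
    then show False using T.lineD[OF L(1), of m "m + 2"] by simp
  qed
  have p0: "p m n \<noteq> 0" for m n
  proof
    assume "p m n = 0"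
    then have "h m (n + 1) = h m n" using p by simp
    then have "?d' (h m n, even n) (L' (n + 2)) = 0" "?d' (h m n, even n) (L' n) = 0"
      using h[of m n] h[of m "n + 1"] unfolding P_def by (auto simp: add.assoc)
    then have "?d' (L' n) (L' (n + 2)) = 0" using T.d_zero(1) by metis
    then show False using T.lineD[OF L'(1), of n "n + 2"] by simp
  qed
  \<comment> \<open>The two ways from \<open>h m n\<close> to
    \<open>h (m + 1) (n + 1)\<close>.\<close>
  have rect: "zmul (q m n) (\<alpha> m) + zmul (p (m + 1) n) (\<beta> n) = zmul (p m n) (\<beta> n) + zmul (q m (n + 1)) (\<alpha> m)" for m n
  proof -
    have "h m n + (zmul (q m n) (\<alpha> m) + zmul (p (m + 1) n) (\<beta> n)) = h (m + 1) (n + 1)"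
      unfolding p q by (simp add: add.assoc)
    also have "\<dots> = h m n + (zmul (p m n) (\<beta> n) + zmul (q m (n + 1)) (\<alpha> m))"
      unfolding q[of m "n + 1"] unfolding p by (simp add: add.assoc)
    finally show ?thesis by simp
  qed
  have ev: "even c" "even c'"
    using T.cdist_even[of i "T.cact y (L 0)" "L (0 + c)"] y(2)[of 0] L(2)[of 0] L(2)[of c]
      T.cdist_even[of "i + 1" "T.cact x (L' 0)" "L' (0 + c')"] x(2)[of 0] L'(2)[of 0] L'(2)[of c']
    by (auto simp: T.cact_def)
  have move: "d (g + h, e) v' = 0"
    if "d = T.cdist j" "d (h, e) v = 0" "d (T.cact g v) v' = 0" for d j g h e v v'
  proof -
    have "T.cdist j (T.cact g (h, e)) (T.cact g v) = 0" using that by simp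
    then show ?thesis using that T.d_zero_trans by (simp add: T.cact_def)
  qed
  have hx: "h m (n + c') = x + h m n" for m n
  proof (rule uniq[OF h])
    have "?d (x + h m n, even m) (L m) = 0" "?d (x + h m n, odd m) (L (m + 1)) = 0"
      "?d' (x + h m n, even n) (L' (n + c')) = 0" "?d' (x + h m n, odd n) (L' (n + 1 + c')) = 0"
      using h[of m n] x(1,2) move[OF HOL.refl] unfolding P_def by blast+
    then show "P (x + h m n) m (n + c')" using ev unfolding P_def by (simp add: algebra_simps)
  qed
  have hy: "h (m + c) n = y + h m n" for m n
  proof (rule uniq[OF h])
    have "?d' (y + h m n, even n) (L' n) = 0" "?d' (y + h m n, odd n) (L' (n + 1)) = 0"
      "?d (y + h m n, even m) (L (m + c)) = 0" "?d (y + h m n, odd m) (L (m + 1 + c)) = 0"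
      using h[of m n] y(1,2) move[OF HOL.refl] unfolding P_def by blast+
    then show "P (y + h m n) (m + c) n" using ev unfolding P_def by (simp add: algebra_simps)
  qed
  have \<alpha>\<beta>: "\<alpha> (m + c) = \<alpha> m" "\<beta> (n + c') = \<beta> n" for m n
    using ev by (simp_all add: \<alpha>_def \<beta>_def)
  have \<alpha>_inj: "k = l" if "zmul k (\<alpha> m) = zmul l (\<alpha> m)" for k l m
    using that zmul_ha_inj unfolding \<alpha>_def by blast
  have \<beta>_inj: "k = l" if "zmul k (\<beta> m) = zmul l (\<beta> m)" for k l m
    using that zmul_ha_inj unfolding \<beta>_def by blast
  have per_q: "q (m + c) n = q m n" "q m (n + c') = q m n" for m n
  proof -
    have "y + h m n + zmul (q (m + c) n) (\<alpha> m) = y + h m n + zmul (q m n) (\<alpha> m)"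
      using q[of "m + c" n] q[of m n] hy[of m n] hy[of "m + 1" n] \<alpha>\<beta>(1)[of m]
      by (simp add: add.assoc add.commute[of 1] add.left_commute[of 1])
    then show "q (m + c) n = q m n" using \<alpha>_inj by simp
    have "x + h m n + zmul (q m (n + c')) (\<alpha> m) = x + h m n + zmul (q m n) (\<alpha> m)"
      using q[of m "n + c'"] q[of m n] hx[of m n] hx[of "m + 1" n] by (simp add: add.assoc)
    then show "q m (n + c') = q m n" using \<alpha>_inj by simp
  qed
  have per_p: "p (m + c) n = p m n" "p m (n + c') = p m n" for m n
  proof -
    have "x + h m n + zmul (p m (n + c')) (\<beta> n) = x + h m n + zmul (p m n) (\<beta> n)"
      using p[of m "n + c'"] p[of m n] hx[of m n] hx[of m "n + 1"] \<alpha>\<beta>(2)[of n]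
      by (simp add: add.assoc add.commute[of 1] add.left_commute[of 1])
    then show "p m (n + c') = p m n" using \<beta>_inj by simp
    have "y + h m n + zmul (p (m + c) n) (\<beta> n) = y + h m n + zmul (p m n) (\<beta> n)"
      using p[of "m + c" n] p[of m n] hy[of m n] hy[of m "n + 1"] by (simp add: add.assoc)
    then show "p (m + c) n = p m n" using \<beta>_inj by simp
  qed
  show False
  proof (rule no_growing_grid[of p q])
    show "p m n \<noteq> 0" "q m n \<noteq> 0" for m n by (rule p0 q0)+
    show "finite (range (\<lambda>(m, n). p m n))" "finite (range (\<lambda>(m, n). q m n))"
      by (rule periodic_bounded[OF y(3) x(3)]; rule per_p per_q)+
    show "q m n = q m (n + 1) \<and> real_of_int (p m n) = 2 powi q m n * real_of_int (p (m + 1) n)"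
      if "even (m + n)" for m n
    proof (cases "odd m")
      case True
      then show ?thesis using that rect[of m n] rectangle[of "q m n" "i + 1"]
        by (simp add: \<alpha>_def \<beta>_def four_plus)
    next
      case False
      then show ?thesis using that rect[of m n] rectangle[of "q m n" "i + 3"]
        by (simp add: \<alpha>_def \<beta>_def four_plus)
    qed
    show "p m n = p (m + 1) n \<and> real_of_int (q m n) = 2 powi p m n * real_of_int (q m (n + 1))"
      if "odd (m + n)" for m n
    proof (cases "odd m")
      case True
      then show ?thesis using that rect[of m n, symmetric] rectangle[of "p m n" i]
        by (simp add: \<alpha>_def \<beta>_def)
    next
      case False
      then show ?thesis using that rect[of m n, symmetric] rectangle[of "p m n" "i + 2"]
        by (simp add: \<alpha>_def \<beta>_def four_plus)
    qed
  qed
qed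

subsection \<open>Subgroups of the affine group\<close>

fun slope :: "aff \<Rightarrow> int" where "slope (Aff k q) = k"
fun shift :: "aff \<Rightarrow> real" where "shift (Aff k q) = q"
fun aff_act :: "aff \<Rightarrow> real \<Rightarrow> real" where "aff_act (Aff k q) z = 2 powi k * z + q"

lemma slope_shift_add: "slope (f + g) = slope f + slope g" "shift (f + g) = shift f + 2 powi slope f * shift g"
  by (cases f; cases g; simp)+

lemma aff_act_add: "aff_act (f + g) z = aff_act f (aff_act g z)"
  by (cases f; cases g) (simp add: power_int_add algebra_simps)

lemma aff_act_0: "aff_act 0 z = z"
  by (simp add: zero_aff_def)

text \<open>Two contractions by a factor at most \<open>1 / 2\<close> map the open interval between their fixed points into
  disjoint subintervals.\<close>

lemma contractions_free:
  assumes u: "\<And>z. aff_act u z = x0 + r * (z - x0)" and v: "\<And>z. aff_act v z = x1 + r * (z - x1)"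
    and r: "0 < r" "r \<le> 1 / 2" and ne: "x0 \<noteq> x1"
  shows "free_pair u v"
proof -
  define pt where "pt \<tau> = x0 + \<tau> * (x1 - x0)" for \<tau>
  have pt_inj: "pt \<sigma> = pt \<tau> \<longleftrightarrow> \<sigma> = \<tau>" for \<sigma> \<tau> using ne by (simp add: pt_def)
  have ua: "aff_act u (pt \<tau>) = pt (r * \<tau>)" for \<tau>
    unfolding u pt_def by (simp add: algebra_simps)
  have va: "aff_act v (pt \<tau>) = pt (1 - r * (1 - \<tau>))" for \<tau>
    unfolding v pt_def by (simp add: algebra_simps)
  show ?thesis
  proof (rule free_pair_pingpong[where act = aff_act and U = "pt ` {0<..<r}" and V = "pt ` {1 - r<..<1}" and p = "pt (r / 2)"])
    show "pt ` {0<..<r} \<inter> pt ` {1 - r<..<1} = {}" using r by (auto simp: pt_inj)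
    show "pt (r / 2) \<in> pt ` {0<..<r} \<union> pt ` {1 - r<..<1}" using r by auto
    have *: "\<exists>\<tau>. z = pt \<tau> \<and> 0 < \<tau> \<and> \<tau> < 1" if "z \<in> pt ` {0<..<r} \<union> pt ` {1 - r<..<1}" for z
      using that r by fastforce
    show "aff_act u z \<in> pt ` {0<..<r}" if z: "z \<in> pt ` {0<..<r} \<union> pt ` {1 - r<..<1}" for z
    proof -
      obtain \<tau> where "z = pt \<tau>" "0 < \<tau>" "\<tau> < 1" using *[OF z] by blast
      then show ?thesis using r ua by (intro image_eqI[of _ _ "r * \<tau>"]) auto
    qed
    show "aff_act v z \<in> pt ` {1 - r<..<1}" if z: "z \<in> pt ` {0<..<r} \<union> pt ` {1 - r<..<1}" for z
    proof -
      obtain \<tau> where "z = pt \<tau>" "0 < \<tau>" "\<tau> < 1" using *[OF z] by blast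
      then show ?thesis using r va by (intro image_eqI[of _ _ "1 - r * (1 - \<tau>)"]) auto
    qed
  qed (simp_all add: aff_act_add aff_act_0)
qed

text \<open>Translations with dyadic shifts have a common denominator 2^M and generate a cyclic
  group. Otherwise some s in \<open>S\<close>, up to inversion, contracts towards a point
  \<open>x0\<close>. If all of \<open>S\<close> fixes \<open>x0\<close>, the slope is injective on
  the group; if t moves \<open>x0\<close>, then s and t + s - t contract by the same factor towards
  different points.\<close>

lemma affine_alternative:
  fixes S :: "'g::group_add set" and f :: "'g \<Rightarrow> aff"
  assumes S: "finite S"
    and f: "\<And>x y. x \<in> gen S \<Longrightarrow> y \<in> gen S \<Longrightarrow> f (x + y) = f x + f y"
    and inj: "\<And>x. x \<in> gen S \<Longrightarrow> f x = 0 \<Longrightarrow> x = 0"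
    and dyadic: "\<And>s. s \<in> S \<Longrightarrow> \<exists>N m. shift (f s) * 2 ^ N = of_int m"
  shows "short_free_pair S \<or> (\<exists>x\<in>gen S. gen S = range (\<lambda>k. zmul k x))"
proof -
  note gc = subgrpD[OF subgrp_gen[of S]]
  have f0: "f 0 = 0" using f[of 0 0] gc(1) add_left_cancel[of "f 0" "f 0" 0] by simp
  have fm: "f (- x) = - f x" if "x \<in> gen S" for x
    using f[of "- x" x] gc(3)[OF that] that f0 by (simp add: eq_neg_iff_add_eq_0)
  show ?thesis
  proof (cases "\<forall>s\<in>S. slope (f s) = 0")
    case True
    obtain N where N: "\<And>s. s \<in> S \<Longrightarrow> \<exists>m. shift (f s) * 2 ^ N s = of_int m" using dyadic by metis
    define M where "M = sum N S"
    define E where "E = {x \<in> gen S. slope (f x) = 0 \<and> shift (f x) * 2 ^ M \<in> \<int>}"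
    have "subgrp E"
      unfolding subgrp_def
    proof (intro conjI ballI)
      show "0 \<in> E" using gc(1) by (simp add: E_def f0 zero_aff_def)
      show "x + y \<in> E" if "x \<in> E" "y \<in> E" for x y
        using that gc(2) by (simp add: E_def f slope_shift_add distrib_right)
      show "- x \<in> E" if "x \<in> E" for x
        using that gc(3) fm[of x] by (cases "f x") (simp add: E_def)
    qed
    moreover have "S \<subseteq> E"
    proof
      fix s assume s: "s \<in> S"
      obtain m where m: "shift (f s) * 2 ^ N s = of_int m" using N[OF s] by blast
      have "M = N s + sum N (S - {s})" unfolding M_def using S s by (simp add: sum.remove)
      then have "shift (f s) * 2 ^ M = of_int m * 2 ^ sum N (S - {s})"
        unfolding m[symmetric] by (simp add: power_add)
      then show "s \<in> E" using True s by (simp add: E_def gen.base)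
    qed
    ultimately have E: "gen S \<subseteq> E" by (rule gen_minimal)
    define c where "c x = \<lfloor>shift (f x) * 2 ^ M\<rfloor>" for x
    have c: "of_int (c x) = shift (f x) * 2 ^ M" if "x \<in> gen S" for x
      using E that by (auto simp: c_def E_def elim!: Ints_cases)
    have "\<exists>x\<in>gen S. gen S = range (\<lambda>k. zmul k x)"
    proof (rule cyclic_if_int_valued[OF subgrp_gen])
      show "c (x + y) = c x + c y" if xy: "x \<in> gen S" "y \<in> gen S" for x y
      proof -
        have "slope (f x) = 0" using E xy by (auto simp: E_def)
        then have "real_of_int (c (x + y)) = real_of_int (c x + c y)"
          using c xy gc(2)[OF xy] by (simp add: f slope_shift_add distrib_right)
        then show ?thesis by (simp only: of_int_eq_iff)
      qed
      show "x = 0" if x: "x \<in> gen S" "c x = 0" for x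
      proof -
        have "shift (f x) = 0" using c[OF x(1)] x(2) by simp
        moreover have "slope (f x) = 0" using E x by (auto simp: E_def)
        ultimately have "f x = 0" by (cases "f x") (simp add: zero_aff_def)
        then show ?thesis using inj x(1) by blast
      qed
    qed
    then show ?thesis ..
  next
    case False
    then obtain s0 where s0: "s0 \<in> S" "slope (f s0) \<noteq> 0" by blast
    define s where "s = (if slope (f s0) < 0 then s0 else - s0)"
    have s: "s \<in> gen S" "s \<in> word_ball S 1"
      using word_ball_base[OF s0(1)] word_ball_uminus[OF word_ball_base[OF s0(1)]]
        gen.base[OF s0(1)] gc(3)[OF gen.base[OF s0(1)]] by (auto simp: s_def)
    obtain k q where kq: "f s = Aff k q" by (cases "f s")
    have "slope (f s) < 0"
      using s0 fm[OF gen.base[OF s0(1)]] by (cases "f s0") (auto simp: s_def)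
    then have k: "k < 0" by (simp add: kq)
    define r where "r = (2::real) powi k"
    have r: "0 < r" "r \<le> 1 / 2"
    proof -
      obtain n where n: "k = - int (Suc n)" using k by (cases k) auto
      have r: "r = inverse (2 ^ Suc n)" unfolding r_def n by (simp only: power_int_minus power_int_of_nat)
      have "(1::real) \<le> 2 ^ n" by simp
      then have "inverse (2 ^ Suc n) \<le> (1 / 2 :: real)" by (simp add: field_simps)
      then show "0 < r" "r \<le> 1 / 2" unfolding r by simp_all
    qed
    define x0 where "x0 = q / (1 - r)"
    have "x0 * (1 - r) = q" using r by (simp add: x0_def)
    then have q: "q = x0 - r * x0" by (simp add: algebra_simps)
    have s_act: "aff_act (f s) z = x0 + r * (z - x0)" for z
      by (simp add: kq r_def[symmetric] q algebra_simps)
    show ?thesis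
    proof (cases "\<forall>t\<in>S. aff_act (f t) x0 = x0")
      case True
      define E where "E = {x \<in> gen S. aff_act (f x) x0 = x0}"
      have "subgrp E"
        unfolding subgrp_def
      proof (intro conjI ballI)
        show "0 \<in> E" using gc(1) by (simp add: E_def f0 aff_act_0)
        show "x + y \<in> E" if "x \<in> E" "y \<in> E" for x y
          using that gc(2) by (simp add: E_def f aff_act_add)
        show "- x \<in> E" if "x \<in> E" for x
        proof -
          have "aff_act (- f x) (aff_act (f x) x0) = x0" by (simp add: aff_act_0 flip: aff_act_add)
          then show ?thesis using that gc(3) fm[of x] by (simp add: E_def)
        qed
      qed
      moreover have "S \<subseteq> E" using True by (auto simp: E_def intro: gen.base)
      ultimately have E: "gen S \<subseteq> E" by (rule gen_minimal)
      have "\<exists>x\<in>gen S. gen S = range (\<lambda>k. zmul k x)"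
      proof (rule cyclic_if_int_valued[OF subgrp_gen, of S "slope \<circ> f"])
        show "(slope \<circ> f) (x + y) = (slope \<circ> f) x + (slope \<circ> f) y" if "x \<in> gen S" "y \<in> gen S" for x y
          using that by (simp add: f slope_shift_add)
        show "x = 0" if x: "x \<in> gen S" "(slope \<circ> f) x = 0" for x
        proof -
          have "aff_act (f x) x0 = x0" using E x by (auto simp: E_def)
          then have "f x = 0" using x(2) by (cases "f x") (simp add: zero_aff_def)
          then show ?thesis using inj x(1) by blast
        qed
      qed
      then show ?thesis ..
    next
      case False
      then obtain t where t: "t \<in> S" "aff_act (f t) x0 \<noteq> x0" by blast
      have tg: "t \<in> gen S" using t(1) by (rule gen.base)
      define x1 where "x1 = aff_act (f t) x0"
      define v where "v = t + s + - t"
      have v: "v \<in> gen S" unfolding v_def by (intro gc(2,3) tg s)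
      have "v \<in> word_ball S (1 + 1 + 1)"
        unfolding v_def
        by (rule word_ball_add[OF word_ball_add[OF word_ball_base[OF t(1)] s(2)]
              word_ball_uminus[OF word_ball_base[OF t(1)]]])
      then have v4: "v \<in> word_ball S 4" using word_ball_mono[of "1 + 1 + 1" 4 S] by auto
      have s4: "s \<in> word_ball S 4" using s(2) word_ball_mono[of 1 4 S] by auto
      have fv: "f v = f t + f s + - f t"
        unfolding v_def using f[OF gc(2)[OF tg s(1)] gc(3)[OF tg]] f[OF tg s(1)] fm[OF tg] by simp
      have v_act: "aff_act (f v) z = x1 + r * (z - x1)" for z
      proof -
        obtain l p where lp: "f t = Aff l p" by (cases "f t")
        define a where "a = (2::real) powi l"
        have a: "a \<noteq> 0" by (simp add: a_def)
        have inv: "aff_act (- f t) z = (z - p) / a"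
          unfolding lp by (simp add: power_int_minus a_def[symmetric] field_simps a)
        show ?thesis
          unfolding fv aff_act_add inv s_act x1_def unfolding lp using a
          by (simp add: a_def[symmetric] field_simps)
      qed
      have "free_pair (f s) (f v)"
        using contractions_free[OF s_act v_act r] t(2) x1_def by auto
      moreover have "f (sum_list (map (\<lambda>b. if b then s else v) bs)) = sum_list (map (\<lambda>b. if b then f s else f v) bs)
          \<and> sum_list (map (\<lambda>b. if b then s else v) bs) \<in> gen S" for bs
        by (induction bs) (auto simp: f0 f s(1) v gc(1) intro: gc(2))
      ultimately have "free_pair s v" unfolding free_pair_def by metis
      then show ?thesis using s4 v4 unfolding short_free_pair_def by blast
    qed
  qed
qed

lemma conj_gen:
  assumes "subgrp Q" "\<And>s. s \<in> S \<Longrightarrow> - g + s + g \<in> Q" "x \<in> gen S"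
  shows "- g + x + g \<in> Q"
proof -
  have "subgrp {x. - g + x + g \<in> Q}"
  proof -
    have "- g + (x + y) + g = (- g + x + g) + (- g + y + g)" "- g + - x + g = - (- g + x + g)" for x y
      by (simp_all add: minus_add add.assoc del: add_uminus_conv_diff)
    then show ?thesis
      unfolding subgrp_def using subgrpD(1-3)[OF assms(1)] by simp
  qed
  then have "gen S \<subseteq> {x. - g + x + g \<in> Q}" using assms(2) by (intro gen_minimal) auto
  then show ?thesis using assms(3) by blast
qed

lemma Bs_alternative:
  fixes S :: "hig set"
  assumes S: "finite S" "\<And>s. s \<in> S \<Longrightarrow> - h + s + h \<in> Bs j"
  shows "short_free_pair S \<or> (\<exists>x\<in>gen S. gen S = range (\<lambda>k. zmul k x))"
proof -
  have conj: "- h + (x + y) + h = (- h + x + h) + (- h + y + h)" for x y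
    by (simp add: add.assoc)
  have ex: "\<exists>y. (- h + x + h, y) \<in> G2 j" if "x \<in> gen S" for x
    using conj_gen[OF subgrp_G(4) S(2) that] Bs_graph by blast
  define f where "f x = (SOME y. (- h + x + h, y) \<in> G2 j)" for x
  have f: "(- h + x + h, f x) \<in> G2 j" if "x \<in> gen S" for x
    unfolding f_def by (rule someI_ex[OF ex[OF that]])
  show ?thesis
  proof (rule affine_alternative[OF S(1), of f])
    fix x y assume xy: "x \<in> gen S" "y \<in> gen S"
    have "(- h + x + h, f x) + (- h + y + h, f y) \<in> G2 j" by (intro subgrpD(2)[OF subgrp_G(1)] f xy)
    then have "(- h + (x + y) + h, f x + f y) \<in> G2 j" unfolding conj by (simp add: plus_prod_def)
    then show "f (x + y) = f x + f y" using f[OF gen.add[OF xy]] G2_functional by blast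
  next
    fix x assume "x \<in> gen S" "f x = 0"
    then have "- h + x + h = 0" using f[of x] G2_snd_0 by simp
    then show "x = 0" by (rule conj_eq_0)
  next
    fix s assume "s \<in> S"
    then show "\<exists>N m. shift (f s) * 2 ^ N = of_int m"
      using f[of s] G2_dyadic[of "- h + s + h" "slope (f s)" "shift (f s)" j] gen.base[of s S]
      by (cases "f s") auto
  qed
qed

subsection \<open>The alternative for finite subsets\<close>

lemma As_alternative:
  assumes S: "finite S" "\<And>s. s \<in> S \<Longrightarrow> - g + s + g \<in> As i"
  shows "short_free_pair S \<or> (\<exists>x\<in>gen S. gen S = range (\<lambda>k. zmul k x))"
  using S(1)
proof (rule T.tree_alternative[where S = S and i = "i + 1"])
  fix v assume "\<And>s. s \<in> S \<Longrightarrow> T.cdist (i + 1) v (T.cact s v) = 0"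
  then obtain h j where "\<And>s. s \<in> S \<Longrightarrow> - h + s + h \<in> Bs j"
    using fixed_fixed[of S g i v] S(2) by blast
  then show ?thesis using Bs_alternative S(1) by blast
next
  fix L x0 c
  assume L: "T.line (i + 1) L" "x0 \<in> gen S" "c > 0" "\<And>n. T.cdist (i + 1) (T.cact x0 (L n)) (L (n + c)) = 0"
    "\<And>s. s \<in> gen S \<Longrightarrow> T.preserves (i + 1) s L"
  have K: "- g + x + g \<in> As i" if "x \<in> gen S" for x
    using conj_gen[OF subgrp_G(6) S(2) that] by blast
  have "\<exists>x\<in>gen S. gen S = range (\<lambda>k. zmul k x)"
  proof (rule cyclic_if_faithful_on_line[OF subgrp_gen L(1,5)])
    fix x assume x: "x \<in> gen S" "\<And>n. T.cdist (i + 1) (T.cact x (L n)) (L n) = 0"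
    show "x = 0" by (rule fixed_line[OF K L(1,2,4) _ x]) (use L(3) in auto)
  qed auto
  then show ?thesis ..
qed auto

lemma nontrivial_on_line:
  assumes "subgrp K" "T.line i L" "\<And>k. k \<in> K \<Longrightarrow> T.preserves i k L"
    and "\<not> (\<exists>x\<in>K. K = range (\<lambda>k. zmul k x))"
  shows "\<exists>x\<in>K. x \<noteq> 0 \<and> (\<forall>n. T.cdist i (T.cact x (L n)) (L n) = 0)"
proof (rule ccontr)
  assume n: "\<not> ?thesis"
  have "\<exists>x\<in>K. K = range (\<lambda>k. zmul k x)"
  proof (rule cyclic_if_faithful_on_line[OF assms(1,2,3)])
    fix x assume "x \<in> K" "\<And>n. T.cdist i (T.cact x (L n)) (L n) = 0"
    then show "x = 0" using n by blast
  qed auto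
  then show False using assms(4) by blast
qed

lemma line_normalize:
  assumes "T.line i L"
  obtains a where "T.line i (\<lambda>n. L (n + a))" "\<And>n. snd (L (n + a)) \<longleftrightarrow> even n"
proof -
  define a :: int where "a = (if snd (L 0) then 0 else 1)"
  have par: "snd (L m) = snd (L n) \<longleftrightarrow> even (m - n)" for m n
  proof -
    have "even (T.cdist i (L m) (L n)) \<longleftrightarrow> even (m - n)" using T.lineD[OF assms, of m n] by presburger
    then show ?thesis by (simp add: T.cdist_even)
  qed
  have "snd (L (n + a)) \<longleftrightarrow> even n" for n
    using par[of "n + a" 0] by (auto simp: a_def)
  moreover have "T.line i (\<lambda>n. L (n + a))" using assms by (simp add: T.line_def)
  ultimately show thesis using that by blast
qed

theorem higman_alternative:
  fixes S :: "hig set"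
  assumes S: "finite S"
  shows "short_free_pair S \<or> (\<exists>x\<in>gen S. gen S = range (\<lambda>k. zmul k x))"
proof -
  have fixed: ?thesis if "\<And>s. s \<in> S \<Longrightarrow> T.cdist j v (T.cact s v) = 0" for j v
  proof -
    obtain g b where v: "v = (g, b)" by fastforce
    have "- g + s + g \<in> As (if b then j else j + 2)" if "s \<in> S" for s
      using \<open>\<And>s. s \<in> S \<Longrightarrow> T.cdist j v (T.cact s v) = 0\<close>[OF that] unfolding v T.fix_iff by (cases b) (simp_all add: AA_def)
    then show ?thesis using As_alternative[OF S] by blast
  qed
  show ?thesis
    using S
  proof (rule T.tree_alternative[where S = S and i = 0])
    fix L1 g c1
    assume L1: "T.line 0 L1" "g \<in> gen S" "c1 > 0" "\<And>n. T.cdist 0 (T.cact g (L1 n)) (L1 (n + c1)) = 0"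
      "\<And>s. s \<in> gen S \<Longrightarrow> T.preserves 0 s L1"
    show ?thesis
      using S
    proof (rule T.tree_alternative[where S = S and i = 1])
      fix L2 g2 c2
      assume L2: "T.line 1 L2" "g2 \<in> gen S" "c2 > 0" "\<And>n. T.cdist 1 (T.cact g2 (L2 n)) (L2 (n + c2)) = 0"
        "\<And>s. s \<in> gen S \<Longrightarrow> T.preserves 1 s L2"
      show ?thesis
      proof (rule ccontr)
        assume "\<not> ?thesis"
        then have no': "\<not> (\<exists>x\<in>gen S. gen S = range (\<lambda>k. zmul k x))" by simp
        have "\<exists>x\<in>gen S. x \<noteq> 0 \<and> (\<forall>n. T.cdist 0 (T.cact x (L1 n)) (L1 n) = 0)"
          by (rule nontrivial_on_line[OF subgrp_gen L1(1)]) (use L1(5) no' in simp_all)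
        then obtain x where x: "x \<in> gen S" "x \<noteq> 0" "\<And>n. T.cdist 0 (T.cact x (L1 n)) (L1 n) = 0"
          by (elim bexE conjE) simp
        have "\<exists>y\<in>gen S. y \<noteq> 0 \<and> (\<forall>n. T.cdist 1 (T.cact y (L2 n)) (L2 n) = 0)"
          by (rule nontrivial_on_line[OF subgrp_gen L2(1)]) (use L2(5) no' in simp_all)
        then obtain y where y: "y \<in> gen S" "y \<noteq> 0" "\<And>n. T.cdist 1 (T.cact y (L2 n)) (L2 n) = 0"
          by (elim bexE conjE) simp
        have trivial: "z = 0"
          if "\<And>n. T.cdist 0 (T.cact z (L1 n)) (L1 n) = 0" "\<And>n. T.cdist 1 (T.cact z (L2 n)) (L2 n) = 0" for z
          using fixes_two_edges[of 0 "L1 0" "L1 1" z "L2 0" "L2 1"] that T.lineD[OF L1(1), of 0 1] T.lineD[OF L2(1), of 0 1]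
          by (simp add: T.d_sym)
        \<comment> \<open>A reflection is excluded because its double would act trivially on
          \<open>L\<close>; this is why the last premise speaks of \<open>z + z\<close>.\<close>
        have translates: "\<exists>c. c \<noteq> 0 \<and> (\<forall>n. T.cdist j (T.cact z (L n)) (L (n + c)) = 0)"
          if z: "T.line j L" "T.preserves j z L" "z \<noteq> 0"
            "\<And>w. w = z \<or> w = z + z \<Longrightarrow> (\<And>n. T.cdist j (T.cact w (L n)) (L n) = 0) \<Longrightarrow> w = 0" for j L z
        proof -
          obtain e c where ec: "e \<in> {1, -1}" "\<And>n. T.cdist j (T.cact z (L n)) (L (e * n + c)) = 0"
            using z(2) unfolding T.preserves_def by blast
          have e: "e = 1"
          proof (rule ccontr)
            assume "e \<noteq> 1"
            then have m: "e = -1" using ec(1) by simp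
            have "T.cdist j (T.cact (z + z) (L n)) (L n) = 0" for n
            proof -
              have "T.cdist j (T.cact z (T.cact z (L n))) (T.cact z (L (e * n + c))) = 0" using ec(2)[of n] by simp
              moreover have "T.cdist j (T.cact z (L (e * n + c))) (L n) = 0" using ec(2)[of "e * n + c"] m by simp
              ultimately show ?thesis unfolding T.act_add by (rule T.d_zero_trans)
            qed
            then have "z + z = 0" using z(4) by blast
            then show False using torsion_free z(3) by blast
          qed
          then have "c \<noteq> 0" using ec(2) z(3,4) by auto
          then show ?thesis using ec(2) e by auto
        qed
        have double: "T.cdist j (T.cact (z + z) (L n)) (L n) = 0"
          if "\<And>n. T.cdist j (T.cact z (L n)) (L n) = 0" for j z L and n :: int
        proof -
          have "T.cdist j (T.cact z (T.cact z (L n))) (T.cact z (L n)) = 0" using that by simp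
          then show ?thesis using that unfolding T.act_add by (rule T.d_zero_trans)
        qed
        have "\<exists>c. c \<noteq> 0 \<and> (\<forall>n. T.cdist 1 (T.cact x (L2 n)) (L2 (n + c)) = 0)"
        proof (rule translates[OF L2(1) L2(5)[OF x(1)] x(2)])
          fix w assume w: "w = x \<or> w = x + x" "\<And>n. T.cdist 1 (T.cact w (L2 n)) (L2 n) = 0"
          have "T.cdist 0 (T.cact w (L1 n)) (L1 n) = 0" for n using w(1) x(3) double[of 0 x L1 n] by auto
          then show "w = 0" using trivial w(2) by blast
        qed
        then obtain cx where cx: "cx \<noteq> 0" "\<And>n. T.cdist 1 (T.cact x (L2 n)) (L2 (n + cx)) = 0"
          by blast
        have "\<exists>c. c \<noteq> 0 \<and> (\<forall>n. T.cdist 0 (T.cact y (L1 n)) (L1 (n + c)) = 0)"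
        proof (rule translates[OF L1(1) L1(5)[OF y(1)] y(2)])
          fix w assume w: "w = y \<or> w = y + y" "\<And>n. T.cdist 0 (T.cact w (L1 n)) (L1 n) = 0"
          have "T.cdist 1 (T.cact w (L2 n)) (L2 n) = 0" for n using w(1) y(3) double[of 1 y L2 n] by auto
          then show "w = 0" using trivial w(2) by blast
        qed
        then obtain cy where cy: "cy \<noteq> 0" "\<And>n. T.cdist 0 (T.cact y (L1 n)) (L1 (n + cy)) = 0"
          by blast
        obtain a where a: "T.line 0 (\<lambda>n. L1 (n + a))" "\<And>n. snd (L1 (n + a)) \<longleftrightarrow> even n"
          using line_normalize[OF L1(1)] by blast
        obtain b where b: "T.line 1 (\<lambda>n. L2 (n + b))" "\<And>n. snd (L2 (n + b)) \<longleftrightarrow> even n"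
          using line_normalize[OF L2(1)] by blast
        show False
        proof (rule no_periodic_flat[of 0 "\<lambda>n. L1 (n + a)" "\<lambda>n. L2 (n + b)" x cx y cy])
          show "T.cdist (0 + 1) (T.cact x (L2 (n + b))) (L2 (n + cx + b)) = 0" for n
            using cx(2)[of "n + b"] by (simp add: algebra_simps)
          show "T.cdist 0 (T.cact y (L1 (m + a))) (L1 (m + cy + a)) = 0" for m
            using cy(2)[of "m + a"] by (simp add: algebra_simps)
        qed (use a b x(3) y(3) cx(1) cy(1) in auto)
      qed
    qed (use fixed in auto)
  qed (use fixed in auto)
qed

section \<open>Growth\<close>

text \<open>Needed because \<open>growth_rate\<close> is a \<open>lim\<close>, which can be
  estimated only once convergence is known. The limit is the infimum: take \<open>k\<close> with
  quotient close to it and divide n by \<open>k\<close> with remainder.\<close>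

lemma fekete:
  fixes b :: "nat \<Rightarrow> real"
  assumes sub: "\<And>m n. b (m + n) \<le> b m + b n" and nonneg: "\<And>n. 0 \<le> b n"
  shows "convergent (\<lambda>n. b n / real n)"
proof -
  define A where "A = (\<lambda>n. b n / real n) ` {1..}"
  define L where "L = Inf A"
  have A: "A \<noteq> {}" "bdd_below A"
    using nonneg by (auto simp: A_def intro!: bdd_belowI[of _ 0])
  have mult: "b (q * k + r) \<le> real q * b k + b r" for q k r
  proof (induction q)
    case (Suc q)
    have "b (Suc q * k + r) \<le> b k + b (q * k + r)" using sub[of k "q * k + r"] by (simp add: add.assoc)
    then show ?case using Suc by (simp add: algebra_simps)
  qed simp
  have "(\<lambda>n. b n / real n) \<longlonglongrightarrow> L"
  proof (rule LIMSEQ_I)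
    fix e :: real assume e: "0 < e"
    have "\<exists>x\<in>A. x < L + e / 2"
      using cInf_lessD[of A "L + e / 2"] A(1) e unfolding L_def by auto
    then obtain k where k: "k \<ge> 1" "b k / real k < L + e / 2" by (auto simp: A_def)
    define C where "C = sum b {..<k}"
    have C: "b r \<le> C" if "r < k" for r
      unfolding C_def using that nonneg by (intro member_le_sum) auto
    obtain N where N: "N \<ge> 1" "C / real N < e / 2"
    proof -
      obtain N where "C / (e / 2) < real N" using reals_Archimedean2 by blast
      then have "C < real (Suc N) * (e / 2)" using e by (simp add: field_simps)
      then show thesis using that[of "Suc N"] by (simp add: field_simps)
    qed
    show "\<exists>N. \<forall>n\<ge>N. norm (b n / real n - L) < e"
    proof (intro exI allI impI)
      fix n assume n: "n \<ge> N"
      have n1: "real n > 0" using n N(1) by simp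
      have Cn: "0 \<le> C" using nonneg by (simp add: C_def sum_nonneg)
      have "b n \<le> real (n div k) * b k + b (n mod k)" using mult[of "n div k" k "n mod k"] by simp
      also have "b (n mod k) \<le> C" using C k(1) by simp
      also have "real (n div k) * b k \<le> (real n / real k) * b k"
      proof (rule mult_right_mono[OF _ nonneg])
        have "real (n div k) * real k \<le> real n" by (metis of_nat_mult of_nat_le_iff div_times_less_eq_dividend)
        then show "real (n div k) \<le> real n / real k" using k(1) by (simp add: field_simps)
      qed
      finally have "b n \<le> real n * (b k / real k) + C" by simp
      then have "b n / real n \<le> b k / real k + C / real n" using n1 by (simp add: field_simps)
      also have "C / real n \<le> C / real N" using n N(1) Cn by (intro divide_left_mono) auto
      finally have "b n / real n < L + e" using k(2) N(2) by linarith
      moreover have "L \<le> b n / real n"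
        unfolding L_def using A(2) n N(1) by (intro cInf_lower) (auto simp: A_def)
      ultimately show "norm (b n / real n - L) < e" by simp
    qed
  qed
  then show ?thesis by (rule convergentI)
qed

section \<open>Balls in Cayley graphs\<close>

context group
begin

lemma cayley_edges_left:
  assumes "(x, y) \<in> cayley_edges G S ^^ n" "g \<in> carrier G" "S \<subseteq> carrier G"
  shows "(g \<otimes> x, g \<otimes> y) \<in> cayley_edges G S ^^ n"
  using assms(1)
proof (induction n arbitrary: y)
  case (Suc n)
  then obtain z where z: "(x, z) \<in> cayley_edges G S ^^ n" "(z, y) \<in> cayley_edges G S" by auto
  have "(g \<otimes> z, g \<otimes> y) \<in> cayley_edges G S"
    using z(2) assms(2,3) unfolding cayley_edges_def by (auto simp: m_assoc subset_iff)
  then show ?case using Suc.IH[OF z(1)] by auto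
qed simp

lemma cayley_path_carrier: "(x, y) \<in> cayley_edges G S ^^ n \<Longrightarrow> x \<in> carrier G \<Longrightarrow> y \<in> carrier G"
proof (induction n)
  case (Suc n)
  then obtain z where "(z, y) \<in> cayley_edges G S" by auto
  then show ?case unfolding cayley_edges_def by blast
qed simp

lemma cayley_ball_carrier: "cayley_ball G n S \<subseteq> carrier G"
  unfolding cayley_ball_def using cayley_path_carrier by blast

lemma cayley_ball_mult:
  assumes "S \<subseteq> carrier G" "x \<in> cayley_ball G m S" "y \<in> cayley_ball G n S"
  shows "x \<otimes> y \<in> cayley_ball G (m + n) S"
proof -
  obtain k where k: "k \<le> m" "(\<one>, x) \<in> cayley_edges G S ^^ k" using assms(2) by (auto simp: cayley_ball_def)
  obtain l where l: "l \<le> n" "(\<one>, y) \<in> cayley_edges G S ^^ l" using assms(3) by (auto simp: cayley_ball_def)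
  have x: "x \<in> carrier G" using assms(2) cayley_ball_carrier by blast
  have "(x \<otimes> \<one>, x \<otimes> y) \<in> cayley_edges G S ^^ l" by (rule cayley_edges_left[OF l(2) x assms(1)])
  then have "(\<one>, x \<otimes> y) \<in> cayley_edges G S ^^ (k + l)" using k(2) x by (auto simp: relpow_add)
  then show ?thesis using k(1) l(1) by (auto simp: cayley_ball_def intro!: exI[of _ "k + l"])
qed

lemma cayley_ball_add:
  assumes "S \<subseteq> carrier G"
  shows "cayley_ball G (m + n) S \<subseteq> (\<lambda>(x, y). x \<otimes> y) ` (cayley_ball G m S \<times> cayley_ball G n S)"
proof
  fix w assume "w \<in> cayley_ball G (m + n) S"
  then obtain k where k: "k \<le> m + n" "(\<one>, w) \<in> cayley_edges G S ^^ k" by (auto simp: cayley_ball_def)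
  define l where "l = min k m"
  have "k = l + (k - l)" by (simp add: l_def)
  then have "(\<one>, w) \<in> (cayley_edges G S ^^ l) O (cayley_edges G S ^^ (k - l))" using k(2) by (metis relpow_add)
  then obtain z where z: "(\<one>, z) \<in> cayley_edges G S ^^ l" "(z, w) \<in> cayley_edges G S ^^ (k - l)" by blast
  have zc: "z \<in> carrier G" "w \<in> carrier G" using cayley_path_carrier z k(2) by blast+
  have "(inv z \<otimes> z, inv z \<otimes> w) \<in> cayley_edges G S ^^ (k - l)"
    by (rule cayley_edges_left[OF z(2) _ assms]) (use zc in simp)
  then have "(\<one>, inv z \<otimes> w) \<in> cayley_edges G S ^^ (k - l)" using zc by simp
  moreover have "k - l \<le> n" using k(1) by (simp add: l_def)
  ultimately have "inv z \<otimes> w \<in> cayley_ball G n S" unfolding cayley_ball_def by blast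
  moreover have "z \<in> cayley_ball G m S" using z(1) unfolding cayley_ball_def l_def by (auto intro: exI[of _ "min k m"])
  moreover have "w = z \<otimes> (inv z \<otimes> w)" using zc by (simp add: m_assoc[symmetric])
  ultimately show "w \<in> (\<lambda>(x, y). x \<otimes> y) ` (cayley_ball G m S \<times> cayley_ball G n S)" by force
qed

lemma finite_cayley_ball:
  assumes "finite S" "S \<subseteq> carrier G"
  shows "finite (cayley_ball G n S)"
proof -
  have nb: "finite {y. (x, y) \<in> cayley_edges G S}" for x
  proof (rule finite_subset)
    show "{y. (x, y) \<in> cayley_edges G S} \<subseteq> (\<lambda>s. x \<otimes> s) ` S \<union> (\<lambda>s. x \<otimes> inv s) ` S"
      using assms(2) by (auto simp: cayley_edges_def m_assoc subset_iff intro!: image_eqI)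
  qed (use assms(1) in simp)
  have "finite {y. (\<one>, y) \<in> cayley_edges G S ^^ k}" for k
  proof (induction k)
    case (Suc k)
    have "{y. (\<one>, y) \<in> cayley_edges G S ^^ Suc k}
        = (\<Union>x\<in>{x. (\<one>, x) \<in> cayley_edges G S ^^ k}. {y. (x, y) \<in> cayley_edges G S})" by auto
    then show ?case using Suc nb by simp
  qed simp
  moreover have "cayley_ball G n S = (\<Union>k\<le>n. {y. (\<one>, y) \<in> cayley_edges G S ^^ k})"
    by (auto simp: cayley_ball_def)
  ultimately show ?thesis by simp
qed

lemma one_in_cayley_ball: "\<one> \<in> cayley_ball G n S"
  unfolding cayley_ball_def by (auto intro: exI[of _ 0])

text \<open>Ball sizes are submultiplicative, so \<open>fekete\<close> applies to their logarithms;
  the limit is then estimated along the radii \<open>N * Suc m\<close>.\<close>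

lemma growth_rate_ge:
  assumes S: "finite S" "S \<subseteq> carrier G" and N: "N \<ge> 1"
    and W: "\<And>m. 2 ^ m \<le> card (cayley_ball G (N * m) S)"
  shows "root N 2 \<le> growth_rate G S"
proof -
  define a where "a n = real (card (cayley_ball G n S))" for n
  have pos: "1 \<le> a n" for n
    using one_in_cayley_ball finite_cayley_ball[OF S, of n] card_gt_0_iff[of "cayley_ball G n S"]
    unfolding a_def by fastforce
  have sub: "a (m + n) \<le> a m * a n" for m n
  proof -
    have "card (cayley_ball G (m + n) S) \<le> card (cayley_ball G m S \<times> cayley_ball G n S)"
      using finite_cayley_ball[OF S] by (intro surj_card_le[OF _ cayley_ball_add[OF S(2)]]) simp
    then show ?thesis unfolding a_def card_cartesian_product by (metis of_nat_le_iff of_nat_mult)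
  qed
  have "convergent (\<lambda>n. ln (a n) / real n)"
  proof (rule fekete)
    show "0 \<le> ln (a n)" for n using pos[of n] by simp
    show "ln (a (m + n)) \<le> ln (a m) + ln (a n)" for m n
    proof -
      have p: "0 < a k" for k using pos[of k] by linarith
      then have "ln (a (m + n)) \<le> ln (a m * a n)" using sub[of m n] by simp
      then show ?thesis using p[of m] p[of n] by (simp add: ln_mult)
    qed
  qed
  then obtain l where "(\<lambda>n. ln (a n) / real n) \<longlonglongrightarrow> l" by (auto simp: convergent_def)
  then have "(\<lambda>n. exp (ln (a n) / real n)) \<longlonglongrightarrow> exp l" by (rule tendsto_exp)
  moreover have "eventually (\<lambda>n. exp (ln (a n) / real n) = root n (a n)) sequentially"
  proof (rule eventually_sequentiallyI[of 1])
    fix n :: nat assume n: "1 \<le> n"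
    have "0 < a n" using pos[of n] by linarith
    then show "exp (ln (a n) / real n) = root n (a n)"
      using n by (simp add: root_powr_inverse powr_def divide_inverse mult.commute)
  qed
  ultimately have lim: "(\<lambda>n. root n (a n)) \<longlonglongrightarrow> exp l" by (rule Lim_transform_eventually)
  then have gr: "growth_rate G S = exp l" unfolding growth_rate_def a_def by (rule limI)
  \<comment> \<open>\<open>Suc m\<close> keeps the radius positive, since \<open>root 0\<close> is
    constantly 0.\<close>
  have "strict_mono (\<lambda>m. N * Suc m)" using N by (auto simp: strict_mono_def)
  then have "((\<lambda>n. root n (a n)) \<circ> (\<lambda>m. N * Suc m)) \<longlonglongrightarrow> exp l" by (rule LIMSEQ_subseq_LIMSEQ[OF lim])
  moreover have "root N 2 \<le> ((\<lambda>n. root n (a n)) \<circ> (\<lambda>m. N * Suc m)) m" for m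
  proof -
    have "root (N * Suc m) (2 ^ Suc m) \<le> root (N * Suc m) (a (N * Suc m))"
    proof (rule real_root_le_mono)
      show "2 ^ Suc m \<le> a (N * Suc m)" using W[of "Suc m"] unfolding a_def by (metis of_nat_le_iff of_nat_numeral of_nat_power)
    qed (use N in simp)
    moreover have "root (N * Suc m) (2 ^ Suc m) = root N 2"
      using real_root_power_cancel[of "Suc m" 2] by (simp only: real_root_mult_exp)
    ultimately show ?thesis by simp
  qed
  ultimately show ?thesis unfolding gr by (intro LIMSEQ_le_const) auto
qed

end

subsection \<open>Transfer to the Higman group\<close>

locale higman_subgroup =
  fixes K :: "4 group_word set set"
  assumes K: "subgroup K higman_group"
begin

abbreviation HK where "HK \<equiv> higman_group\<lparr>carrier := K\<rparr>"

sublocale KG: group HK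
  by (rule H.subgroup_imp_group[OF K])

lemma inv_HK: "x \<in> K \<Longrightarrow> inv\<^bsub>HK\<^esub> x = inv\<^bsub>higman_group\<^esub> x"
  by (rule H.m_inv_consistent[OF K])

lemma K_carrier: "x \<in> K \<Longrightarrow> x \<in> carrier higman_group"
  using subgroup.mem_carrier[OF K] .

lemma Rep_gen:
  assumes "S \<subseteq> K" "generate HK S = K"
  shows "Rep_hig ` gen (Abs_hig ` S) = K"
proof
  have R: "Rep_hig (Abs_hig s) = s" if "s \<in> K" for s using Abs_hig_inverse K_carrier[OF that] by simp
  show "Rep_hig ` gen (Abs_hig ` S) \<subseteq> K"
  proof clarify
    fix x assume "x \<in> gen (Abs_hig ` S)"
    then show "Rep_hig x \<in> K"
    proof induction
      case zero
      then show ?case using subgroup.one_closed[OF K] by (simp add: zero_hig.rep_eq)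
    next
      case (base s)
      then show ?case using assms(1) R by auto
    next
      case (add x y)
      then show ?case using subgroup.m_closed[OF K] by (simp add: plus_hig.rep_eq)
    next
      case (uminus x)
      then show ?case using subgroup.m_inv_closed[OF K] by (simp add: uminus_hig.rep_eq)
    qed
  qed
  show "K \<subseteq> Rep_hig ` gen (Abs_hig ` S)"
  proof
    fix k assume "k \<in> K"
    then have "k \<in> generate HK S" using assms(2) by simp
    then show "k \<in> Rep_hig ` gen (Abs_hig ` S)"
    proof induction
      case one
      show ?case by (intro image_eqI[of _ _ 0]) (simp_all add: zero_hig.rep_eq gen.zero)
    next
      case (incl s)
      then show ?case using assms(1) R by (intro image_eqI[of _ _ "Abs_hig s"]) (auto intro: gen.base)
    next
      case (inv s)
      then have s: "s \<in> K" using assms(1) by blast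
      then show ?case using inv R[OF s] inv_HK[OF s]
        by (intro image_eqI[of _ _ "- Abs_hig s"]) (auto simp: uminus_hig.rep_eq intro: gen.base gen.uminus)
    next
      case (eng g h)
      then obtain x y where "x \<in> gen (Abs_hig ` S)" "y \<in> gen (Abs_hig ` S)" "g = Rep_hig x" "h = Rep_hig y" by blast
      then show ?case by (intro image_eqI[of _ _ "x + y"]) (simp_all add: plus_hig.rep_eq gen.add)
    qed
  qed
qed

lemma Rep_zmul:
  assumes x: "Rep_hig x \<in> K"
  shows "Rep_hig (zmul k x) = Rep_hig x [^]\<^bsub>HK\<^esub> k"
proof (induction k rule: int_induct[where k = 0])
  case base
  then show ?case by (simp add: zero_hig.rep_eq)
next
  case (step1 i)
  have "Rep_hig x [^]\<^bsub>HK\<^esub> (i + 1) = Rep_hig x [^]\<^bsub>HK\<^esub> (1 + i)" by (simp add: add.commute)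
  also have "\<dots> = Rep_hig x \<otimes>\<^bsub>HK\<^esub> Rep_hig x [^]\<^bsub>HK\<^esub> i"
    using KG.int_pow_mult[of "Rep_hig x" 1 i] x KG.int_pow_1[of "Rep_hig x"] by simp
  finally show ?case using step1 by (simp add: zmul_succ plus_hig.rep_eq)
next
  case (step2 i)
  have "Rep_hig x [^]\<^bsub>HK\<^esub> (i - 1) = Rep_hig x [^]\<^bsub>HK\<^esub> ((- 1) + i)" by simp
  also have "\<dots> = inv\<^bsub>HK\<^esub> (Rep_hig x) \<otimes>\<^bsub>HK\<^esub> Rep_hig x [^]\<^bsub>HK\<^esub> i"
    using KG.int_pow_mult[of "Rep_hig x" "-1" i] x KG.int_pow_neg[of "Rep_hig x" 1] KG.int_pow_1[of "Rep_hig x"] by simp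
  finally show ?case using step2 inv_HK[OF x] by (simp add: zmul_pred plus_hig.rep_eq uminus_hig.rep_eq)
qed

lemma word_ball_cayley:
  assumes S: "S \<subseteq> K" and x: "x \<in> word_ball (Abs_hig ` S) n"
  shows "Rep_hig x \<in> cayley_ball HK n S"
proof -
  have R: "Rep_hig (Abs_hig s) = s" if "s \<in> S" for s using Abs_hig_inverse K_carrier S that by blast
  have SK: "S \<subseteq> carrier HK" using S by simp
  have one: "Rep_hig s \<in> cayley_ball HK 1 S" if s: "s \<in> Abs_hig ` S \<union> uminus ` Abs_hig ` S" for s
  proof -
    obtain t where t: "t \<in> S" "s = Abs_hig t \<or> s = - Abs_hig t" using s by blast
    then have Rs: "Rep_hig s = t \<or> Rep_hig s = inv\<^bsub>HK\<^esub> t"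
      using R[OF t(1)] inv_HK[of t] S by (auto simp: uminus_hig.rep_eq)
    have tK: "t \<in> carrier HK" using t(1) SK by blast
    have "(\<one>\<^bsub>HK\<^esub>, t) \<in> cayley_edges HK S" "(\<one>\<^bsub>HK\<^esub>, inv\<^bsub>HK\<^esub> t) \<in> cayley_edges HK S"
      using t(1) tK KG.one_closed KG.inv_closed[OF tK] KG.l_one[OF tK] KG.l_inv[OF tK]
      unfolding cayley_edges_def by fastforce+
    then have "(\<one>\<^bsub>HK\<^esub>, Rep_hig s) \<in> cayley_edges HK S ^^ 1" using Rs by auto
    then show ?thesis unfolding cayley_ball_def by blast
  qed
  have "Rep_hig (sum_list ws) \<in> cayley_ball HK (length ws) S"
    if "set ws \<subseteq> Abs_hig ` S \<union> uminus ` Abs_hig ` S" for ws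
    using that
  proof (induction ws)
    case Nil
    then show ?case using KG.one_in_cayley_ball[of 0 S] by (simp add: zero_hig.rep_eq)
  next
    case (Cons w ws)
    then have "Rep_hig w \<otimes>\<^bsub>HK\<^esub> Rep_hig (sum_list ws) \<in> cayley_ball HK (1 + length ws) S"
      by (intro KG.cayley_ball_mult[OF SK] one) auto
    then show ?case by (simp add: plus_hig.rep_eq)
  qed
  moreover obtain ws where ws: "x = sum_list ws" "length ws \<le> n" "set ws \<subseteq> Abs_hig ` S \<union> uminus ` Abs_hig ` S"
    using x unfolding word_ball_def by blast
  ultimately have "Rep_hig x \<in> cayley_ball HK (length ws) S" by blast
  then show ?thesis using ws(2) unfolding cayley_ball_def by (auto intro: order.trans)
qed

lemma growth_if_short_free_pair:
  assumes S: "finite S" "S \<subseteq> K" and free: "short_free_pair (Abs_hig ` S)"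
  shows "root 4 2 \<le> growth_rate HK S"
proof -
  obtain u v where uv: "u \<in> word_ball (Abs_hig ` S) 4" "v \<in> word_ball (Abs_hig ` S) 4" "free_pair u v"
    using free unfolding short_free_pair_def by blast
  define ev where "ev bs = sum_list (map (\<lambda>b. if b then u else v) bs)" for bs
  have ball: "ev bs \<in> word_ball (Abs_hig ` S) (4 * length bs)" for bs
  proof (induction bs)
    case Nil
    then show ?case unfolding word_ball_def ev_def by (intro CollectI exI[of _ "[]"]) simp
  next
    case (Cons b bs)
    have "(if b then u else v) + ev bs \<in> word_ball (Abs_hig ` S) (4 + 4 * length bs)"
      using uv(1,2) Cons by (intro word_ball_add) auto
    then show ?case by (simp add: ev_def)
  qed
  have SK: "S \<subseteq> carrier HK" using S(2) by simp
  show ?thesis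
  proof (rule KG.growth_rate_ge[OF S(1) SK])
    fix m
    let ?B = "{bs :: bool list. length bs = m}"
    have "inj_on (Rep_hig \<circ> ev) ?B"
      using uv(3) unfolding free_pair_def ev_def inj_on_def by (auto simp: Rep_hig_inject)
    then have "card ((Rep_hig \<circ> ev) ` ?B) = card ?B" by (rule card_image)
    also have "card ?B = 2 ^ m" using card_lists_length_eq[of "UNIV :: bool set" m] by simp
    finally have "2 ^ m = card ((Rep_hig \<circ> ev) ` ?B)" by simp
    also have "\<dots> \<le> card (cayley_ball HK (4 * m) S)"
      using word_ball_cayley[OF S(2) ball] by (intro card_mono KG.finite_cayley_ball[OF S(1) SK]) auto
    finally show "2 ^ m \<le> card (cayley_ball HK (4 * m) S)" .
  qed simp
qed

lemma growth_or_cyclic: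
  assumes "\<not> cyclic_group HK" "finite_generating_set HK S"
  shows "root 4 2 \<le> growth_rate HK S"
proof -
  have S: "finite S" "S \<subseteq> K" "generate HK S = K" using assms(2) by (auto simp: finite_generating_set_def)
  have "\<not> (\<exists>x\<in>gen (Abs_hig ` S). gen (Abs_hig ` S) = range (\<lambda>k. zmul k x))"
  proof
    assume "\<exists>x\<in>gen (Abs_hig ` S). gen (Abs_hig ` S) = range (\<lambda>k. zmul k x)"
    then obtain x where x: "x \<in> gen (Abs_hig ` S)" "gen (Abs_hig ` S) = range (\<lambda>k. zmul k x)" by blast
    then have xK: "Rep_hig x \<in> K" using Rep_gen[OF S(2,3)] by blast
    have "K = Rep_hig ` range (\<lambda>k. zmul k x)" using Rep_gen[OF S(2,3)] x(2) by simp
    also have "\<dots> = range (\<lambda>k::int. Rep_hig x [^]\<^bsub>HK\<^esub> k)" by (simp add: image_image Rep_zmul[OF xK])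
    finally have "cyclic_group HK" unfolding KG.cyclic_group using xK by auto
    then show False using assms(1) by blast
  qed
  then have "short_free_pair (Abs_hig ` S)" using higman_alternative S(1) by blast
  then show ?thesis by (rule growth_if_short_free_pair[OF S(1,2)])
qed

end

theorem theorem6p2:
  fixes K :: "4 group_word set set"
  assumes "subgroup K higman_group"
    and "finitely_generated_group (higman_group\<lparr>carrier := K\<rparr>)"
  shows "cyclic_group (higman_group\<lparr>carrier := K\<rparr>) \<or>
    uniform_exponential_growth (higman_group\<lparr>carrier := K\<rparr>) \<and>
    uniform_growth_rate (higman_group\<lparr>carrier := K\<rparr>) \<ge> root 600 2"
proof (cases "cyclic_group (higman_group\<lparr>carrier := K\<rparr>)")
  case False
  interpret higman_subgroup K by (rule higman_subgroup.intro[OF assms(1)])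
  \<comment> \<open>The argument yields the fourth root of 2; the exponent 600 is reached by
    monotonicity.\<close>
  have "root 600 2 \<le> root 4 (2 :: real)" by (rule real_root_decreasing) simp_all
  then have "root 600 2 \<le> growth_rate HK S" if "finite_generating_set HK S" for S
    using growth_or_cyclic[OF False that] by linarith
  \<comment> \<open>Makes the set of growth rates nonempty, as \<open>cInf_greatest\<close>
    requires.\<close>
  moreover have "\<exists>S. finite_generating_set HK S" using assms(2) by (simp add: finitely_generated_group_def)
  ultimately have "root 600 2 \<le> uniform_growth_rate HK"
    unfolding uniform_growth_rate_def by (intro cInf_greatest) auto
  moreover have "1 < root 600 (2 :: real)" by simp
  ultimately show ?thesis unfolding uniform_exponential_growth_def by linarith
qed simp

end
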